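(* Let $V\in L^{3/2}(\mathbb{R}^3)\cap L^1(\mathbb{R}^3)$ be real-valued and let $\mu>0$. Assume that $e_\mu(V)<0$. Then $T_c(\lambda V)$ is non-zero for all $\lambda>0$, and $$\lim_{\lambda\to0}\lambda\,\ln\frac{\mu}{T_c(\lambda V)}=-\frac{1}{\sqrt{\mu}\,e_\mu(V)}.$$
   Context: Fourier transform: $\hat V(p)=(2\pi)^{-3/2}\int_{\mathbb{R}^3}V(x)e^{-ip\cdot x}dx$. Here $\lambda>0$ is a coupling parameter and $\lambda\to0$ means $\lambda\downarrow0$. For $T>0$, $K_T$ is the operator on $L^2(\mathbb{R}^3)$ acting as multiplication in Fourier space by $K_T(p)=\dfrac{p^2-\mu}{\tanh\frac{p^2-\mu}{2T}}$. The critical temperature of a real potential $U$ (at chemical potential $\mu$) is $$T_c(U)=\inf\{T>0\,:\,K_T+U\ge0\},$$ where $U$ acts by multiplication in configuration space and the sum is understood in the sense of quadratic forms. Let $\Omega\subset\mathbb{R}^3$ be the unit $2$-sphere with Lebesgue (surface) measure $d\omega$. The operator $\mathcal{V}_\mu:L^2(\Omega)\to L^2(\Omega)$ is $$(\mathcal{V}_\mu u)(p)=\frac{1}{(2\pi)^{3/2}}\int_\Omega\hat V(\sqrt\mu(p-q))\,u(q)\,d\omega(q),$$ and $e_\mu(V)=\inf\operatorname{spec}\mathcal{V}_\mu$. *)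

theory Defs
  imports "HOL-Analysis.Analysis"
begin

text \<open>
  Elements of \<open>L\<^sup>p\<close> are represented by functions; almost everywhere equal functions are not
  identified, so equations between elements of \<open>L\<^sup>p\<close> are stated almost everywhere.
\<close>

definition Lp_space :: "real \<Rightarrow> 'a measure \<Rightarrow> ('a \<Rightarrow> 'b::{banach, second_countable_topology}) set"
  where "Lp_space p M = {f \<in> borel_measurable M. integrable M (\<lambda>x. norm (f x) powr p)}"

definition Lp_norm :: "real \<Rightarrow> 'a measure \<Rightarrow> ('a \<Rightarrow> 'b::{banach, second_countable_topology}) \<Rightarrow> real"
  where "Lp_norm p M f = (LINT x|M. norm (f x) powr p) powr (1 / p)"

definition fourier :: "(real^3 \<Rightarrow> complex) \<Rightarrow> real^3 \<Rightarrow> complex"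
  where "fourier f p =
    complex_of_real ((2 * pi) powr (- 3 / 2)) *
    (LINT x|lebesgue. f x * exp (- \<i> * complex_of_real (p \<bullet> x)))"

text \<open>
  The Fourier--Plancherel transform on \<open>L\<^sup>2\<close> as a relation: \<open>g\<close> is the \<open>L\<^sup>2\<close>-limit of the
  Fourier integrals of \<open>f\<close> truncated to balls of radius \<open>n\<close>. The distance is a nonnegative
  (extended) integral, because a Bochner integral would be 0 if it diverged.
\<close>

definition is_fourier_L2 :: "(real^3 \<Rightarrow> complex) \<Rightarrow> (real^3 \<Rightarrow> complex) \<Rightarrow> bool"
  where "is_fourier_L2 f g \<longleftrightarrow>
    f \<in> Lp_space 2 lebesgue \<and> g \<in> Lp_space 2 lebesgue \<and>
    (\<lambda>n::nat. \<integral>\<^sup>+p. ennreal ((cmod (fourier (\<lambda>x. indicator (cball 0 (real n)) x * f x) p - g p))\<^sup>2)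
       \<partial>lebesgue) \<longlonglongrightarrow> 0"

text \<open>The value \<open>2 * T\<close> on the sphere \<open>p\<^sup>2 = \<mu>\<close> is the continuous extension.\<close>

definition K_symbol :: "real \<Rightarrow> real \<Rightarrow> real^3 \<Rightarrow> real"
  where "K_symbol \<mu> T p =
    (if (norm p)\<^sup>2 = \<mu> then 2 * T
     else ((norm p)\<^sup>2 - \<mu>) / tanh (((norm p)\<^sup>2 - \<mu>) / (2 * T)))"

text \<open>
  \<open>K\<^sub>T + U \<ge> 0\<close> as quadratic forms, on the intersection of the form domains of \<open>K\<^sub>T\<close> and \<open>U\<close>.
  The form domain of \<open>K\<^sub>T\<close> is \<open>H\<^sup>1\<close>; if \<open>U\<close> is in \<open>L\<^sup>3\<^sup>/\<^sup>2\<close> it is contained in that of \<open>U\<close>.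
\<close>

definition K_plus_nonneg :: "real \<Rightarrow> real \<Rightarrow> (real^3 \<Rightarrow> real) \<Rightarrow> bool"
  where "K_plus_nonneg \<mu> T U \<longleftrightarrow>
    (\<forall>\<psi> \<psi>h. is_fourier_L2 \<psi> \<psi>h \<longrightarrow>
       integrable lebesgue (\<lambda>p. K_symbol \<mu> T p * (cmod (\<psi>h p))\<^sup>2) \<longrightarrow>
       integrable lebesgue (\<lambda>x. U x * (cmod (\<psi> x))\<^sup>2) \<longrightarrow>
       0 \<le> (LINT p|lebesgue. K_symbol \<mu> T p * (cmod (\<psi>h p))\<^sup>2)
            + (LINT x|lebesgue. U x * (cmod (\<psi> x))\<^sup>2))"

text \<open>The infimum of the empty set of reals is unspecified; for \<open>U\<close> in \<open>L\<^sup>3\<^sup>/\<^sup>2\<close> the set is nonempty.\<close>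

definition critical_temperature :: "real \<Rightarrow> (real^3 \<Rightarrow> real) \<Rightarrow> real"
  where "critical_temperature \<mu> U = Inf {T. T > 0 \<and> K_plus_nonneg \<mu> T U}"

text \<open>
  Surface measure on the unit sphere: the measure of \<open>A\<close> is 3 times the volume of the cone
  \<open>{t *\<^sub>R \<omega> | t \<omega>. 0 < t \<and> t \<le> 1 \<and> \<omega> \<in> A}\<close>, by integration in polar coordinates.
\<close>

definition sphere_measure :: "(real^3) measure"
  where "sphere_measure =
    scale_measure 3
      (distr (restrict_space lborel (cball 0 1 - {0})) (restrict_space borel (sphere 0 1))
        (\<lambda>x. x /\<^sub>R norm x))"

definition sphere_op :: "real \<Rightarrow> (real^3 \<Rightarrow> real) \<Rightarrow> (real^3 \<Rightarrow> complex) \<Rightarrow> real^3 \<Rightarrow> complex"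
  where "sphere_op \<mu> V u p =
    complex_of_real (1 / (2 * pi) powr (3 / 2)) *
    (LINT q|sphere_measure. fourier (\<lambda>x. complex_of_real (V x)) (sqrt \<mu> *\<^sub>R (p - q)) * u q)"

text \<open>
  \<open>z\<close> is in the resolvent set of a bounded linear operator \<open>A\<close> on \<open>L\<^sup>2\<close> iff \<open>A - z\<close> has a bounded
  two-sided inverse \<open>R\<close>. Linearity of \<open>R\<close>, and its compatibility with almost everywhere equality,
  follow from the stated conditions.
\<close>

definition L2_resolvent_set :: "'a measure \<Rightarrow> (('a \<Rightarrow> complex) \<Rightarrow> 'a \<Rightarrow> complex) \<Rightarrow> complex set"
  where "L2_resolvent_set M A =
    {z. \<exists>R C. \<forall>f \<in> Lp_space 2 M.
          R f \<in> Lp_space 2 M \<and> Lp_norm 2 M (R f) \<le> C * Lp_norm 2 M f \<and>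
          (AE x in M. A (R f) x - z * R f x = f x) \<and>
          (AE x in M. R (\<lambda>y. A f y - z * f y) x = f x)}"

definition L2_spectrum :: "'a measure \<Rightarrow> (('a \<Rightarrow> complex) \<Rightarrow> 'a \<Rightarrow> complex) \<Rightarrow> complex set"
  where "L2_spectrum M A = - L2_resolvent_set M A"

text \<open>For real \<open>V\<close> the operator is self-adjoint, so its spectrum is real.\<close>

definition e_inf :: "real \<Rightarrow> (real^3 \<Rightarrow> real) \<Rightarrow> real"
  where "e_inf \<mu> V = Inf {r. complex_of_real r \<in> L2_spectrum sphere_measure (sphere_op \<mu> V)}"

end

theory Submission
  imports Defs "HOL-Probability.Probability" "HOL-Real_Asymp.Real_Asymp"
begin

text \<open>
  Put \<open>k = sqrt \<mu>\<close> and \<open>e = e_inf \<mu> V\<close>. The integral of \<open>1 / K_symbol \<mu> T\<close> over a thin shell around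
  the sphere of radius \<open>k\<close>, divided by the area of the unit sphere, is \<open>m = k ln (1 / T) + o(ln (1 / T))\<close>
  as \<open>T \<rightarrow> 0\<close>. For \<open>\<psi>\<close> with frequencies in the shell, the potential energy is, up to a small
  multiple of \<open>(\<integral>\<bar>\<psi>h\<bar>)\<^sup>2\<close>, the quadratic form of \<open>sphere_op \<mu> V\<close> at the radial integral \<open>u\<close> of
  \<open>\<psi>h\<close>, and by Cauchy--Schwarz \<open>\<parallel>u\<parallel>\<^sup>2\<close> is at most \<open>m\<close> times the kinetic energy, with equality
  when \<open>\<psi>h\<close> is \<open>u / (m K_symbol \<mu> T)\<close>. As \<open>e\<close> is the infimum of the numerical range, the total energy
  at coupling \<open>\<lambda>\<close> changes sign at \<open>\<lambda> m e = - 1\<close> up to small errors. Frequencies outside the shell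
  have kinetic energy at least a multiple of \<open>p\<^sup>2\<close>, so by the Sobolev inequality their contribution, and
  by Young's inequality the cross term, is negligible for small \<open>\<lambda>\<close>.
\<close>

section \<open>Square-integrable functions and translations\<close>

text \<open>The factor \<open>k\<close> in \<open>m\<close>: each side of the sphere contributes the
  integral of \<open>k * k / (2 * k * \<bar>r - k\<bar>)\<close>, that is, half of
  \<open>k * ln (1 / T)\<close>; the temperature merely cuts the logarithm off at a distance of
  order \<open>T\<close>. Both bounds are variational, so no Birman--Schwinger operator and no
  square root of \<open>V\<close> appear; the operator on the sphere enters only through the bottom
  of its numerical range, which has to be identified with that of its spectrum. The critical
  temperature is an infimum: an upper bound needs nonnegativity at a single temperature, a lower
  bound a negative direction at every smaller one. The small parameters are chosen in the order
  tolerance, shell width, Young parameter, coupling. This order is forced, as the constant for the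
  far frequencies diverges when the shell width or the Young parameter tends to 0; only a small
  coupling compensates it. The \<mu> inside the logarithm of the theorem adds only \<lambda> ln
  \<mu>, which vanishes in the limit.\<close>

abbreviation L2 :: "'a measure \<Rightarrow> ('a \<Rightarrow> complex) set"
  where "L2 M \<equiv> Lp_space 2 M"

text \<open>As a Bochner integral it is 0 when \<open>f\<close> is not square integrable, which is
  why membership in \<open>L2\<close> is carried along.\<close>

definition sqnorm :: "'a measure \<Rightarrow> ('a \<Rightarrow> complex) \<Rightarrow> real"
  where "sqnorm M f = (LINT x|M. (cmod (f x))\<^sup>2)"

lemma borel_measurable_cnj [measurable (raw)]:
  "f \<in> borel_measurable M \<Longrightarrow> (\<lambda>x. cnj (f x)) \<in> borel_measurable M"
  by (rule borel_measurable_continuous_on[OF continuous_on_cnj[OF continuous_on_id]])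

lemma L2_iff: "f \<in> L2 M \<longleftrightarrow> f \<in> borel_measurable M \<and> integrable M (\<lambda>x. (cmod (f x))\<^sup>2)"
  by (auto simp: Lp_space_def powr_numeral)

lemma Lp_norm_2: "Lp_norm 2 M f = sqrt (sqnorm M f)"
  by (simp add: Lp_norm_def sqnorm_def powr_numeral powr_half_sqrt)

lemma L2_measurable: "f \<in> L2 M \<Longrightarrow> f \<in> borel_measurable M"
  by (simp add: L2_iff)

lemma L2_integrable_sq: "f \<in> L2 M \<Longrightarrow> integrable M (\<lambda>x. (cmod (f x))\<^sup>2)"
  by (simp add: L2_iff)

lemma sqnorm_nonneg [simp]: "0 \<le> sqnorm M f"
  by (simp add: sqnorm_def)

lemma nn_integral_sqnorm:
  "f \<in> L2 M \<Longrightarrow> (\<integral>\<^sup>+x. ennreal ((cmod (f x))\<^sup>2) \<partial>M) = ennreal (sqnorm M f)"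
  unfolding sqnorm_def by (subst nn_integral_eq_integral) (auto simp: L2_iff)

lemma L2_I_nn:
  assumes "f \<in> borel_measurable M" "(\<integral>\<^sup>+x. ennreal ((cmod (f x))\<^sup>2) \<partial>M) < \<infinity>"
  shows "f \<in> L2 M"
  using assms by (auto simp: L2_iff integrable_iff_bounded)

lemma L2_bound:
  assumes "g \<in> L2 M" "f \<in> borel_measurable M" "AE x in M. cmod (f x) \<le> C * cmod (g x)"
  shows "f \<in> L2 M"
proof -
  have "integrable M (\<lambda>x. C\<^sup>2 * (cmod (g x))\<^sup>2)" using assms(1) by (simp add: L2_iff)
  then have "integrable M (\<lambda>x. (cmod (f x))\<^sup>2)"
  proof (rule Bochner_Integration.integrable_bound)
    show "(\<lambda>x. (cmod (f x))\<^sup>2) \<in> borel_measurable M" using assms(2) by measurable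
    show "AE x in M. norm ((cmod (f x))\<^sup>2) \<le> norm (C\<^sup>2 * (cmod (g x))\<^sup>2)"
      using assms(3)
    proof eventually_elim
      case (elim x)
      then have "(cmod (f x))\<^sup>2 \<le> (C * cmod (g x))\<^sup>2" by (intro power_mono) auto
      then show ?case by (simp add: power_mult_distrib)
    qed
  qed
  then show ?thesis using assms(2) by (simp add: L2_iff)
qed

lemma L2_scale: "f \<in> L2 M \<Longrightarrow> (\<lambda>x. c * f x) \<in> L2 M"
  by (rule L2_bound[where C = "cmod c" and g = f]) (auto simp: L2_iff norm_mult)

lemma sqnorm_scale: "sqnorm M (\<lambda>x. c * f x) = (cmod c)\<^sup>2 * sqnorm M f"
  by (simp add: sqnorm_def norm_mult power_mult_distrib)

lemma cmod_add_sq: "(cmod (a + b))\<^sup>2 \<le> 2 * (cmod a)\<^sup>2 + 2 * (cmod b)\<^sup>2"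
proof -
  have "(cmod (a + b))\<^sup>2 \<le> (cmod a + cmod b)\<^sup>2" by (intro power_mono norm_triangle_ineq) auto
  also have "\<dots> \<le> 2 * (cmod a)\<^sup>2 + 2 * (cmod b)\<^sup>2"
    using zero_le_power2[of "cmod a - cmod b"] unfolding power2_sum power2_diff by linarith
  finally show ?thesis .
qed

lemma L2_add:
  assumes "f \<in> L2 M" "g \<in> L2 M" shows "(\<lambda>x. f x + g x) \<in> L2 M"
proof -
  have [measurable]: "f \<in> borel_measurable M" "g \<in> borel_measurable M" using assms by (auto simp: L2_iff)
  have "integrable M (\<lambda>x. 2 * (cmod (f x))\<^sup>2 + 2 * (cmod (g x))\<^sup>2)"
    using assms by (auto simp: L2_iff)
  then have "integrable M (\<lambda>x. (cmod (f x + g x))\<^sup>2)"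
    by (rule Bochner_Integration.integrable_bound) (auto simp: cmod_add_sq)
  then show ?thesis by (simp add: L2_iff)
qed

lemma L2_diff:
  assumes "f \<in> L2 M" "g \<in> L2 M" shows "(\<lambda>x. f x - g x) \<in> L2 M"
  using L2_add[OF assms(1) L2_scale[OF assms(2), of "-1"]] by simp

lemma sqnorm_add_le:
  assumes "f \<in> L2 M" "g \<in> L2 M"
  shows "sqnorm M (\<lambda>x. f x + g x) \<le> 2 * sqnorm M f + 2 * sqnorm M g"
proof -
  have "sqnorm M (\<lambda>x. f x + g x) \<le> (LINT x|M. 2 * (cmod (f x))\<^sup>2 + 2 * (cmod (g x))\<^sup>2)"
    unfolding sqnorm_def using L2_add[OF assms] assms
    by (intro integral_mono) (auto simp: L2_iff cmod_add_sq)
  also have "\<dots> = 2 * sqnorm M f + 2 * sqnorm M g"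
    using assms by (simp add: L2_iff sqnorm_def)
  finally show ?thesis .
qed

lemma L2_prod_integrable:
  assumes "f \<in> L2 M" "g \<in> L2 M"
  shows "integrable M (\<lambda>x. f x * g x)"
proof -
  have [measurable]: "f \<in> borel_measurable M" "g \<in> borel_measurable M" using assms by (auto simp: L2_iff)
  have "integrable M (\<lambda>x. (cmod (f x))\<^sup>2 + (cmod (g x))\<^sup>2)"
    using assms by (auto simp: L2_iff)
  then show ?thesis
  proof (rule Bochner_Integration.integrable_bound)
    have "cmod (f x) * cmod (g x) \<le> (cmod (f x))\<^sup>2 + (cmod (g x))\<^sup>2" for x
    proof -
      have "2 * (cmod (f x) * cmod (g x)) \<le> (cmod (f x))\<^sup>2 + (cmod (g x))\<^sup>2"
        using zero_le_power2[of "cmod (f x) - cmod (g x)"] unfolding power2_diff by linarith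
      moreover have "0 \<le> cmod (f x) * cmod (g x)" by simp
      ultimately show ?thesis by linarith
    qed
    then show "AE x in M. norm (f x * g x) \<le> norm ((cmod (f x))\<^sup>2 + (cmod (g x))\<^sup>2)"
      by (auto simp: norm_mult)
  qed auto
qed

lemma L2_cnj: "f \<in> L2 M \<Longrightarrow> (\<lambda>x. cnj (f x)) \<in> L2 M"
  by (auto simp: L2_iff)

lemma sqnorm_cnj: "sqnorm M (\<lambda>x. cnj (f x)) = sqnorm M f"
  by (simp add: sqnorm_def)

lemma cauchy_schwarz_cmod:
  assumes "f \<in> L2 M" "g \<in> L2 M"
  shows "(LINT x|M. cmod (f x) * cmod (g x))\<^sup>2 \<le> sqnorm M f * sqnorm M g"
proof -
  have [measurable]: "f \<in> borel_measurable M" "g \<in> borel_measurable M" using assms by (auto simp: L2_iff)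
  have int: "integrable M (\<lambda>x. cmod (f x) * cmod (g x))"
    using integrable_norm[OF L2_prod_integrable[OF assms]] by (simp add: norm_mult)
  have "ennreal ((LINT x|M. cmod (f x) * cmod (g x))\<^sup>2) = (ennreal (LINT x|M. cmod (f x) * cmod (g x)))\<^sup>2"
    by (simp add: ennreal_power)
  also have "ennreal (LINT x|M. cmod (f x) * cmod (g x)) = (\<integral>\<^sup>+x. ennreal (cmod (f x)) * ennreal (cmod (g x)) \<partial>M)"
    using int by (subst nn_integral_eq_integral[symmetric]) (auto simp: ennreal_mult)
  also have "\<dots>\<^sup>2 \<le> (\<integral>\<^sup>+x. (ennreal (cmod (f x)))\<^sup>2 \<partial>M) * (\<integral>\<^sup>+x. (ennreal (cmod (g x)))\<^sup>2 \<partial>M)"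
    by (rule Cauchy_Schwarz_nn_integral) auto
  also have "\<dots> = ennreal (sqnorm M f) * ennreal (sqnorm M g)"
    using assms by (simp add: ennreal_power nn_integral_sqnorm)
  also have "\<dots> = ennreal (sqnorm M f * sqnorm M g)" by (simp add: ennreal_mult)
  finally show ?thesis by (subst (asm) ennreal_le_iff) auto
qed

lemma cauchy_schwarz:
  assumes "f \<in> L2 M" "g \<in> L2 M"
  shows "(cmod (LINT x|M. f x * g x))\<^sup>2 \<le> sqnorm M f * sqnorm M g"
proof -
  have "cmod (LINT x|M. f x * g x) \<le> (LINT x|M. cmod (f x) * cmod (g x))"
    using integral_norm_bound[of M "\<lambda>x. f x * g x"] by (simp add: norm_mult)
  then have "(cmod (LINT x|M. f x * g x))\<^sup>2 \<le> (LINT x|M. cmod (f x) * cmod (g x))\<^sup>2"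
    by (intro power_mono) auto
  with cauchy_schwarz_cmod[OF assms] show ?thesis by linarith
qed

lemma sqnorm_diff_expand:
  assumes "f \<in> L2 M" "g \<in> L2 M"
  shows "sqnorm M (\<lambda>x. f x - g x) = sqnorm M f + sqnorm M g - 2 * Re (LINT x|M. cnj (f x) * g x)"
proof -
  have i: "integrable M (\<lambda>x. cnj (f x) * g x)" using L2_prod_integrable[OF L2_cnj[OF assms(1)] assms(2)] .
  have e: "(cmod (f x - g x))\<^sup>2 = (cmod (f x))\<^sup>2 + (cmod (g x))\<^sup>2 - 2 * Re (cnj (f x) * g x)" for x
    by (simp only: cmod_power2) (simp add: power2_eq_square algebra_simps)
  have "integrable M (\<lambda>x. Re (cnj (f x) * g x))" "(LINT x|M. Re (cnj (f x) * g x)) = Re (LINT x|M. cnj (f x) * g x)"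
    using integrable_Re[OF i] integral_Re[OF i] by auto
  then show ?thesis unfolding sqnorm_def e using assms
    by (simp add: L2_iff del: times_complex.sel)
qed

lemma L2_indicator: "f \<in> L2 M \<Longrightarrow> A \<in> sets M \<Longrightarrow> (\<lambda>x. indicator A x * f x) \<in> L2 M"
  by (rule L2_bound[where C = 1 and g = f]) (auto simp: L2_iff norm_mult indicator_def split: if_splits)

lemma L2_AE_cong:
  assumes "f \<in> L2 M" "g \<in> borel_measurable M" "AE x in M. g x = f x"
  shows "g \<in> L2 M" "sqnorm M g = sqnorm M f"
proof -
  show "g \<in> L2 M" using assms by (intro L2_bound[OF assms(1), where C = 1]) auto
  show "sqnorm M g = sqnorm M f" unfolding sqnorm_def
    using assms by (intro integral_cong_AE) (auto simp: L2_iff)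
qed

section \<open>Continuity of translations in L1\<close>

lemma nn_integral_lborel_shift:
  fixes f :: "'a::euclidean_space \<Rightarrow> ennreal"
  assumes [measurable]: "f \<in> borel_measurable borel"
  shows "(\<integral>\<^sup>+x. f (x + h) \<partial>lborel) = (\<integral>\<^sup>+x. f x \<partial>lborel)"
proof -
  have "(\<integral>\<^sup>+x. f x \<partial>lborel) = (\<integral>\<^sup>+x. f x \<partial>distr lborel borel ((+) h))"
    by (subst lborel_distr_plus) simp
  also have "\<dots> = (\<integral>\<^sup>+x. f (h + x) \<partial>lborel)" by (subst nn_integral_distr) auto
  finally show ?thesis by (simp add: add.commute)
qed

lemma integrable_lborel_shift:
  fixes f :: "'a::euclidean_space \<Rightarrow> 'b::{banach, second_countable_topology}"
  assumes "integrable lborel f"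
  shows "integrable lborel (\<lambda>x. f (x + h))"
proof -
  have [measurable]: "f \<in> borel_measurable borel" using assms by auto
  have "(\<lambda>x. f (x + h)) \<in> borel_measurable borel" by measurable
  then show ?thesis
    using assms nn_integral_lborel_shift[of "\<lambda>x. ennreal (norm (f x))" h]
    by (auto simp: integrable_iff_bounded)
qed

lemma integral_lborel_shift:
  fixes f :: "'a::euclidean_space \<Rightarrow> 'b::{banach, second_countable_topology}"
  assumes [measurable]: "f \<in> borel_measurable borel"
  shows "(LINT x|lborel. f (x + h)) = (LINT x|lborel. f x)"
proof -
  have "(LINT x|lborel. f x) = (LINT x|distr lborel borel ((+) h). f x)"
    by (subst lborel_distr_plus) simp
  also have "\<dots> = (LINT x|lborel. f (h + x))" by (subst integral_distr) auto
  finally show ?thesis by (simp add: add.commute)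
qed

text \<open>A point of an open set stays in it under small shifts, so the overlap of
  \<open>U\<close> with its translates tends to the measure of \<open>U\<close> by dominated
  convergence. Boundary points need no care: for indicators
  \<open>\<bar>a - b\<bar> = a + b - 2 * a * b\<close> expresses the distance through the overlap
  and two equal masses.\<close>

lemma open_translation_continuous:
  fixes U :: "'a::euclidean_space set"
  assumes U: "open U" "emeasure lborel U < \<infinity>" and h: "h \<longlonglongrightarrow> 0"
  shows "(\<lambda>n. LINT x|lborel. norm (indicator U (x + h n) - indicator U x :: real)) \<longlonglongrightarrow> 0"
proof -
  have [measurable]: "U \<in> sets borel" using U by auto
  have i: "integrable lborel (indicator U :: 'a \<Rightarrow> real)" using U by (auto simp: integrable_indicator_iff)
  have ish: "integrable lborel (\<lambda>x. indicator U (x + h n) :: real)" for n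
    by (rule integrable_lborel_shift[OF i])
  have ip: "integrable lborel (\<lambda>x. indicator U (x + h n) * indicator U x :: real)" for n
    by (rule Bochner_Integration.integrable_bound[OF i]) (auto simp: indicator_def)
  have "(\<lambda>n. LINT x|lborel. indicator U (x + h n) * indicator U x :: real) \<longlonglongrightarrow> (LINT x|lborel. indicator U x :: real)"
  proof (rule integral_dominated_convergence[where w = "indicator U :: 'a \<Rightarrow> real"])
    show "AE x in lborel. (\<lambda>n. indicator U (x + h n) * indicator U x :: real) \<longlonglongrightarrow> indicator U x"
    proof (rule AE_I2)
      fix x :: 'a
      show "(\<lambda>n. indicator U (x + h n) * indicator U x :: real) \<longlonglongrightarrow> indicator U x"
      proof (cases "x \<in> U")
        case True
        have "(\<lambda>n. x + h n) \<longlonglongrightarrow> x" using tendsto_add[OF tendsto_const h, of x] by simp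
        then have "\<forall>\<^sub>F n in sequentially. x + h n \<in> U" using U(1) True by (rule topological_tendstoD)
        then have "\<forall>\<^sub>F n in sequentially. indicator U (x + h n) * indicator U x = (indicator U x :: real)"
          by eventually_elim (simp add: True)
        then show ?thesis by (rule tendsto_eventually)
      qed simp
    qed
    show "AE x in lborel. norm (indicator U (x + h n) * indicator U x :: real) \<le> indicator U x" for n
      by (auto simp: indicator_def)
  qed (use i in auto)
  then have lim: "(\<lambda>n. 2 * (LINT x|lborel. indicator U x :: real) - 2 * (LINT x|lborel. indicator U (x + h n) * indicator U x :: real)) \<longlonglongrightarrow>
     2 * (LINT x|lborel. indicator U x :: real) - 2 * (LINT x|lborel. indicator U x :: real)"
    by (intro tendsto_intros)
  have "norm (indicator U (x + h n) - indicator U x :: real) = indicator U (x + h n) + indicator U x - 2 * (indicator U (x + h n) * indicator U x)" for x n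
    by (auto simp: indicator_def)
  then have "(LINT x|lborel. norm (indicator U (x + h n) - indicator U x :: real)) =
     2 * (LINT x|lborel. indicator U x :: real) - 2 * (LINT x|lborel. indicator U (x + h n) * indicator U x :: real)" for n
    using i ish[of n] ip[of n] integral_lborel_shift[of "indicator U :: 'a \<Rightarrow> real" "h n"]
    by simp
  with lim show ?thesis by simp
qed

text \<open>Insert \<open>g\<close> at the shifted and at the unshifted argument; by translation
  invariance both errors are the same, whence the factor 2.\<close>

lemma L1_shift_diff_le:
  fixes f g :: "'a::euclidean_space \<Rightarrow> 'b::{banach, second_countable_topology}"
  assumes f: "integrable lborel f" and g: "integrable lborel g"
  shows "(LINT x|lborel. norm (f (x + h) - f x)) \<le>
    (LINT x|lborel. norm (g (x + h) - g x)) + 2 * (LINT x|lborel. norm (f x - g x))"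
proof -
  have d: "integrable lborel (\<lambda>x. norm (f x - g x))" using f g by auto
  have [measurable]: "f \<in> borel_measurable borel" "g \<in> borel_measurable borel" using f g by auto
  have dh: "integrable lborel (\<lambda>x. norm (f (x + h) - g (x + h)))"
    by (rule integrable_lborel_shift[OF d])
  have gh: "integrable lborel (\<lambda>x. norm (g (x + h) - g x))"
    using integrable_lborel_shift[OF g] g by auto
  have fh: "integrable lborel (\<lambda>x. norm (f (x + h) - f x))"
    using integrable_lborel_shift[OF f] f by auto
  have "(LINT x|lborel. norm (f (x + h) - f x)) \<le>
    (LINT x|lborel. norm (f (x + h) - g (x + h)) + norm (g (x + h) - g x) + norm (f x - g x))"
  proof (rule integral_mono[OF fh])
    fix x
    have "f (x + h) - f x = (f (x + h) - g (x + h)) + (g (x + h) - g x) + (g x - f x)" by simp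
    then show "norm (f (x + h) - f x) \<le> norm (f (x + h) - g (x + h)) + norm (g (x + h) - g x) + norm (f x - g x)"
      by (metis norm_triangle_mono norm_minus_commute order_refl)
  qed (use d dh gh in auto)
  also have "\<dots> = (LINT x|lborel. norm (f (x + h) - g (x + h))) + (LINT x|lborel. norm (g (x + h) - g x)) + (LINT x|lborel. norm (f x - g x))"
    using d dh gh by simp
  also have "(LINT x|lborel. norm (f (x + h) - g (x + h))) = (LINT x|lborel. norm (f x - g x))"
    by (rule integral_lborel_shift) measurable
  finally show ?thesis by simp
qed

lemma L1_shift_limI:
  fixes f :: "'a::euclidean_space \<Rightarrow> 'b::{banach, second_countable_topology}"
  assumes f: "integrable lborel f"
    and approx: "\<And>e. e > 0 \<Longrightarrow> \<exists>g::'a \<Rightarrow> 'b. integrable lborel g \<and> (LINT x|lborel. norm (f x - g x)) < e \<and>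
       (\<lambda>n. LINT x|lborel. norm (g (x + h n) - g x)) \<longlonglongrightarrow> 0"
  shows "(\<lambda>n. LINT x|lborel. norm (f (x + h n) - f x)) \<longlonglongrightarrow> 0"
proof (rule LIMSEQ_I)
  fix e :: real assume "e > 0"
  then obtain g :: "'a \<Rightarrow> 'b" where g: "integrable lborel g" "(LINT x|lborel. norm (f x - g x)) < e/4"
    "(\<lambda>n. LINT x|lborel. norm (g (x + h n) - g x)) \<longlonglongrightarrow> 0" using approx[of "e/4"] by auto
  from LIMSEQ_D[OF g(3), of "e/2"] \<open>e > 0\<close> obtain N where
    N: "\<And>n. n \<ge> N \<Longrightarrow> norm (LINT x|lborel. norm (g (x + h n) - g x)) < e/2" by auto
  show "\<exists>no. \<forall>n\<ge>no. norm ((LINT x|lborel. norm (f (x + h n) - f x)) - 0) < e"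
  proof (intro exI allI impI)
    fix n assume "n \<ge> N"
    then have "(LINT x|lborel. norm (g (x + h n) - g x)) < e/2" using N[of n] by simp
    then show "norm ((LINT x|lborel. norm (f (x + h n) - f x)) - 0) < e"
      using L1_shift_diff_le[OF f g(1), of "h n"] g(2) by simp
  qed
qed

text \<open>Induction over integrable functions: an indicator is approximated by that of an open set
  through outer regularity, sums are trivial, and limits are handled by \<open>L1_shift_limI\<close>
  because the approximants converge in L1.\<close>

lemma L1_translation_continuous:
  fixes f :: "'a::euclidean_space \<Rightarrow> 'b::{banach, second_countable_topology}"
  assumes f: "integrable lborel f" and h: "h \<longlonglongrightarrow> 0"
  shows "(\<lambda>n. LINT x|lborel. norm (f (x + h n) - f x)) \<longlonglongrightarrow> 0"
  using f
proof (induction rule: integrable_induct)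
  case (base A c)
  have A: "A \<in> sets borel" "emeasure lborel A < \<infinity>" using base by auto
  have iA: "integrable lborel (indicator A :: 'a \<Rightarrow> real)" using A by (auto simp: integrable_indicator_iff)
  have "(\<lambda>n. LINT x|lborel. norm (indicator A (x + h n) - indicator A x :: real)) \<longlonglongrightarrow> 0"
  proof (rule L1_shift_limI[OF iA])
    fix e :: real assume e: "e > 0"
    obtain U where U: "open U" "A \<subseteq> U" "emeasure lborel (U - A) < ennreal e"
      using outer_regular_lborel[OF A(1) e] by auto
    have [measurable]: "U \<in> sets borel" "A \<in> sets borel" using U A by auto
    have "emeasure lborel U = emeasure lborel A + emeasure lborel (U - A)"
      using U(2) by (subst plus_emeasure) (auto intro!: arg_cong[where f = "emeasure lborel"])
    also have "\<dots> < \<infinity>" using A(2) U(3) by (auto simp: less_top[symmetric])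
    finally have Uf: "emeasure lborel U < \<infinity>" .
    have "(LINT x|lborel. norm (indicator A x - indicator U x :: real)) = (LINT x|lborel. indicator (U - A) x)"
      using U(2) by (intro Bochner_Integration.integral_cong) (auto simp: indicator_def)
    also have "\<dots> = measure lborel (U - A)" by simp
    also have "\<dots> < e" using U(3) e by (auto simp: measure_def intro!: enn2real_less_iff[THEN iffD2] intro: less_trans)
    finally show "\<exists>g::'a \<Rightarrow> real. integrable lborel g \<and> (LINT x|lborel. norm (indicator A x - g x)) < e \<and>
       (\<lambda>n. LINT x|lborel. norm (g (x + h n) - g x)) \<longlonglongrightarrow> 0"
      using open_translation_continuous[OF U(1) Uf h] Uf
      by (intro exI[of _ "indicator U"]) (auto simp: integrable_indicator_iff)
  qed
  then have "(\<lambda>n. (LINT x|lborel. norm (indicator A (x + h n) - indicator A x :: real)) * norm c) \<longlonglongrightarrow> 0 * norm c"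
    by (intro tendsto_intros)
  moreover have "norm (indicator A (x + h n) *\<^sub>R c - indicator A x *\<^sub>R c) = norm (indicator A (x + h n) - indicator A x :: real) * norm c" for x n
    by (simp add: scaleR_diff_left[symmetric])
  ultimately show ?case by simp
next
  case (add f g)
  have "(\<lambda>n. (LINT x|lborel. norm (f (x + h n) - f x)) + (LINT x|lborel. norm (g (x + h n) - g x))) \<longlonglongrightarrow> 0 + 0"
    using add by (intro tendsto_add) auto
  then have lim: "(\<lambda>n. (LINT x|lborel. norm (f (x + h n) - f x)) + (LINT x|lborel. norm (g (x + h n) - g x))) \<longlonglongrightarrow> 0" by simp
  show ?case
  proof (rule tendsto_sandwich[OF _ _ tendsto_const lim])
    show "\<forall>\<^sub>F n in sequentially. (LINT x|lborel. norm (f (x + h n) + g (x + h n) - (f x + g x))) \<le>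
       (LINT x|lborel. norm (f (x + h n) - f x)) + (LINT x|lborel. norm (g (x + h n) - g x))"
    proof (intro always_eventually allI)
      fix n
      have i: "integrable lborel (\<lambda>x. norm (f (x + h n) - f x))" "integrable lborel (\<lambda>x. norm (g (x + h n) - g x))"
        using integrable_lborel_shift[of f "h n"] integrable_lborel_shift[of g "h n"] add by auto
      have "(LINT x|lborel. norm (f (x + h n) + g (x + h n) - (f x + g x))) \<le>
         (LINT x|lborel. norm (f (x + h n) - f x) + norm (g (x + h n) - g x))"
        using i integrable_lborel_shift[of f "h n"] integrable_lborel_shift[of g "h n"] add
        by (intro integral_mono) (auto simp: add_diff_add intro: norm_triangle_ineq)
      then show "(LINT x|lborel. norm (f (x + h n) + g (x + h n) - (f x + g x))) \<le>
       (LINT x|lborel. norm (f (x + h n) - f x)) + (LINT x|lborel. norm (g (x + h n) - g x))"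
        using i by simp
    qed
  qed (auto intro!: always_eventually)
next
  case (lim f s)
  show ?case
  proof (rule L1_shift_limI[OF lim(4)])
    fix e :: real assume e: "e > 0"
    have [measurable]: "f \<in> borel_measurable borel" "\<And>i. s i \<in> borel_measurable borel" using lim(4) lim(1) by auto
    have "(\<lambda>i. LINT x|lborel. norm (f x - s i x)) \<longlonglongrightarrow> (LINT (x::'a)|lborel. (0::real))"
    \<comment> \<open>The approximants supplied by \<open>integrable_induct\<close> satisfy
      \<open>norm (s i x) \<le> 2 * norm (f x)\<close>, whence the factor 3.\<close>
    proof (rule integral_dominated_convergence[where w = "\<lambda>x. 3 * norm (f x)"])
      show "AE x in lborel. (\<lambda>i. norm (f x - s i x)) \<longlonglongrightarrow> 0"
      proof (rule AE_I2)
        fix x assume "x \<in> space (lborel :: 'a measure)"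
        from tendsto_norm[OF tendsto_diff[OF tendsto_const lim(2)[OF this], of "f x"]]
        show "(\<lambda>i. norm (f x - s i x)) \<longlonglongrightarrow> 0" by simp
      qed
      show "AE x in lborel. norm (norm (f x - s i x)) \<le> 3 * norm (f x)" for i
      proof (rule AE_I2)
        fix x :: 'a
        have "norm (f x - s i x) \<le> norm (f x) + norm (s i x)" by (rule norm_triangle_ineq4)
        with lim(3)[of x i] show "norm (norm (f x - s i x)) \<le> 3 * norm (f x)" by simp
      qed
    qed (use lim(4) in auto)
    then have "(\<lambda>i. LINT x|lborel. norm (f x - s i x)) \<longlonglongrightarrow> 0" by simp
    from LIMSEQ_D[OF this e] obtain i where "(LINT x|lborel. norm (f x - s i x)) < e" by auto
    then show "\<exists>g::'a \<Rightarrow> 'b. integrable lborel g \<and> (LINT x|lborel. norm (f x - g x)) < e \<and>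
       (\<lambda>n. LINT x|lborel. norm (g (x + h n) - g x)) \<longlonglongrightarrow> 0"
      using lim(1)[of i] lim(5)[of i] by (intro exI[of _ "s i"]) auto
  qed
qed

section \<open>Plancherel's identity\<close>

lemma lborel_affine_nn_integral:
  fixes F :: "'a::euclidean_space \<Rightarrow> ennreal"
  assumes [measurable]: "F \<in> borel_measurable borel" and "c \<noteq> 0"
  shows "(\<integral>\<^sup>+y. F y \<partial>lborel) = ennreal (\<bar>c\<bar> ^ DIM('a)) * (\<integral>\<^sup>+y. F (t + c *\<^sub>R y) \<partial>lborel)"
  by (subst lborel_affine[OF assms(2), of t]) (simp add: nn_integral_density nn_integral_distr nn_integral_cmult)

lemma lborel_affine_integral:
  fixes F :: "'a::euclidean_space \<Rightarrow> 'b::{banach, second_countable_topology}"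
  assumes [measurable]: "F \<in> borel_measurable borel" and "c \<noteq> 0"
  shows "(LINT y|lborel. F y) = \<bar>c\<bar> ^ DIM('a) *\<^sub>R (LINT y|lborel. F (t + c *\<^sub>R y))"
  by (subst lborel_affine[OF assms(2), of t]) (simp add: integral_density integral_distr)

lemma pair_mult_integral:
  fixes a :: "'a \<Rightarrow> 'c::{real_normed_field, banach, second_countable_topology}"
  assumes "sigma_finite_measure M" "sigma_finite_measure N"
  assumes a: "integrable M a" and b: "integrable N b"
  shows "integrable (M \<Otimes>\<^sub>M N) (\<lambda>z. a (fst z) * b (snd z))"
    and "(LINT z|(M \<Otimes>\<^sub>M N). a (fst z) * b (snd z)) = (LINT x|M. a x) * (LINT y|N. b y)"
proof -
  interpret pair_sigma_finite M N using assms by (simp add: pair_sigma_finite_def)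
  have [measurable]: "a \<in> borel_measurable M" "b \<in> borel_measurable N" using a b by auto
  show i: "integrable (M \<Otimes>\<^sub>M N) (\<lambda>z. a (fst z) * b (snd z))"
  proof (rule Fubini_integrable)
    show "integrable M (\<lambda>x. LINT y|N. norm (a (fst (x, y)) * b (snd (x, y))))"
      using a by (simp add: norm_mult)
    show "AE x in M. integrable N (\<lambda>y. a (fst (x, y)) * b (snd (x, y)))" using b by simp
  qed measurable
  have "(LINT z|(M \<Otimes>\<^sub>M N). a (fst z) * b (snd z)) = (LINT x|M. LINT y|N. a x * b y)"
    using integral_fst'[OF i] by simp
  also have "\<dots> = (LINT x|M. a x) * (LINT y|N. b y)" using b by simp
  finally show "(LINT z|(M \<Otimes>\<^sub>M N). a (fst z) * b (snd z)) = (LINT x|M. a x) * (LINT y|N. b y)" .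
qed

text \<open>The characteristic function of the standard normal distribution, rescaled by
  \<open>sqrt e\<close>; \<open>e\<close> later serves as the strength of a Gaussian cutoff that is
  sent to 0.\<close>

lemma gaussian_fourier_real:
  fixes s e :: real
  assumes e: "e > 0"
  shows "integrable lborel (\<lambda>t. exp (- e * t\<^sup>2 / 2))"
    and "(LINT t|lborel. complex_of_real (exp (- e * t\<^sup>2 / 2)) * iexp (t * s)) =
      complex_of_real (sqrt (2 * pi / e) * exp (- s\<^sup>2 / (2 * e)))"
proof -
  define r where "r = sqrt e"
  have r: "r > 0" "r * r = e" "r\<^sup>2 = e" using e by (auto simp: r_def)
  have d: "std_normal_density (0 + r * t) = exp (- e * t\<^sup>2 / 2) / sqrt (2 * pi)" for t
    by (simp add: normal_density_def power_mult_distrib r)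
  have "integrable lborel std_normal_density" by simp
  from lborel_integrable_real_affine[OF this, of r 0] r(1)
  have "integrable lborel (\<lambda>t. exp (- e * t\<^sup>2 / 2) / sqrt (2 * pi))" unfolding d by simp
  from integrable_mult_right[OF this, of "sqrt (2 * pi)"]
  show "integrable lborel (\<lambda>t. exp (- e * t\<^sup>2 / 2))" by simp
  have "complex_of_real (exp (- (s / r)\<^sup>2 / 2)) = char std_normal_distribution (s / r)"
    by (simp add: char_std_normal_distribution)
  also have "\<dots> = (LINT x|lborel. std_normal_density x *\<^sub>R iexp ((s / r) * x))"
    unfolding char_def by (subst integral_density) auto
  also have "\<dots> = \<bar>r\<bar> *\<^sub>R (LINT t|lborel. std_normal_density (0 + r * t) *\<^sub>R iexp ((s / r) * (0 + r * t)))"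
    using r by (intro lborel_integral_real_affine) auto
  also have "\<dots> = complex_of_real r * (LINT t|lborel. complex_of_real (1 / sqrt (2 * pi)) * (complex_of_real (exp (- e * t\<^sup>2 / 2)) * iexp (t * s)))"
    unfolding d using r by (simp add: scaleR_conv_of_real field_simps)
  also have "\<dots> = complex_of_real (r / sqrt (2 * pi)) * (LINT t|lborel. complex_of_real (exp (- e * t\<^sup>2 / 2)) * iexp (t * s))"
    by simp
  finally have *: "complex_of_real (exp (- (s / r)\<^sup>2 / 2)) =
     complex_of_real (r / sqrt (2 * pi)) * (LINT t|lborel. complex_of_real (exp (- e * t\<^sup>2 / 2)) * iexp (t * s))" .
  have 1: "complex_of_real (sqrt (2 * pi / e)) * complex_of_real (r / sqrt (2 * pi)) = 1"
    unfolding of_real_mult[symmetric] using e by (simp add: r_def real_sqrt_divide)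
  have "complex_of_real (sqrt (2 * pi / e) * exp (- s\<^sup>2 / (2 * e))) =
     complex_of_real (sqrt (2 * pi / e)) * complex_of_real (exp (- (s / r)\<^sup>2 / 2))"
    by (simp add: power_divide r mult.commute)
  also have "\<dots> = (LINT t|lborel. complex_of_real (exp (- e * t\<^sup>2 / 2)) * iexp (t * s))"
    unfolding * mult.assoc[symmetric] 1 by simp
  finally show "(LINT t|lborel. complex_of_real (exp (- e * t\<^sup>2 / 2)) * iexp (t * s)) =
      complex_of_real (sqrt (2 * pi / e) * exp (- s\<^sup>2 / (2 * e)))" ..
qed

text \<open>Both the Gaussian and the exponential factor over the coordinates, and
  \<open>lborel\<close> is the image of a product measure, so the integral is a product of
  one-dimensional ones.\<close>

lemma gaussian_fourier:
  fixes x :: "'a::euclidean_space" and e :: real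
  assumes e: "e > 0"
  shows "integrable lborel (\<lambda>p::'a. exp (- e * (norm p)\<^sup>2 / 2))"
    and "(LINT p|lborel. complex_of_real (exp (- e * (norm p)\<^sup>2 / 2)) * iexp (p \<bullet> x)) =
      complex_of_real (sqrt (2 * pi / e) ^ DIM('a) * exp (- (norm x)\<^sup>2 / (2 * e)))"
proof -
  interpret product_sigma_finite "\<lambda>_::'a. lborel :: real measure" ..
  let ?f = "\<lambda>b t. complex_of_real (exp (- e * t\<^sup>2 / 2)) * iexp (t * (x \<bullet> b))"
  let ?S = "\<lambda>g. \<Sum>b\<in>Basis. g b *\<^sub>R b :: 'a"
  have norm: "(norm p)\<^sup>2 = (\<Sum>b\<in>Basis. (p \<bullet> b)\<^sup>2)" for p :: 'a
    by (subst power2_norm_eq_inner, subst euclidean_inner) (simp add: power2_eq_square)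
  have inn: "p \<bullet> x = (\<Sum>b\<in>Basis. (p \<bullet> b) * (x \<bullet> b))" for p :: 'a
    by (rule euclidean_inner)
  have eq: "complex_of_real (exp (- e * (norm p)\<^sup>2 / 2)) * iexp (p \<bullet> x) = (\<Prod>b\<in>Basis. ?f b (p \<bullet> b))" for p :: 'a
  proof -
    have "- e * (norm p)\<^sup>2 / 2 = (\<Sum>b\<in>Basis. - e * (p \<bullet> b)\<^sup>2 / 2)"
      by (simp add: norm sum_distrib_left sum_divide_distrib sum_negf)
    then show ?thesis by (simp add: inn prod.distrib exp_sum sum_distrib_left)
  qed
  have i1: "integrable lborel (?f b)" for b
    using gaussian_fourier_real(1)[OF e]
    by (intro Bochner_Integration.integrable_bound[OF gaussian_fourier_real(1)[OF e]]) (auto simp: norm_mult)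
  have i2: "integrable (\<Pi>\<^sub>M b\<in>Basis. lborel) (\<lambda>g. \<Prod>b\<in>Basis. ?f b (g b))"
    by (rule product_integrable_prod) (use i1 in auto)
  have [simp]: "?S g \<bullet> b = g b" if "b \<in> Basis" for g and b :: 'a
    using that by (simp add: inner_sum_left_Basis)
  have [measurable]: "?S \<in> (\<Pi>\<^sub>M b\<in>Basis. lborel) \<rightarrow>\<^sub>M borel" by measurable
  have [measurable]: "(\<lambda>p. \<Prod>b\<in>Basis. ?f b (p \<bullet> b)) \<in> borel_measurable borel" by measurable
  have i3: "integrable lborel (\<lambda>p::'a. \<Prod>b\<in>Basis. ?f b (p \<bullet> b))"
    by (subst lborel_eq, subst integrable_distr_eq) (use i2 in \<open>auto cong: prod.cong\<close>)
  have "integrable lborel (\<lambda>p::'a. cmod (complex_of_real (exp (- e * (norm p)\<^sup>2 / 2)) * iexp (p \<bullet> x)))"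
    using integrable_norm[OF i3] unfolding eq .
  then show "integrable lborel (\<lambda>p::'a. exp (- e * (norm p)\<^sup>2 / 2))" by (simp add: norm_mult)
  have "(LINT p|lborel. complex_of_real (exp (- e * (norm p)\<^sup>2 / 2)) * iexp (p \<bullet> x)) =
     (LINT p|lborel. (\<Prod>b\<in>Basis. ?f b (p \<bullet> b)))" unfolding eq ..
  also have "\<dots> = (LINT g|(\<Pi>\<^sub>M b\<in>Basis. lborel). (\<Prod>b\<in>Basis. ?f b (g b)))"
    by (subst lborel_eq, subst integral_distr) (auto cong: prod.cong)
  also have "\<dots> = (\<Prod>b\<in>Basis. LINT t|lborel. ?f b t)"
    by (rule product_integral_prod) (use i1 in auto)
  also have "\<dots> = (\<Prod>b\<in>(Basis::'a set). complex_of_real (sqrt (2 * pi / e) * exp (- (x \<bullet> b)\<^sup>2 / (2 * e))))"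
    using gaussian_fourier_real(2)[OF e] by simp
  also have "\<dots> = complex_of_real (sqrt (2 * pi / e) ^ DIM('a) * (\<Prod>b\<in>Basis. exp (- (x \<bullet> b)\<^sup>2 / (2 * e))))"
    by (simp add: prod.distrib)
  also have "(\<Prod>b\<in>Basis. exp (- (x \<bullet> b)\<^sup>2 / (2 * e))) = exp (- (norm x)\<^sup>2 / (2 * e))"
    by (subst exp_sum[symmetric]) (auto simp: norm sum_divide_distrib sum_negf)
  finally show "(LINT p|lborel. complex_of_real (exp (- e * (norm p)\<^sup>2 / 2)) * iexp (p \<bullet> x)) =
      complex_of_real (sqrt (2 * pi / e) ^ DIM('a) * exp (- (norm x)\<^sup>2 / (2 * e)))" .
qed

lemma L2_shift:
  fixes f :: "'a::euclidean_space \<Rightarrow> complex"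
  assumes "f \<in> L2 lborel"
  shows "(\<lambda>x. f (x + h)) \<in> L2 lborel" "sqnorm lborel (\<lambda>x. f (x + h)) = sqnorm lborel f"
proof -
  have [measurable]: "f \<in> borel_measurable borel" using assms by (auto simp: L2_iff)
  have "(\<lambda>x. f (x + h)) \<in> borel_measurable borel" by measurable
  then show "(\<lambda>x. f (x + h)) \<in> L2 lborel"
    using assms integrable_lborel_shift[of "\<lambda>x. (cmod (f x))\<^sup>2" h] by (auto simp: L2_iff)
  show "sqnorm lborel (\<lambda>x. f (x + h)) = sqnorm lborel f"
    unfolding sqnorm_def by (rule integral_lborel_shift) measurable
qed

text \<open>Dominated convergence with \<open>\<bar>f\<bar>\<^sup>2\<close> as bound. Asking that
  each point eventually lies in \<open>A n\<close> covers truncation by the height of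
  \<open>f\<close> as well as truncation to balls.\<close>

lemma truncation_sqnorm_lim:
  assumes f: "f \<in> L2 M" and A: "\<And>n. A n \<in> sets M"
    and ev: "\<And>x. x \<in> space M \<Longrightarrow> \<forall>\<^sub>F n in sequentially. x \<in> A n"
  shows "(\<lambda>n. sqnorm M (\<lambda>x. f x - indicator (A n) x * f x)) \<longlonglongrightarrow> 0"
    and "(\<lambda>n. sqnorm M (\<lambda>x. indicator (A n) x * f x)) \<longlonglongrightarrow> sqnorm M f"
proof -
  have [measurable]: "f \<in> borel_measurable M" "\<And>n. A n \<in> sets M" using f A by (auto simp: L2_iff)
  have "(\<lambda>n. LINT x|M. (cmod (f x - indicator (A n) x * f x))\<^sup>2) \<longlonglongrightarrow> (LINT x|M. (0::real))"
  proof (rule integral_dominated_convergence[where w = "\<lambda>x. (cmod (f x))\<^sup>2"])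
    show "AE x in M. (\<lambda>n. (cmod (f x - indicator (A n) x * f x))\<^sup>2) \<longlonglongrightarrow> 0"
    proof (rule AE_I2)
      fix x assume "x \<in> space M"
      from ev[OF this] have "\<forall>\<^sub>F n in sequentially. (cmod (f x - indicator (A n) x * f x))\<^sup>2 = 0"
        by eventually_elim simp
      then show "(\<lambda>n. (cmod (f x - indicator (A n) x * f x))\<^sup>2) \<longlonglongrightarrow> 0" by (rule tendsto_eventually)
    qed
  qed (use f in \<open>auto simp: L2_iff indicator_def\<close>)
  then show "(\<lambda>n. sqnorm M (\<lambda>x. f x - indicator (A n) x * f x)) \<longlonglongrightarrow> 0" by (simp add: sqnorm_def)
  show "(\<lambda>n. sqnorm M (\<lambda>x. indicator (A n) x * f x)) \<longlonglongrightarrow> sqnorm M f"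
    unfolding sqnorm_def
  proof (rule integral_dominated_convergence[where w = "\<lambda>x. (cmod (f x))\<^sup>2"])
    show "AE x in M. (\<lambda>n. (cmod (indicator (A n) x * f x))\<^sup>2) \<longlonglongrightarrow> (cmod (f x))\<^sup>2"
    proof (rule AE_I2)
      fix x assume "x \<in> space M"
      from ev[OF this] have "\<forall>\<^sub>F n in sequentially. (cmod (indicator (A n) x * f x))\<^sup>2 = (cmod (f x))\<^sup>2"
        by eventually_elim simp
      then show "(\<lambda>n. (cmod (indicator (A n) x * f x))\<^sup>2) \<longlonglongrightarrow> (cmod (f x))\<^sup>2" by (rule tendsto_eventually)
    qed
  qed (use f in \<open>auto simp: L2_iff indicator_def\<close>)
qed

text \<open>Truncation at height \<open>k\<close> gives a bounded \<open>g\<close> with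
  \<open>\<bar>g (x + h) - g x\<bar>\<^sup>2 \<le> 2 * k * \<bar>g (x + h) - g x\<bar>\<close>,
  which reduces the claim to the continuity of translations in L1.\<close>

lemma L2_translation_continuous:
  fixes f :: "'a::euclidean_space \<Rightarrow> complex"
  assumes f: "f \<in> L2 lborel" and f1: "integrable lborel f" and h: "h \<longlonglongrightarrow> 0"
  shows "(\<lambda>n. sqnorm lborel (\<lambda>x. f (x + h n) - f x)) \<longlonglongrightarrow> 0"
proof (rule LIMSEQ_I)
  fix e :: real assume e: "e > 0"
  have [measurable]: "f \<in> borel_measurable borel" using f by (auto simp: L2_iff)
  define A where "A k = {x. cmod (f x) \<le> real k}" for k :: nat
  have [measurable]: "A k \<in> sets borel" for k unfolding A_def by measurable
  have "\<forall>\<^sub>F k in sequentially. x \<in> A k" for x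
    unfolding A_def mem_Collect_eq by (rule eventually_sequentiallyI[of "nat \<lceil>cmod (f x)\<rceil>"]) linarith
  then have "(\<lambda>k. sqnorm lborel (\<lambda>x. f x - indicator (A k) x * f x)) \<longlonglongrightarrow> 0"
    by (intro truncation_sqnorm_lim(1)[OF f]) auto
  \<comment> \<open>The tolerances fit two applications of \<open>sqnorm_add_le\<close>:
    \<open>2 * e/12 + 4 * e/8 + 4 * e/12 = e\<close>.\<close>
  from LIMSEQ_D[OF this, of "e/12"] e obtain k where
    k: "sqnorm lborel (\<lambda>x. f x - indicator (A k) x * f x) < e/12" by force
  define g where "g x = indicator (A k) x * f x" for x
  have g: "g \<in> L2 lborel" unfolding g_def by (rule L2_indicator[OF f]) auto
  have [measurable]: "g \<in> borel_measurable borel" using g by (auto simp: L2_iff)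
  have g1: "integrable lborel g"
    by (rule Bochner_Integration.integrable_bound[OF f1]) (auto simp: g_def indicator_def)
  have gk: "cmod (g x) \<le> real k" for x by (auto simp: g_def A_def indicator_def)
  have "(\<lambda>n. LINT x|lborel. norm (g (x + h n) - g x)) \<longlonglongrightarrow> 0"
    by (rule L1_translation_continuous[OF g1 h])
  then have "(\<lambda>n. 2 * real k * (LINT x|lborel. norm (g (x + h n) - g x))) \<longlonglongrightarrow> 2 * real k * 0"
    by (intro tendsto_intros)
  from LIMSEQ_D[OF this, of "e/8"] e obtain N where
    N: "\<And>n. n \<ge> N \<Longrightarrow> 2 * real k * (LINT x|lborel. norm (g (x + h n) - g x)) < e/8" by force
  show "\<exists>no. \<forall>n\<ge>no. norm (sqnorm lborel (\<lambda>x. f (x + h n) - f x) - 0) < e"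
  proof (intro exI allI impI)
    fix n assume n: "n \<ge> N"
    note gh = L2_shift(1)[OF g, of "h n"] and fh = L2_shift(1)[OF f, of "h n"]
    have t: "sqnorm lborel (\<lambda>x. g (x + h n) - g x) \<le> 2 * real k * (LINT x|lborel. norm (g (x + h n) - g x))"
    proof -
      have "sqnorm lborel (\<lambda>x. g (x + h n) - g x) \<le> (LINT x|lborel. 2 * real k * norm (g (x + h n) - g x))"
        unfolding sqnorm_def
      proof (rule integral_mono)
        show "integrable lborel (\<lambda>x. (cmod (g (x + h n) - g x))\<^sup>2)"
          using L2_diff[OF gh g] by (auto simp: L2_iff)
        show "integrable lborel (\<lambda>x. 2 * real k * norm (g (x + h n) - g x))"
          using integrable_lborel_shift[OF g1] g1 by auto
        fix x
        have "norm (g (x + h n) - g x) \<le> 2 * real k"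
          using norm_triangle_ineq4[of "g (x + h n)" "g x"] gk[of x] gk[of "x + h n"] by linarith
        then show "(cmod (g (x + h n) - g x))\<^sup>2 \<le> 2 * real k * norm (g (x + h n) - g x)"
          unfolding power2_eq_square by (intro mult_right_mono) auto
      qed
      then show ?thesis by simp
    qed
    have d: "sqnorm lborel (\<lambda>x. f x - g x) < e/12" using k by (simp add: g_def)
    have d1: "sqnorm lborel (\<lambda>x. f (x + h n) - g (x + h n)) < e/12"
      using L2_shift(2)[OF L2_diff[OF f g], of "h n"] d by simp
    have d2: "sqnorm lborel (\<lambda>x. g x - f x) < e/12"
      using d unfolding sqnorm_def by (simp add: norm_minus_commute)
    have "sqnorm lborel (\<lambda>x. f (x + h n) - f x) =
       sqnorm lborel (\<lambda>x. (f (x + h n) - g (x + h n)) + ((g (x + h n) - g x) + (g x - f x)))"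
      by simp
    also have "\<dots> \<le> 2 * sqnorm lborel (\<lambda>x. f (x + h n) - g (x + h n)) +
        2 * sqnorm lborel (\<lambda>x. (g (x + h n) - g x) + (g x - f x))"
      by (intro sqnorm_add_le L2_add L2_diff fh gh f g)
    also have "\<dots> \<le> 2 * sqnorm lborel (\<lambda>x. f (x + h n) - g (x + h n)) +
        2 * (2 * sqnorm lborel (\<lambda>x. g (x + h n) - g x) + 2 * sqnorm lborel (\<lambda>x. g x - f x))"
      by (intro add_left_mono mult_left_mono sqnorm_add_le L2_diff fh gh f g) auto
    also have "\<dots> < e"
    proof -
      have "2 * a + 2 * (2 * b + 2 * c) < e" if "a < e/12" "b < e/8" "c < e/12" for a b c
        using that by simp
      from this[OF d1 order_le_less_trans[OF t N[OF n]] d2] show ?thesis .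
    qed
    finally show "norm (sqnorm lborel (\<lambda>x. f (x + h n) - f x) - 0) < e" by simp
  qed
qed

section \<open>Fourier integrals of integrable functions\<close>

lemma fourier_lborel:
  assumes [measurable]: "f \<in> borel_measurable borel"
  shows "fourier f p = complex_of_real ((2 * pi) powr (- 3 / 2)) *
    (LINT x|lborel. f x * exp (- \<i> * complex_of_real (p \<bullet> x)))"
  unfolding fourier_def by (subst integral_completion) auto

lemma borel_measurable_fourier [measurable]:
  assumes [measurable]: "f \<in> borel_measurable borel"
  shows "fourier f \<in> borel_measurable borel"
proof -
  have "(\<lambda>p. LINT x|lborel. f x * exp (- \<i> * complex_of_real (p \<bullet> x))) \<in> borel_measurable borel"
    by (rule lborel.borel_measurable_lebesgue_integral) measurable
  then show ?thesis unfolding fourier_lborel[OF assms, abs_def] by measurable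
qed

lemma integrable_mult_unimodular:
  fixes f e :: "'a \<Rightarrow> complex"
  assumes "integrable M f" "e \<in> borel_measurable M" "\<And>x. cmod (e x) = 1"
  shows "integrable M (\<lambda>x. f x * e x)"
  by (rule Bochner_Integration.integrable_bound[OF assms(1)]) (use assms in \<open>auto simp: norm_mult\<close>)

lemma fourier_bound:
  assumes "integrable lborel f"
  shows "cmod (fourier f p) \<le> (2 * pi) powr (- 3 / 2) * (LINT x|lborel. cmod (f x))"
proof -
  have [measurable]: "f \<in> borel_measurable borel" using assms by auto
  show ?thesis unfolding fourier_lborel[OF \<open>f \<in> borel_measurable borel\<close>] norm_mult
    using integral_norm_bound[of lborel "\<lambda>x. f x * exp (- \<i> * complex_of_real (p \<bullet> x))"]
    by (auto simp: norm_mult intro!: mult_mono)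
qed

lemma fourier_diff:
  assumes f: "integrable lborel f" and g: "integrable lborel g"
  shows "fourier (\<lambda>x. f x - g x) p = fourier f p - fourier g p"
proof -
  have [measurable]: "f \<in> borel_measurable borel" "g \<in> borel_measurable borel" using f g by auto
  have "integrable lborel (\<lambda>x. h x * exp (- \<i> * complex_of_real (p \<bullet> x)))" if "integrable lborel h" for h
    using that by (rule integrable_mult_unimodular) auto
  from this[OF f] this[OF g] show ?thesis
    by (simp add: fourier_lborel algebra_simps)
qed

lemma gaussian_total:
  "(LINT w|lborel. exp (- (norm (w::real^3))\<^sup>2 / 2)) = sqrt (2 * pi) ^ 3"
proof -
  have "complex_of_real (LINT w|lborel. exp (- (norm (w::real^3))\<^sup>2 / 2)) = complex_of_real (sqrt (2 * pi) ^ 3)"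
    using gaussian_fourier(2)[of 1 "0::real^3"] by (simp flip: of_real_power)
  then show ?thesis by (simp only: of_real_eq_iff)
qed

text \<open>One factor \<open>sqrt (2 * pi) ^ 3\<close> is produced by the transform of the Gaussian
  cutoff, the other is the total mass of the Gaussian that remains in the limit.\<close>

lemma fourier_const: "((2 * pi) powr (- 3 / 2))\<^sup>2 * sqrt (2 * pi) ^ 3 * sqrt (2 * pi) ^ 3 = 1"
proof -
  have "((2 * pi) powr (- 3 / 2))\<^sup>2 = (2 * pi) powr (- 3)"
    by (simp add: powr_powr flip: powr_numeral)
  also have "\<dots> = inverse ((2 * pi) ^ 3)" by (simp add: powr_minus powr_numeral)
  finally have *: "((2 * pi) powr (- 3 / 2))\<^sup>2 = inverse ((2 * pi) ^ 3)" .
  have "sqrt (2 * pi) ^ 3 * sqrt (2 * pi) ^ 3 = (2 * pi) ^ 3"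
    by (simp add: power_mult_distrib[symmetric])
  then show ?thesis unfolding * mult.assoc by simp
qed

text \<open>The product with the conjugate is a double integral in which \<open>p\<close> occurs
  only in a phase, ready to be integrated against a Gaussian in \<open>p\<close>.\<close>

lemma fourier_sq:
  assumes f: "integrable lborel f"
  shows "complex_of_real ((cmod (fourier f p))\<^sup>2) = complex_of_real (((2 * pi) powr (- 3 / 2))\<^sup>2) *
    (LINT z|(lborel \<Otimes>\<^sub>M lborel). f (fst z) * cnj (f (snd z)) * iexp (p \<bullet> (snd z - fst z)))"
proof -
  have [measurable]: "f \<in> borel_measurable borel" using f by auto
  let ?c = "complex_of_real ((2 * pi) powr (- 3 / 2))"
  let ?a = "\<lambda>x. f x * exp (- \<i> * complex_of_real (p \<bullet> x))"
  have a: "integrable lborel ?a" using f by (rule integrable_mult_unimodular) auto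
  have "complex_of_real ((cmod (fourier f p))\<^sup>2) = fourier f p * cnj (fourier f p)"
    by (rule complex_norm_square)
  also have "\<dots> = ?c\<^sup>2 * ((LINT x|lborel. ?a x) * (LINT x|lborel. cnj (?a x)))"
  proof -
    have "(LINT x|lborel. cnj (?a x)) = cnj (LINT x|lborel. ?a x)"
      by (rule Bochner_Integration.integral_cnj)
    then show ?thesis
      unfolding fourier_lborel[OF \<open>f \<in> borel_measurable borel\<close>] complex_cnj_mult[of ?c] complex_cnj_complex_of_real
      by (simp only: power2_eq_square mult_ac)
  qed
  also have "(LINT x|lborel. ?a x) * (LINT x|lborel. cnj (?a x)) =
     (LINT z|(lborel \<Otimes>\<^sub>M lborel). ?a (fst z) * cnj (?a (snd z)))"
    by (rule pair_mult_integral(2)[symmetric]) (use a in \<open>auto simp del: complex_cnj_mult intro: lborel.sigma_finite_measure_axioms\<close>)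
  also have "(\<lambda>z. ?a (fst z) * cnj (?a (snd z))) =
     (\<lambda>z. f (fst z) * cnj (f (snd z)) * iexp (p \<bullet> (snd z - fst z)))"
    by (intro ext) (simp add: exp_cnj exp_add[symmetric] exp_diff exp_minus inner_diff_right algebra_simps divide_simps)
  finally show ?thesis by simp
qed

text \<open>The Gaussian makes the integral over \<open>p\<close> and both space variables
  absolutely convergent, so Fubini allows the \<open>p\<close>-integral to be done first; it leaves
  a kernel that concentrates on the diagonal as \<open>e\<close> tends to 0.\<close>

lemma fourier_gauss_regularized:
  assumes f: "integrable lborel f" and e: "e > 0"
  shows "complex_of_real (LINT p|lborel. (cmod (fourier f p))\<^sup>2 * exp (- e * (norm p)\<^sup>2 / 2)) =
    complex_of_real (((2 * pi) powr (- 3 / 2))\<^sup>2) * (LINT z|(lborel \<Otimes>\<^sub>M lborel).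
      f (fst z) * cnj (f (snd z)) * complex_of_real (sqrt (2 * pi / e) ^ 3 * exp (- (norm (snd z - fst z))\<^sup>2 / (2 * e))))"
proof -
  have [measurable]: "f \<in> borel_measurable borel" using f by auto
  let ?c = "complex_of_real (((2 * pi) powr (- 3 / 2))\<^sup>2)"
  let ?G = "\<lambda>p::real^3. complex_of_real (exp (- e * (norm p)\<^sup>2 / 2))"
  let ?F = "\<lambda>z. f (fst z) * cnj (f (snd z))"
  interpret Q: pair_sigma_finite "lborel :: (real^3) measure" "lborel \<Otimes>\<^sub>M lborel :: ((real^3) \<times> (real^3)) measure"
    by (intro pair_sigma_finite.intro lborel.sigma_finite_measure_axioms lborel_pair.sigma_finite_measure_axioms)
  have iF: "integrable (lborel \<Otimes>\<^sub>M lborel) ?F"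
    using f by (intro pair_mult_integral(1)) (auto intro: lborel.sigma_finite_measure_axioms)
  have iG: "integrable lborel ?G" using gaussian_fourier(1)[OF e] by auto
  have "integrable (lborel \<Otimes>\<^sub>M (lborel \<Otimes>\<^sub>M lborel)) (\<lambda>w. ?G (fst w) * ?F (snd w))"
    by (rule pair_mult_integral(1)[OF lborel.sigma_finite_measure_axioms lborel_pair.sigma_finite_measure_axioms iG iF])
  then have "integrable (lborel \<Otimes>\<^sub>M (lborel \<Otimes>\<^sub>M lborel)) (\<lambda>w. ?G (fst w) * ?F (snd w) * iexp (fst w \<bullet> (snd (snd w) - fst (snd w))))"
    by (rule integrable_mult_unimodular) (auto simp: split_beta)
  then have i: "integrable (lborel \<Otimes>\<^sub>M (lborel \<Otimes>\<^sub>M lborel)) (\<lambda>(p, z). ?G p * ?F z * iexp (p \<bullet> (snd z - fst z)))"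
    by (simp add: split_beta')
  have "complex_of_real (LINT p|lborel. (cmod (fourier f p))\<^sup>2 * exp (- e * (norm p)\<^sup>2 / 2)) =
     (LINT p|lborel. complex_of_real ((cmod (fourier f p))\<^sup>2) * ?G p)"
    by (simp flip: integral_complex_of_real)
  also have "\<dots> = (LINT p|lborel. ?c * (LINT z|(lborel \<Otimes>\<^sub>M lborel). ?G p * ?F z * iexp (p \<bullet> (snd z - fst z))))"
    by (subst fourier_sq[OF f]) (simp add: mult_ac flip: integral_mult_right_zero)
  also have "\<dots> = ?c * (LINT p|lborel. LINT z|(lborel \<Otimes>\<^sub>M lborel). ?G p * ?F z * iexp (p \<bullet> (snd z - fst z)))"
    by simp
  also have "(LINT p|lborel. LINT z|(lborel \<Otimes>\<^sub>M lborel). ?G p * ?F z * iexp (p \<bullet> (snd z - fst z))) =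
     (LINT z|(lborel \<Otimes>\<^sub>M lborel). LINT p|lborel. ?G p * ?F z * iexp (p \<bullet> (snd z - fst z)))"
    by (rule Q.Fubini_integral[OF i, symmetric])
  also have "\<dots> = (LINT z|(lborel \<Otimes>\<^sub>M lborel). ?F z * (LINT p|lborel. ?G p * iexp (p \<bullet> (snd z - fst z))))"
    by (simp add: mult_ac flip: integral_mult_right_zero)
  also have "\<dots> = (LINT z|(lborel \<Otimes>\<^sub>M lborel). ?F z *
     complex_of_real (sqrt (2 * pi / e) ^ 3 * exp (- (norm (snd z - fst z))\<^sup>2 / (2 * e))))"
    unfolding gaussian_fourier(2)[OF e] by simp
  finally show ?thesis .
qed

text \<open>Cauchy--Schwarz with translation invariance. The bounds are uniform in the shift
  \<open>h\<close>, so they can dominate the autocorrelation when the cutoff is removed.\<close>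

lemma nn_integral_L2_correlation:
  fixes f :: "'a::euclidean_space \<Rightarrow> complex"
  assumes f: "f \<in> L2 lborel"
  shows "(\<integral>\<^sup>+x. ennreal (cmod (f x * cnj (f (x + h)))) \<partial>lborel) \<le> ennreal (sqnorm lborel f)"
    and "integrable lborel (\<lambda>x. f x * cnj (f (x + h)))"
    and "cmod (LINT x|lborel. f x * cnj (f (x + h))) \<le> sqnorm lborel f"
proof -
  note fh = L2_cnj[OF L2_shift(1)[OF f, of h]]
  show i: "integrable lborel (\<lambda>x. f x * cnj (f (x + h)))" by (rule L2_prod_integrable[OF f fh])
  have "(LINT x|lborel. cmod (f x) * cmod (cnj (f (x + h))))\<^sup>2 \<le> (sqnorm lborel f)\<^sup>2"
    using cauchy_schwarz_cmod[OF f fh] L2_shift(2)[OF f, of h] sqnorm_cnj[of lborel "\<lambda>x. f (x + h)"]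
    by (simp add: power2_eq_square)
  then have le: "(LINT x|lborel. cmod (f x * cnj (f (x + h)))) \<le> sqnorm lborel f"
    by (subst norm_mult) (rule power2_le_imp_le, simp_all)
  show "(\<integral>\<^sup>+x. ennreal (cmod (f x * cnj (f (x + h)))) \<partial>lborel) \<le> ennreal (sqnorm lborel f)"
    using integrable_norm[OF i] le by (subst nn_integral_eq_integral) auto
  show "cmod (LINT x|lborel. f x * cnj (f (x + h))) \<le> sqnorm lborel f"
    using integral_norm_bound[of lborel "\<lambda>x. f x * cnj (f (x + h))"] le by linarith
qed

text \<open>Substituting \<open>y = x + s *\<^sub>R w\<close> turns the kernel, which degenerates as
  \<open>s\<close> tends to 0, into a fixed Gaussian in \<open>w\<close> times the autocorrelation
  of \<open>f\<close> at the shift \<open>s *\<^sub>R w\<close>; the powers of \<open>s\<close>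
  cancel.\<close>

lemma fourier_gauss_correlation:
  assumes f: "integrable lborel f" and f2: "f \<in> L2 lborel" and s: "s > 0"
  shows "complex_of_real (LINT p|lborel. (cmod (fourier f p))\<^sup>2 * exp (- s\<^sup>2 * (norm p)\<^sup>2 / 2)) =
    complex_of_real (((2 * pi) powr (- 3 / 2))\<^sup>2 * sqrt (2 * pi) ^ 3) * (LINT w|lborel.
      complex_of_real (exp (- (norm w)\<^sup>2 / 2)) * (LINT x|lborel. f x * cnj (f (x + s *\<^sub>R w))))"
proof -
  have [measurable]: "f \<in> borel_measurable borel" using f by auto
  let ?c = "complex_of_real (((2 * pi) powr (- 3 / 2))\<^sup>2)"
  let ?K = "\<lambda>y::real^3. complex_of_real (sqrt (2 * pi / s\<^sup>2) ^ 3 * exp (- (norm y)\<^sup>2 / (2 * s\<^sup>2)))"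
  let ?g = "\<lambda>w::real^3. complex_of_real (exp (- (norm w)\<^sup>2 / 2))"
  let ?C = "complex_of_real (sqrt (2 * pi) ^ 3)"
  have iF: "integrable (lborel \<Otimes>\<^sub>M lborel) (\<lambda>z. f (fst z) * cnj (f (snd z)))"
    using f by (intro pair_mult_integral(1)) (auto intro: lborel.sigma_finite_measure_axioms)
  then have iFK: "integrable (lborel \<Otimes>\<^sub>M lborel) (\<lambda>z. f (fst z) * cnj (f (snd z)) * ?K (snd z - fst z))"
    by (intro Bochner_Integration.integrable_bound[OF integrable_mult_right[OF iF, of "complex_of_real (sqrt (2 * pi / s\<^sup>2) ^ 3)"]])
       (auto simp: norm_mult mult_ac intro!: AE_I2 mult_left_mono mult_left_le)
  have Ks: "?K (s *\<^sub>R w) = complex_of_real (1 / s ^ 3) * ?C * ?g w" for w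
    using s by (simp add: power_mult_distrib real_sqrt_divide power_divide)
  have inner: "(LINT y|lborel. f x * cnj (f y) * ?K (y - x)) =
     (LINT w|lborel. ?C * (?g w * (f x * cnj (f (x + s *\<^sub>R w)))))" for x
  proof -
    have "(LINT y|lborel. f x * cnj (f y) * ?K (y - x)) = \<bar>s\<bar> ^ DIM(real^3) *\<^sub>R
       (LINT w|lborel. f x * cnj (f (x + s *\<^sub>R w)) * ?K (x + s *\<^sub>R w - x))"
      using s by (intro lborel_affine_integral) auto
    also have "\<dots> = complex_of_real (s ^ 3) * (LINT w|lborel. complex_of_real (1 / s ^ 3) * (?C * (?g w * (f x * cnj (f (x + s *\<^sub>R w))))))"
      unfolding add_diff_cancel_left' Ks using s by (simp add: scaleR_conv_of_real mult_ac)
    also have "\<dots> = (LINT w|lborel. ?C * (?g w * (f x * cnj (f (x + s *\<^sub>R w)))))"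
      using s by (simp only: integral_mult_right_zero) (simp add: mult.assoc[symmetric])
    finally show ?thesis .
  qed
  have isw: "integrable (lborel \<Otimes>\<^sub>M lborel) (\<lambda>(x, w). ?g w * (f x * cnj (f (x + s *\<^sub>R w))))"
  proof (rule integrableI_bounded)
    show "(\<lambda>(x, w). ?g w * (f x * cnj (f (x + s *\<^sub>R w)))) \<in> borel_measurable (lborel \<Otimes>\<^sub>M lborel)"
      by measurable
    have "(\<integral>\<^sup>+z. ennreal (norm (case z of (x, w) \<Rightarrow> ?g w * (f x * cnj (f (x + s *\<^sub>R w))))) \<partial>(lborel \<Otimes>\<^sub>M lborel)) =
       (\<integral>\<^sup>+w. \<integral>\<^sup>+x. ennreal (exp (- (norm w)\<^sup>2 / 2)) * ennreal (cmod (f x * cnj (f (x + s *\<^sub>R w)))) \<partial>lborel \<partial>lborel)"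
      by (subst lborel_pair.nn_integral_snd[symmetric]) (auto simp: norm_mult ennreal_mult'[symmetric])
    also have "\<dots> = (\<integral>\<^sup>+w. ennreal (exp (- (norm w)\<^sup>2 / 2)) * (\<integral>\<^sup>+x. ennreal (cmod (f x * cnj (f (x + s *\<^sub>R w)))) \<partial>lborel) \<partial>lborel)"
      by (intro nn_integral_cong nn_integral_cmult) auto
    also have "\<dots> \<le> (\<integral>\<^sup>+w. ennreal (exp (- (norm (w::real^3))\<^sup>2 / 2)) * ennreal (sqnorm lborel f) \<partial>lborel)"
      by (intro nn_integral_mono mult_left_mono nn_integral_L2_correlation(1)[OF f2]) auto
    also have "\<dots> = (\<integral>\<^sup>+w. ennreal (exp (- (norm (w::real^3))\<^sup>2 / 2)) \<partial>lborel) * ennreal (sqnorm lborel f)"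
      by (rule nn_integral_multc) auto
    also have "\<dots> < \<infinity>"
      using gaussian_fourier(1)[of 1, where 'a = "real^3"] by (subst nn_integral_eq_integral) (auto simp: ennreal_mult_less_top)
    finally show "(\<integral>\<^sup>+z. ennreal (norm (case z of (x, w) \<Rightarrow> ?g w * (f x * cnj (f (x + s *\<^sub>R w))))) \<partial>(lborel \<Otimes>\<^sub>M lborel)) < \<infinity>" .
  qed
  have "complex_of_real (LINT p|lborel. (cmod (fourier f p))\<^sup>2 * exp (- s\<^sup>2 * (norm p)\<^sup>2 / 2)) =
    ?c * (LINT z|(lborel \<Otimes>\<^sub>M lborel). f (fst z) * cnj (f (snd z)) * ?K (snd z - fst z))"
    using s by (intro fourier_gauss_regularized[OF f]) simp
  also have "(LINT z|(lborel \<Otimes>\<^sub>M lborel). f (fst z) * cnj (f (snd z)) * ?K (snd z - fst z)) =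
     (LINT x|lborel. LINT y|lborel. f x * cnj (f y) * ?K (y - x))"
    using lborel_pair.integral_fst'[OF iFK] by simp
  also have "\<dots> = ?C * (LINT x|lborel. LINT w|lborel. ?g w * (f x * cnj (f (x + s *\<^sub>R w))))"
    unfolding inner by simp
  also have "(LINT x|lborel. LINT w|lborel. ?g w * (f x * cnj (f (x + s *\<^sub>R w)))) =
     (LINT w|lborel. LINT x|lborel. ?g w * (f x * cnj (f (x + s *\<^sub>R w))))"
    by (rule lborel_pair.Fubini_integral[OF isw, symmetric])
  also have "\<dots> = (LINT w|lborel. ?g w * (LINT x|lborel. f x * cnj (f (x + s *\<^sub>R w))))" by simp
  finally show ?thesis by (simp add: mult.assoc)
qed

text \<open>As \<open>s n\<close> decreases to 0, the right-hand side of
  \<open>fourier_gauss_correlation\<close> converges because the autocorrelation is bounded and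
  continuous at 0, while the left-hand side increases to the integral of
  \<open>\<bar>fourier f\<bar>\<^sup>2\<close>. Finiteness of that integral is thus obtained
  together with its value.\<close>

theorem plancherel_L1_L2:
  assumes f: "integrable lborel f" and f2: "f \<in> L2 lborel"
  shows "fourier f \<in> L2 lborel" "sqnorm lborel (fourier f) = sqnorm lborel f"
proof -
  have [measurable]: "f \<in> borel_measurable borel" using f by auto
  let ?C = "((2 * pi) powr (- 3 / 2))\<^sup>2 * sqrt (2 * pi) ^ 3"
  define s where "s n = 1 / real (Suc n)" for n
  have s: "s n > 0" for n by (simp add: s_def)
  have s0: "s \<longlonglongrightarrow> 0" unfolding s_def using LIMSEQ_inverse_real_of_nat by (simp add: inverse_eq_divide)
  define \<phi> where "\<phi> h = (LINT x|lborel. f x * cnj (f (x + h)))" for h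
  have \<phi>m[measurable]: "\<phi> \<in> borel_measurable borel"
    unfolding \<phi>_def by (rule lborel.borel_measurable_lebesgue_integral) measurable
  have \<phi>0: "\<phi> 0 = complex_of_real (sqnorm lborel f)"
    unfolding \<phi>_def sqnorm_def integral_complex_of_real[symmetric] by (simp add: complex_norm_square del: of_real_power)
  have \<phi>b: "cmod (\<phi> h) \<le> sqnorm lborel f" for h
    unfolding \<phi>_def by (rule nn_integral_L2_correlation(3)[OF f2])
  have \<phi>lim: "(\<lambda>n. \<phi> (h n)) \<longlonglongrightarrow> \<phi> 0" if h: "h \<longlonglongrightarrow> 0" for h
  proof -
    have "(\<lambda>n. sqrt (sqnorm lborel f * sqnorm lborel (\<lambda>x. f (x + h n) - f x))) \<longlonglongrightarrow> sqrt (sqnorm lborel f * 0)"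
      by (intro tendsto_intros L2_translation_continuous[OF f2 f h])
    then have lim: "(\<lambda>n. sqrt (sqnorm lborel f * sqnorm lborel (\<lambda>x. f (x + h n) - f x))) \<longlonglongrightarrow> 0" by simp
    have "(\<lambda>n. \<phi> (h n) - \<phi> 0) \<longlonglongrightarrow> 0"
    proof (rule Lim_null_comparison[OF always_eventually lim], rule allI)
      fix n
      note d = L2_cnj[OF L2_diff[OF L2_shift(1)[OF f2, of "h n"] f2]]
      have "\<phi> (h n) - \<phi> 0 = (LINT x|lborel. f x * cnj (f (x + h n) - f x))"
        using nn_integral_L2_correlation(2)[OF f2, of "h n"] nn_integral_L2_correlation(2)[OF f2, of 0]
        by (simp add: \<phi>_def algebra_simps)
      then have "(cmod (\<phi> (h n) - \<phi> 0))\<^sup>2 \<le> sqnorm lborel f * sqnorm lborel (\<lambda>x. f (x + h n) - f x)"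
        using cauchy_schwarz[OF f2 d] by (simp only: sqnorm_cnj)
      then show "norm (\<phi> (h n) - \<phi> 0) \<le> sqrt (sqnorm lborel f * sqnorm lborel (\<lambda>x. f (x + h n) - f x))"
        by (rule real_le_rsqrt)
    qed
    then show ?thesis by (simp add: LIM_zero_iff)
  qed
  have "(\<lambda>n. LINT w|lborel. complex_of_real (exp (- (norm (w::real^3))\<^sup>2 / 2)) * \<phi> (s n *\<^sub>R w)) \<longlonglongrightarrow>
     (LINT w|lborel. complex_of_real (exp (- (norm (w::real^3))\<^sup>2 / 2)) * \<phi> 0)"
  proof (rule integral_dominated_convergence[where w = "\<lambda>w. exp (- (norm (w::real^3))\<^sup>2 / 2) * sqnorm lborel f"])
    show "integrable lborel (\<lambda>w. exp (- (norm (w::real^3))\<^sup>2 / 2) * sqnorm lborel f)"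
      using gaussian_fourier(1)[of 1, where 'a = "real^3"] by auto
    show "AE w in lborel. (\<lambda>n. complex_of_real (exp (- (norm (w::real^3))\<^sup>2 / 2)) * \<phi> (s n *\<^sub>R w)) \<longlonglongrightarrow>
       complex_of_real (exp (- (norm w)\<^sup>2 / 2)) * \<phi> 0"
    proof (intro AE_I2 tendsto_intros \<phi>lim)
      fix w :: "real^3"
      show "(\<lambda>n. s n *\<^sub>R w) \<longlonglongrightarrow> 0" using tendsto_scaleR[OF s0 tendsto_const[of w]] by simp
    qed
    show "AE w in lborel. norm (complex_of_real (exp (- (norm (w::real^3))\<^sup>2 / 2)) * \<phi> (s n *\<^sub>R w)) \<le>
       exp (- (norm w)\<^sup>2 / 2) * sqnorm lborel f" for n
      by (auto simp: norm_mult intro!: mult_left_mono \<phi>b)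
  qed measurable
  then have "(\<lambda>n. complex_of_real ?C * (LINT w|lborel. complex_of_real (exp (- (norm (w::real^3))\<^sup>2 / 2)) * \<phi> (s n *\<^sub>R w)))
     \<longlonglongrightarrow> complex_of_real ?C * (LINT w|lborel. complex_of_real (exp (- (norm (w::real^3))\<^sup>2 / 2)) * \<phi> 0)"
    by (intro tendsto_intros)
  moreover have "complex_of_real ?C * (LINT w|lborel. complex_of_real (exp (- (norm (w::real^3))\<^sup>2 / 2)) * \<phi> 0) =
     complex_of_real (?C * sqrt (2 * pi) ^ 3 * sqnorm lborel f)"
    by (simp only: \<phi>0 of_real_mult[symmetric] integral_complex_of_real integral_mult_left_zero gaussian_total mult.assoc)
  ultimately have "(\<lambda>n. complex_of_real (LINT p|lborel. (cmod (fourier f p))\<^sup>2 * exp (- (s n)\<^sup>2 * (norm p)\<^sup>2 / 2)))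
     \<longlonglongrightarrow> complex_of_real (sqnorm lborel f)"
    unfolding fourier_gauss_correlation[OF f f2 s] \<phi>_def[symmetric] fourier_const by (simp only: mult_1_left)
  then have lim: "(\<lambda>n. LINT p|lborel. (cmod (fourier f p))\<^sup>2 * exp (- (s n)\<^sup>2 * (norm p)\<^sup>2 / 2))
     \<longlonglongrightarrow> sqnorm lborel f"
    by (simp only: tendsto_of_real_iff)
  define F where "F n p = (cmod (fourier f p))\<^sup>2 * exp (- (s n)\<^sup>2 * (norm p)\<^sup>2 / 2)" for n p
  have Fm[measurable]: "F n \<in> borel_measurable borel" for n unfolding F_def by measurable
  have iF: "integrable lborel (F n)" for n
  proof (rule Bochner_Integration.integrable_bound)
    let ?B = "((2 * pi) powr (- 3 / 2) * (LINT x|lborel. cmod (f x)))\<^sup>2"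
    show "integrable lborel (\<lambda>p::real^3. ?B * exp (- (s n)\<^sup>2 * (norm p)\<^sup>2 / 2))"
      using s[of n] by (intro integrable_mult_right gaussian_fourier(1)) auto
    show "AE p in lborel. norm (F n p) \<le> norm (?B * exp (- (s n)\<^sup>2 * (norm p)\<^sup>2 / 2))"
    proof (rule AE_I2)
      fix p :: "real^3"
      have "(cmod (fourier f p))\<^sup>2 \<le> ?B" by (intro power_mono fourier_bound[OF f]) simp
      then show "norm (F n p) \<le> norm (?B * exp (- (s n)\<^sup>2 * (norm p)\<^sup>2 / 2))"
        unfolding F_def by (simp add: abs_mult mult_right_mono)
    qed
  qed measurable
  have "(\<lambda>n. \<integral>\<^sup>+p. ennreal (F n p) \<partial>lborel) \<longlonglongrightarrow> (\<integral>\<^sup>+p. ennreal ((cmod (fourier f p))\<^sup>2) \<partial>lborel)"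
  proof (rule nn_integral_LIMSEQ)
    show "incseq (\<lambda>n p. ennreal (F n p))"
    proof (intro incseq_SucI le_funI ennreal_leI)
      fix n and p :: "real^3"
      have "(s (Suc n))\<^sup>2 \<le> (s n)\<^sup>2" using s[of "Suc n"] by (intro power_mono) (auto simp: s_def field_simps)
      then have "(s (Suc n))\<^sup>2 * (norm p)\<^sup>2 \<le> (s n)\<^sup>2 * (norm p)\<^sup>2" by (rule mult_right_mono) simp
      then show "F n p \<le> F (Suc n) p" unfolding F_def by (intro mult_left_mono) auto
    qed
    fix p :: "real^3"
    have "(\<lambda>n. F n p) \<longlonglongrightarrow> (cmod (fourier f p))\<^sup>2 * exp (- (0)\<^sup>2 * (norm p)\<^sup>2 / 2)"
      unfolding F_def by (intro tendsto_intros s0) auto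
    then show "(\<lambda>n. ennreal (F n p)) \<longlonglongrightarrow> ennreal ((cmod (fourier f p))\<^sup>2)"
      by (intro tendsto_ennrealI) simp
  qed measurable
  moreover have "(\<integral>\<^sup>+p. ennreal (F n p) \<partial>lborel) = ennreal (LINT p|lborel. F n p)" for n
    by (rule nn_integral_eq_integral[OF iF]) (simp add: F_def)
  moreover have "(\<lambda>n. ennreal (LINT p|lborel. F n p)) \<longlonglongrightarrow> ennreal (sqnorm lborel f)"
    using lim unfolding F_def by (intro tendsto_ennrealI)
  ultimately have eq: "(\<integral>\<^sup>+p. ennreal ((cmod (fourier f p))\<^sup>2) \<partial>lborel) = ennreal (sqnorm lborel f)"
    by (auto intro: LIMSEQ_unique)
  show 1: "fourier f \<in> L2 lborel"
    by (rule L2_I_nn) (use eq in auto)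
  from nn_integral_sqnorm[OF this] eq show "sqnorm lborel (fourier f) = sqnorm lborel f"
    by simp
qed

section \<open>The Fourier--Plancherel relation\<close>

text \<open>For Borel functions, integrals over the completed measure agree with those over
  \<open>lborel\<close>. The estimates are carried out on Borel representatives, for which
  substitutions and product measures stay measurable.\<close>

lemma is_fourier_L2_borel:
  assumes [measurable]: "f \<in> borel_measurable borel" "g \<in> borel_measurable borel"
  shows "is_fourier_L2 f g \<longleftrightarrow> f \<in> L2 lborel \<and> g \<in> L2 lborel \<and>
    (\<lambda>n::nat. \<integral>\<^sup>+p. ennreal ((cmod (fourier (\<lambda>x. indicator (cball 0 (real n)) x * f x) p - g p))\<^sup>2) \<partial>lborel)
      \<longlonglongrightarrow> 0"
proof -
  have "h \<in> L2 lebesgue \<longleftrightarrow> h \<in> L2 lborel" if [measurable]: "h \<in> borel_measurable borel" for h :: "real^3 \<Rightarrow> complex"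
  proof -
    have "h \<in> borel_measurable lebesgue" by (rule measurable_completion) simp
    then show ?thesis by (simp add: L2_iff integrable_completion)
  qed
  then show ?thesis by (simp add: is_fourier_L2_def nn_integral_completion)
qed

lemma complex_borel_representative:
  fixes f :: "'a::euclidean_space \<Rightarrow> complex"
  assumes "f \<in> borel_measurable lebesgue"
  obtains f' where "f' \<in> borel_measurable borel" "AE x in lebesgue. f x = f' x"
proof -
  have "(\<lambda>x. Re (f x)) \<in> borel_measurable lebesgue" "(\<lambda>x. Im (f x)) \<in> borel_measurable lebesgue"
    using assms by measurable
  from this[THEN completion_ex_borel_measurable_real] obtain r i where
    [measurable]: "r \<in> borel_measurable lborel" "i \<in> borel_measurable lborel" and
    ae: "AE x in lborel. Re (f x) = r x" "AE x in lborel. Im (f x) = i x" by auto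
  have "AE x in lborel. f x = Complex (r x) (i x)"
    using ae by eventually_elim (simp add: complex_eq_iff)
  then have "AE x in lebesgue. f x = Complex (r x) (i x)" by (rule AE_completion)
  moreover have "(\<lambda>x. Complex (r x) (i x)) \<in> borel_measurable borel"
    unfolding complex_eq_cancel_iff2 Complex_eq by measurable
  ultimately show ?thesis using that by blast
qed

lemma fourier_cong_AE:
  assumes "AE x in lebesgue. f x = g x" "f \<in> borel_measurable lebesgue" "g \<in> borel_measurable lebesgue"
  shows "fourier f p = fourier g p"
proof -
  have e: "(\<lambda>x. exp (- \<i> * complex_of_real (p \<bullet> x))) \<in> borel_measurable lebesgue"
    by (rule measurable_completion) measurable
  have "(LINT x|lebesgue. f x * exp (- \<i> * complex_of_real (p \<bullet> x))) = (LINT x|lebesgue. g x * exp (- \<i> * complex_of_real (p \<bullet> x)))"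
    by (rule integral_cong_AE[OF borel_measurable_times[OF assms(2) e] borel_measurable_times[OF assms(3) e]])
       (use assms(1) in \<open>eventually_elim, simp\<close>)
  then show ?thesis by (simp add: fourier_def)
qed

text \<open>Truncated Fourier integrals do not see null sets in \<open>x\<close>, and the distance
  to \<open>g\<close> is an integral in \<open>p\<close>; this permits the passage to Borel
  representatives.\<close>

lemma is_fourier_L2_cong_AE:
  assumes F: "is_fourier_L2 f g"
    and f': "f' \<in> borel_measurable lebesgue" "AE x in lebesgue. f x = f' x"
    and g': "g' \<in> borel_measurable lebesgue" "AE x in lebesgue. g x = g' x"
  shows "is_fourier_L2 f' g'"
proof -
  have [measurable]: "(indicator (cball 0 r) :: real^3 \<Rightarrow> complex) \<in> borel_measurable lebesgue" for r :: real
    by (rule measurable_completion) (auto intro!: borel_measurable_indicator)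
  have m: "f \<in> borel_measurable lebesgue" using F by (auto simp: is_fourier_L2_def L2_iff)
  have eq: "fourier (\<lambda>x. indicator (cball 0 (real n)) x * f x) p = fourier (\<lambda>x. indicator (cball 0 (real n)) x * f' x) p" for n p
  proof (rule fourier_cong_AE)
    show "AE x in lebesgue. indicator (cball 0 (real n)) x * f x = indicator (cball 0 (real n)) x * f' x"
      using f'(2) by eventually_elim simp
  qed (use m f'(1) in measurable)
  have "(\<integral>\<^sup>+p. ennreal ((cmod (fourier (\<lambda>x. indicator (cball 0 (real n)) x * f x) p - g p))\<^sup>2) \<partial>lebesgue) =
     (\<integral>\<^sup>+p. ennreal ((cmod (fourier (\<lambda>x. indicator (cball 0 (real n)) x * f' x) p - g' p))\<^sup>2) \<partial>lebesgue)" for n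
    unfolding eq
  proof (rule nn_integral_cong_AE)
    show "AE p in lebesgue. ennreal ((cmod (fourier (\<lambda>x. indicator (cball 0 (real n)) x * f' x) p - g p))\<^sup>2) =
       ennreal ((cmod (fourier (\<lambda>x. indicator (cball 0 (real n)) x * f' x) p - g' p))\<^sup>2)"
      using g'(2) by eventually_elim simp
  qed
  moreover have "f' \<in> L2 lebesgue"
  proof (rule L2_AE_cong(1)[of f])
    show "AE x in lebesgue. f' x = f x" using f'(2) by eventually_elim simp
  qed (use F f' in \<open>simp_all add: is_fourier_L2_def\<close>)
  moreover have "g' \<in> L2 lebesgue"
  proof (rule L2_AE_cong(1)[of g])
    show "AE x in lebesgue. g' x = g x" using g'(2) by eventually_elim simp
  qed (use F g' in \<open>simp_all add: is_fourier_L2_def\<close>)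
  ultimately show ?thesis using F by (simp add: is_fourier_L2_def)
qed

lemma L2_bounded_support_integrable:
  fixes f :: "'a::euclidean_space \<Rightarrow> complex"
  assumes f: "f \<in> L2 lborel"
  shows "integrable lborel (\<lambda>x. indicator (cball 0 r) x * f x)"
proof -
  have "(\<lambda>x. (cmod (indicator (cball 0 r) x))\<^sup>2) = (indicator (cball 0 r) :: 'a \<Rightarrow> real)"
    by (auto simp: indicator_def)
  then have "(\<lambda>x. indicator (cball 0 r) x) \<in> L2 (lborel :: 'a measure)"
    using emeasure_bounded_finite[of "cball (0::'a) r"]
    by (auto simp: L2_iff intro!: integrable_real_indicator borel_measurable_indicator)
  from L2_prod_integrable[OF this f] show ?thesis by simp
qed

text \<open>On a ball a square-integrable function is integrable, so \<open>plancherel_L1_L2\<close>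
  applies to every truncation.\<close>

lemma truncated_fourier:
  assumes f: "f \<in> L2 lborel"
  defines "F \<equiv> \<lambda>n. fourier (\<lambda>x. indicator (cball 0 (real n)) x * f x)"
  shows "F n \<in> L2 lborel" "sqnorm lborel (F n) = sqnorm lborel (\<lambda>x. indicator (cball 0 (real n)) x * f x)"
    "(\<lambda>n. sqnorm lborel (F n)) \<longlonglongrightarrow> sqnorm lborel f"
proof -
  have t: "(\<lambda>x. indicator (cball 0 (real n)) x * f x) \<in> L2 lborel" for n
    by (rule L2_indicator[OF f]) auto
  show "F n \<in> L2 lborel" and *: "sqnorm lborel (F n) = sqnorm lborel (\<lambda>x. indicator (cball 0 (real n)) x * f x)" for n
    unfolding F_def using plancherel_L1_L2[OF L2_bounded_support_integrable[OF f] t] by auto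
  show "(\<lambda>n. sqnorm lborel (F n)) \<longlonglongrightarrow> sqnorm lborel f"
    unfolding *
  proof (rule truncation_sqnorm_lim(2)[OF f])
    fix x :: "real^3"
    have "norm x \<le> real n" if "nat \<lceil>norm x\<rceil> \<le> n" for n using that by linarith
    then show "\<forall>\<^sub>F n in sequentially. x \<in> cball 0 (real n)"
      by (intro eventually_sequentiallyI[of "nat \<lceil>norm x\<rceil>"]) simp
  qed auto
qed

lemma nn_tendsto_sqnorm:
  assumes "\<And>n. F n \<in> L2 M" "g \<in> L2 M"
  shows "((\<lambda>n. \<integral>\<^sup>+p. ennreal ((cmod (F n p - g p))\<^sup>2) \<partial>M) \<longlonglongrightarrow> 0) \<longleftrightarrow>
    (\<lambda>n. sqnorm M (\<lambda>p. F n p - g p)) \<longlonglongrightarrow> 0"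
proof -
  have "(\<integral>\<^sup>+p. ennreal ((cmod (F n p - g p))\<^sup>2) \<partial>M) = ennreal (sqnorm M (\<lambda>p. F n p - g p))" for n
    by (rule nn_integral_sqnorm[OF L2_diff[OF assms]])
  then show ?thesis
    using tendsto_ennreal_iff[where F = sequentially and f = "\<lambda>n. sqnorm M (\<lambda>p. F n p - g p)" and x = 0]
    by simp
qed

lemma is_fourier_L2_iff_sqnorm:
  assumes "f \<in> borel_measurable borel" "g \<in> borel_measurable borel"
  shows "is_fourier_L2 f g \<longleftrightarrow> f \<in> L2 lborel \<and> g \<in> L2 lborel \<and>
    (\<lambda>n::nat. sqnorm lborel (\<lambda>p. fourier (\<lambda>x. indicator (cball 0 (real n)) x * f x) p - g p)) \<longlonglongrightarrow> 0"
  unfolding is_fourier_L2_borel[OF assms]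
  by (auto simp: nn_tendsto_sqnorm[OF truncated_fourier(1)])

text \<open>Expanding the square around \<open>g\<close> leaves a cross term that Cauchy--Schwarz
  bounds by the vanishing distance.\<close>

lemma sqnorm_tendsto:
  assumes F: "\<And>n. F n \<in> L2 M" and g: "g \<in> L2 M"
    and lim: "(\<lambda>n. sqnorm M (\<lambda>p. F n p - g p)) \<longlonglongrightarrow> 0"
  shows "(\<lambda>n. sqnorm M (F n)) \<longlonglongrightarrow> sqnorm M g"
proof -
  have d: "(\<lambda>p. g p - F n p) \<in> L2 M" "sqnorm M (\<lambda>p. g p - F n p) = sqnorm M (\<lambda>p. F n p - g p)" for n
    using L2_diff[OF g F] by (auto simp: sqnorm_def norm_minus_commute)
  have e: "sqnorm M (F n) - sqnorm M g = sqnorm M (\<lambda>p. F n p - g p) - 2 * Re (LINT p|M. cnj (g p) * (g p - F n p))" for n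
    using sqnorm_diff_expand[OF g d(1), of n] by (simp add: d(2))
  have "(\<lambda>n. LINT p|M. cnj (g p) * (g p - F n p)) \<longlonglongrightarrow> 0"
  proof (rule Lim_null_comparison[OF always_eventually])
    show "\<forall>n. norm (LINT p|M. cnj (g p) * (g p - F n p)) \<le> sqrt (sqnorm M g * sqnorm M (\<lambda>p. F n p - g p))"
      using cauchy_schwarz[OF L2_cnj[OF g] d(1)] by (auto intro!: real_le_rsqrt simp: sqnorm_cnj d(2))
    have "(\<lambda>n. sqrt (sqnorm M g * sqnorm M (\<lambda>p. F n p - g p))) \<longlonglongrightarrow> sqrt (sqnorm M g * 0)"
      by (intro tendsto_intros lim)
    then show "(\<lambda>n. sqrt (sqnorm M g * sqnorm M (\<lambda>p. F n p - g p))) \<longlonglongrightarrow> 0" by simp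
  qed
  then have "(\<lambda>n. sqnorm M (\<lambda>p. F n p - g p) - 2 * Re (LINT p|M. cnj (g p) * (g p - F n p))) \<longlonglongrightarrow> 0 - 2 * Re 0"
    by (intro tendsto_intros lim)
  then have "(\<lambda>n. sqnorm M (F n) - sqnorm M g) \<longlonglongrightarrow> 0" unfolding e by simp
  then show ?thesis by (simp add: LIM_zero_iff)
qed

text \<open>The square norms of the truncated transforms converge to that of \<open>g\<close> by the
  definition of the relation and to that of \<open>f\<close> by Plancherel's identity.\<close>

lemma is_fourier_L2_sqnorm:
  assumes [measurable]: "f \<in> borel_measurable borel" "g \<in> borel_measurable borel"
    and F: "is_fourier_L2 f g"
  shows "sqnorm lborel f = sqnorm lborel g"
proof -
  have *: "f \<in> L2 lborel" "g \<in> L2 lborel"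
    "(\<lambda>n::nat. sqnorm lborel (\<lambda>p. fourier (\<lambda>x. indicator (cball 0 (real n)) x * f x) p - g p)) \<longlonglongrightarrow> 0"
    using F by (auto simp: is_fourier_L2_iff_sqnorm)
  from sqnorm_tendsto[OF truncated_fourier(1)[OF *(1)] *(2,3)] truncated_fourier(3)[OF *(1)]
  show ?thesis using LIMSEQ_unique by blast
qed

text \<open>Serves to remove from a function the part with frequencies in a given set and still know
  the transform of the remainder.\<close>

lemma is_fourier_L2_diff:
  assumes [measurable]: "f \<in> borel_measurable borel" "g \<in> borel_measurable borel"
    "f' \<in> borel_measurable borel" "g' \<in> borel_measurable borel"
    and F: "is_fourier_L2 f g" and F': "is_fourier_L2 f' g'"
  shows "is_fourier_L2 (\<lambda>x. f x - f' x) (\<lambda>p. g p - g' p)"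
proof -
  let ?T = "\<lambda>f n. fourier (\<lambda>x. indicator (cball 0 (real n)) x * f x)"
  have *: "f \<in> L2 lborel" "g \<in> L2 lborel" "f' \<in> L2 lborel" "g' \<in> L2 lborel"
    "(\<lambda>n. sqnorm lborel (\<lambda>p. ?T f n p - g p)) \<longlonglongrightarrow> 0" "(\<lambda>n. sqnorm lborel (\<lambda>p. ?T f' n p - g' p)) \<longlonglongrightarrow> 0"
    using F F' by (auto simp: is_fourier_L2_iff_sqnorm)
  have T: "?T (\<lambda>x. f x - f' x) n p = ?T f n p - ?T f' n p" for n p
    using fourier_diff[OF L2_bounded_support_integrable[OF *(1)] L2_bounded_support_integrable[OF *(3)]]
    by (simp add: right_diff_distrib)
  have "(\<lambda>n. 2 * sqnorm lborel (\<lambda>p. ?T f n p - g p) + 2 * sqnorm lborel (\<lambda>p. ?T f' n p - g' p)) \<longlonglongrightarrow> 2 * 0 + 2 * 0"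
    by (intro tendsto_intros *)
  then have lim: "(\<lambda>n. 2 * sqnorm lborel (\<lambda>p. ?T f n p - g p) + 2 * sqnorm lborel (\<lambda>p. ?T f' n p - g' p)) \<longlonglongrightarrow> 0" by simp
  have "(\<lambda>n. sqnorm lborel (\<lambda>p. ?T (\<lambda>x. f x - f' x) n p - (g p - g' p))) \<longlonglongrightarrow> 0"
  proof (rule tendsto_sandwich[OF _ _ tendsto_const lim])
    show "\<forall>\<^sub>F n in sequentially. sqnorm lborel (\<lambda>p. ?T (\<lambda>x. f x - f' x) n p - (g p - g' p)) \<le>
       2 * sqnorm lborel (\<lambda>p. ?T f n p - g p) + 2 * sqnorm lborel (\<lambda>p. ?T f' n p - g' p)"
    proof (intro always_eventually allI)
      fix n
      note d = L2_diff[OF truncated_fourier(1)[OF *(1), of n] *(2)] and d' = L2_diff[OF truncated_fourier(1)[OF *(3), of n] *(4)]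
      have "sqnorm lborel (\<lambda>p. ?T (\<lambda>x. f x - f' x) n p - (g p - g' p)) =
         sqnorm lborel (\<lambda>p. (?T f n p - g p) + (-1) * (?T f' n p - g' p))"
        unfolding T by (simp add: algebra_simps)
      also have "\<dots> \<le> 2 * sqnorm lborel (\<lambda>p. ?T f n p - g p) + 2 * sqnorm lborel (\<lambda>p. (-1) * (?T f' n p - g' p))"
        by (rule sqnorm_add_le[OF d L2_scale[OF d']])
      finally show "sqnorm lborel (\<lambda>p. ?T (\<lambda>x. f x - f' x) n p - (g p - g' p)) \<le>
         2 * sqnorm lborel (\<lambda>p. ?T f n p - g p) + 2 * sqnorm lborel (\<lambda>p. ?T f' n p - g' p)"
        by (simp only: sqnorm_scale) simp
    qed
  qed (auto intro!: always_eventually)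
  then show ?thesis
    using * by (simp add: is_fourier_L2_iff_sqnorm L2_diff)
qed

text \<open>Written as the reflected forward transform, so that measurability, the sup bound and the
  norm identity are inherited from \<open>fourier\<close>.\<close>

definition inv_fourier :: "(real^3 \<Rightarrow> complex) \<Rightarrow> real^3 \<Rightarrow> complex"
  where "inv_fourier g x = fourier g (- x)"

lemma inv_fourier_lborel:
  assumes [measurable]: "g \<in> borel_measurable borel"
  shows "inv_fourier g x = complex_of_real ((2 * pi) powr (- 3 / 2)) * (LINT p|lborel. g p * iexp (p \<bullet> x))"
  by (simp add: inv_fourier_def fourier_lborel inner_commute)

lemma borel_measurable_inv_fourier [measurable]:
  "g \<in> borel_measurable borel \<Longrightarrow> inv_fourier g \<in> borel_measurable borel"
  unfolding inv_fourier_def[abs_def]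
  by (rule measurable_compose[OF borel_measurable_uminus[OF measurable_ident_sets[OF refl]] borel_measurable_fourier])

lemma inv_fourier_plancherel:
  assumes g: "integrable lborel g" and g2: "g \<in> L2 lborel"
  shows "inv_fourier g \<in> L2 lborel" "sqnorm lborel (inv_fourier g) = sqnorm lborel g"
proof -
  have [measurable]: "g \<in> borel_measurable borel" using g by auto
  have "(\<integral>\<^sup>+x. ennreal ((cmod (fourier g x))\<^sup>2) \<partial>lborel) = (\<integral>\<^sup>+x. ennreal ((cmod (inv_fourier g x))\<^sup>2) \<partial>lborel)"
    using lborel_affine_nn_integral[of "\<lambda>x. ennreal ((cmod (fourier g x))\<^sup>2)" "-1" 0]
    by (simp add: inv_fourier_def)
  then have eq: "(\<integral>\<^sup>+x. ennreal ((cmod (inv_fourier g x))\<^sup>2) \<partial>lborel) = ennreal (sqnorm lborel g)"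
    using plancherel_L1_L2[OF g g2] nn_integral_sqnorm by metis
  show 1: "inv_fourier g \<in> L2 lborel" by (rule L2_I_nn) (use eq in auto)
  from nn_integral_sqnorm[OF this] eq show "sqnorm lborel (inv_fourier g) = sqnorm lborel g" by simp
qed

text \<open>No inversion formula is needed: the cross term of the expanded square is evaluated by
  Fubini, and the norms by Plancherel's identity.\<close>

theorem is_fourier_L2_inv_fourier:
  assumes g: "integrable lborel g" and g2: "g \<in> L2 lborel"
  shows "is_fourier_L2 (inv_fourier g) g"
proof -
  have [measurable]: "g \<in> borel_measurable borel" using g by auto
  define \<psi> where "\<psi> = inv_fourier g"
  have [measurable]: "\<psi> \<in> borel_measurable borel" unfolding \<psi>_def by measurable
  have \<psi>: "\<psi> \<in> L2 lborel" "sqnorm lborel \<psi> = sqnorm lborel g"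
    unfolding \<psi>_def using inv_fourier_plancherel[OF g g2] by auto
  let ?c = "complex_of_real ((2 * pi) powr (- 3 / 2))"
  define h where "h n x = indicator (cball 0 (real n)) x * \<psi> x" for n x
  have h1: "integrable lborel (h n)" for n unfolding h_def by (rule L2_bounded_support_integrable[OF \<psi>(1)])
  have h2: "h n \<in> L2 lborel" for n unfolding h_def by (rule L2_indicator[OF \<psi>(1)]) auto
  have [measurable]: "h n \<in> borel_measurable borel" for n using h1 by auto
  \<comment> \<open>Fubini moves the transform from \<open>h n\<close> to \<open>g\<close>, where it
    becomes the conjugate of \<open>\<psi>\<close>; as \<open>h n\<close> is a truncation of
    \<open>\<psi>\<close>, the pairing is the square norm of \<open>h n\<close>.\<close>
  have cross: "(LINT p|lborel. cnj (g p) * fourier (h n) p) = complex_of_real (sqnorm lborel (h n))" for n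
  proof -
    have i: "integrable (lborel \<Otimes>\<^sub>M lborel) (\<lambda>(p, x). cnj (g p) * h n x * exp (- \<i> * complex_of_real (p \<bullet> x)))"
    proof -
      have "integrable (lborel \<Otimes>\<^sub>M lborel) (\<lambda>z. cnj (g (fst z)) * h n (snd z))"
        by (rule pair_mult_integral(1)[OF lborel.sigma_finite_measure_axioms lborel.sigma_finite_measure_axioms])
           (use g h1 in auto)
      then have "integrable (lborel \<Otimes>\<^sub>M lborel) (\<lambda>z. cnj (g (fst z)) * h n (snd z) * exp (- \<i> * complex_of_real (fst z \<bullet> snd z)))"
        by (rule integrable_mult_unimodular) auto
      then show ?thesis by (simp add: split_beta')
    qed
    have "(LINT p|lborel. cnj (g p) * fourier (h n) p) =
       ?c * (LINT p|lborel. LINT x|lborel. cnj (g p) * h n x * exp (- \<i> * complex_of_real (p \<bullet> x)))"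
    proof -
      have "cnj (g p) * fourier (h n) p =
         ?c * (LINT x|lborel. cnj (g p) * h n x * exp (- \<i> * complex_of_real (p \<bullet> x)))" for p
        unfolding fourier_lborel[OF \<open>h n \<in> borel_measurable borel\<close>] mult.assoc integral_mult_right_zero
        by (simp only: mult_ac)
      then show ?thesis by simp
    qed
    also have "(LINT p|lborel. LINT x|lborel. cnj (g p) * h n x * exp (- \<i> * complex_of_real (p \<bullet> x))) =
       (LINT x|lborel. LINT p|lborel. cnj (g p) * h n x * exp (- \<i> * complex_of_real (p \<bullet> x)))"
      by (rule lborel_pair.Fubini_integral[OF i, symmetric])
    also have "?c * \<dots> = (LINT x|lborel. h n x * (?c * (LINT p|lborel. cnj (g p) * exp (- \<i> * complex_of_real (p \<bullet> x)))))"
    proof -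
      have "(\<lambda>p. cnj (g p) * h n x * exp (- \<i> * complex_of_real (p \<bullet> x))) =
         (\<lambda>p. h n x * (cnj (g p) * exp (- \<i> * complex_of_real (p \<bullet> x))))" for x
        by (simp add: mult_ac)
      then show ?thesis
        unfolding mult.left_commute[of "h n _" ?c] by (simp only: integral_mult_right_zero)
    qed
    also have "\<dots> = (LINT x|lborel. h n x * cnj (\<psi> x))"
    proof (intro Bochner_Integration.integral_cong refl arg_cong2[where f = "(*)"])
      fix x
      have "(LINT p|lborel. cnj (g p * iexp (p \<bullet> x))) = cnj (LINT p|lborel. g p * iexp (p \<bullet> x))"
        by (rule Bochner_Integration.integral_cnj)
      then show "?c * (LINT p|lborel. cnj (g p) * exp (- \<i> * complex_of_real (p \<bullet> x))) = cnj (\<psi> x)"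
        by (simp add: \<psi>_def inv_fourier_lborel exp_cnj)
    qed
    also have "\<dots> = (LINT x|lborel. complex_of_real ((cmod (h n x))\<^sup>2))"
      unfolding complex_norm_square by (rule Bochner_Integration.integral_cong) (auto simp: h_def indicator_def)
    also have "\<dots> = complex_of_real (sqnorm lborel (h n))"
      by (simp add: sqnorm_def flip: integral_complex_of_real)
    finally show ?thesis .
  qed
  have T: "fourier (h n) \<in> L2 lborel" "sqnorm lborel (fourier (h n)) = sqnorm lborel (h n)"
    "(\<lambda>n. sqnorm lborel (h n)) \<longlonglongrightarrow> sqnorm lborel g" for n
    using truncated_fourier[OF \<psi>(1)] by (auto simp: h_def[abs_def] \<psi>(2))
  \<comment> \<open>The square norm of \<open>g\<close>, plus that of \<open>h n\<close>, minus
    twice that of \<open>h n\<close> from the cross term.\<close>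
  have "sqnorm lborel (\<lambda>p. fourier (h n) p - g p) = sqnorm lborel g - sqnorm lborel (h n)" for n
  proof -
    have "sqnorm lborel (\<lambda>p. fourier (h n) p - g p) = sqnorm lborel (\<lambda>p. g p - fourier (h n) p)"
      by (simp add: sqnorm_def norm_minus_commute)
    then show ?thesis using sqnorm_diff_expand[OF g2 T(1)] by (simp add: cross T(2))
  qed
  moreover have "(\<lambda>n. sqnorm lborel g - sqnorm lborel (h n)) \<longlonglongrightarrow> sqnorm lborel g - sqnorm lborel g"
    by (intro tendsto_intros T(3))
  ultimately show ?thesis
    using \<psi>(1) g2 unfolding \<psi>_def[symmetric] by (simp add: is_fourier_L2_iff_sqnorm h_def[abs_def])
qed

section \<open>Polar coordinates\<close>

abbreviation unit_sphere_borel :: "(real^3) measure"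
  where "unit_sphere_borel \<equiv> restrict_space borel (sphere 0 1)"

text \<open>The value at the origin is an arbitrary unit vector, so that the map takes values in the
  sphere everywhere; the origin is a null set.\<close>

definition direction :: "real^3 \<Rightarrow> real^3"
  where "direction x = (if x = 0 then axis 1 1 else x /\<^sub>R norm x)"

text \<open>Kept on all reals, with a density vanishing on the negative axis, so that the radius
  ranges over an unrestricted space; negative radii form a null set.\<close>

definition radial_measure :: "real measure"
  where "radial_measure = density lborel (\<lambda>r. ennreal (r\<^sup>2 * indicator {0..} r))"

lemma norm_direction [simp]: "norm (direction x) = 1"
  by (simp add: direction_def norm_axis_1)

lemma direction_scaleR: "c > 0 \<Longrightarrow> direction (c *\<^sub>R x) = direction x"
  by (auto simp: direction_def)

lemma direction_decompose: "norm x *\<^sub>R direction x = x"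
  by (simp add: direction_def)

lemma direction_sphere: "w \<in> sphere 0 1 \<Longrightarrow> direction w = w"
  by (auto simp: direction_def)

lemma measurable_direction [measurable]: "direction \<in> borel \<rightarrow>\<^sub>M unit_sphere_borel"
proof (rule measurable_restrict_space2)
  have "(\<lambda>x. if x = 0 then axis 1 1 else x /\<^sub>R norm x) \<in> borel_measurable (borel :: (real^3) measure)"
    by measurable
  then show "direction \<in> borel_measurable borel" by (simp add: direction_def[abs_def])
qed auto

lemma measurable_direction' [measurable]: "direction \<in> borel_measurable borel"
  using measurable_direction by (simp add: measurable_restrict_space2_iff)

lemma space_sphere_measure [simp]: "space sphere_measure = sphere 0 1"
  by (simp add: sphere_measure_def space_scale_measure space_restrict_space)

lemma sets_sphere_measure [measurable_cong]: "sets sphere_measure = sets unit_sphere_borel"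
  by (simp add: sphere_measure_def)

lemma borel_measurable_sphere: "f \<in> borel_measurable borel \<Longrightarrow> f \<in> borel_measurable sphere_measure"
  using measurable_restrict_space1[of f borel borel] measurable_cong_sets[OF sets_sphere_measure refl] by blast

text \<open>Adding the origin, a null set, lets the cone be described by the total function
  \<open>direction\<close>.\<close>

lemma emeasure_sphere_measure:
  assumes B: "B \<in> sets unit_sphere_borel"
  shows "emeasure sphere_measure B = 3 * emeasure lborel {x. norm x \<le> 1 \<and> direction x \<in> B}"
proof -
  let ?C = "cball 0 1 - {0} :: (real^3) set"
  have m: "(\<lambda>x. x /\<^sub>R norm x) \<in> restrict_space lborel ?C \<rightarrow>\<^sub>M unit_sphere_borel"
  proof (rule measurable_restrict_space2)
    show "(\<lambda>x. x /\<^sub>R norm x) \<in> borel_measurable (restrict_space lborel ?C)"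
      by (rule measurable_restrict_space1) measurable
  qed (auto simp: space_restrict_space)
  have "(\<lambda>x. x /\<^sub>R norm x) -` B \<inter> ?C = {x. norm x \<le> 1 \<and> direction x \<in> B} - {0}"
    by (auto simp: direction_def)
  moreover have [measurable]: "{x. norm x \<le> 1 \<and> direction x \<in> B} \<in> sets borel"
    using B by measurable
  ultimately have "emeasure (distr (restrict_space lborel ?C) unit_sphere_borel (\<lambda>x. x /\<^sub>R norm x)) B =
      emeasure lborel ({x. norm x \<le> 1 \<and> direction x \<in> B} - {0})"
    using m B by (simp add: emeasure_distr space_restrict_space)
      (subst emeasure_restrict_space, auto)
  also have "\<dots> = emeasure lborel {x. norm x \<le> 1 \<and> direction x \<in> B}"
    by (rule emeasure_Diff_null_set) auto
  finally show ?thesis by (simp add: sphere_measure_def)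
qed

lemma emeasure_sphere_measure_finite: "emeasure sphere_measure (sphere 0 1) < \<infinity>"
proof -
  have "emeasure sphere_measure (sphere 0 1) = 3 * emeasure lborel (cball (0::real^3) 1)"
    by (subst emeasure_sphere_measure) (auto simp: sets_restrict_space cball_def intro!: image_eqI[of _ _ UNIV])
  also have "\<dots> < \<infinity>" using emeasure_bounded_finite[of "cball (0::real^3) 1"] by (simp add: ennreal_mult_less_top)
  finally show ?thesis .
qed

interpretation sphere_measure: finite_measure sphere_measure
  by (rule finite_measureI) (use emeasure_sphere_measure_finite in auto)

definition sphere_area :: real where "sphere_area = measure sphere_measure (sphere 0 1)"

lemma sphere_area_pos: "sphere_area > 0"
proof -
  have "emeasure sphere_measure (sphere 0 1) = 3 * emeasure lborel (cball (0::real^3) 1)"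
    by (subst emeasure_sphere_measure) (auto simp: sets_restrict_space cball_def intro!: image_eqI[of _ _ UNIV])
  moreover have "emeasure lborel (cball (0::real^3) 1) > 0"
    by (subst emeasure_cball) (auto simp: unit_ball_vol_pos)
  ultimately have "emeasure sphere_measure (sphere 0 1) \<noteq> 0" by auto
  then show ?thesis unfolding sphere_area_def
    by (simp add: sphere_measure.emeasure_eq_measure zero_less_measure_iff)
qed

lemma nn_integral_square_Icc:
  assumes "b \<ge> 0"
  shows "(\<integral>\<^sup>+r. ennreal (r\<^sup>2) * indicator {0..b} r \<partial>lborel) = ennreal (b ^ 3 / 3)"
  by (subst nn_integral_FTC_Icc[where F = "\<lambda>r. r ^ 3 / 3"])
     (use assms in \<open>auto intro!: derivative_eq_intros simp: power2_eq_square\<close>)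

lemma sets_radial_measure [measurable_cong, simp]: "sets radial_measure = sets borel"
  by (simp add: radial_measure_def)

lemma space_radial_measure [simp]: "space radial_measure = UNIV"
  by (simp add: radial_measure_def)

lemma sigma_finite_radial_measure: "sigma_finite_measure radial_measure"
  unfolding radial_measure_def
  by (subst sigma_finite_measure.sigma_finite_iff_density_finite[OF lborel.sigma_finite_measure_axioms]) auto

lemma emeasure_radial_atMost: "emeasure radial_measure {..b} = (if b \<ge> 0 then ennreal (b ^ 3 / 3) else 0)"
proof -
  have "emeasure radial_measure {..b} = (\<integral>\<^sup>+r. ennreal (r\<^sup>2 * indicator {0..} r) * indicator {..b} r \<partial>lborel)"
    unfolding radial_measure_def by (subst emeasure_density) auto
  also have "\<dots> = (\<integral>\<^sup>+r. ennreal (r\<^sup>2) * indicator {0..b} r \<partial>lborel)"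
    by (intro nn_integral_cong) (auto simp: indicator_def)
  also have "\<dots> = (if b \<ge> 0 then ennreal (b ^ 3 / 3) else 0)"
    using nn_integral_square_Icc[of b] by auto
  finally show ?thesis .
qed

text \<open>Scaling by \<open>b\<close> multiplies volumes by \<open>b ^ 3\<close> and preserves
  directions, and the unit cone over \<open>B\<close> has a third of the sphere measure of
  \<open>B\<close>.\<close>

lemma emeasure_cone:
  assumes B[measurable]: "B \<in> sets unit_sphere_borel"
  shows "emeasure lborel {x. norm x \<le> b \<and> direction x \<in> B} =
    emeasure radial_measure {..b} * emeasure sphere_measure B"
proof -
  consider "b < 0" | "b = 0" | "b > 0" by linarith
  then show ?thesis
  proof cases
    case 1
    then have "\<not> norm x \<le> b" for x :: "real^3" using norm_ge_zero[of x] by linarith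
    then show ?thesis using 1 by (simp add: emeasure_radial_atMost)
  next
    case 2
    then have "emeasure lborel {x::real^3. norm x \<le> b \<and> direction x \<in> B} \<le> emeasure lborel {0::real^3}"
      by (intro emeasure_mono) auto
    then show ?thesis using 2 by (simp add: emeasure_radial_atMost)
  next
    case 3
    let ?S = "\<lambda>b. {x::real^3. norm x \<le> b \<and> direction x \<in> B}"
    have [measurable]: "?S b \<in> sets borel" for b by measurable
    have "emeasure lborel (?S b) = (\<integral>\<^sup>+x. indicator (?S b) x \<partial>lborel)" by simp
    also have "\<dots> = ennreal (b ^ 3) * (\<integral>\<^sup>+x. indicator (?S b) (b *\<^sub>R x) \<partial>lborel)"
      using 3 by (subst lborel_affine_nn_integral[of _ b 0]) auto
    also have "(\<lambda>x. indicator (?S b) (b *\<^sub>R x) :: ennreal) = indicator (?S 1)"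
      using 3 by (intro ext) (auto simp: indicator_def direction_scaleR)
    finally have *: "emeasure lborel (?S b) = ennreal (b ^ 3) * emeasure lborel (?S 1)" by simp
    have "ennreal (b ^ 3 / 3) * 3 = ennreal (b ^ 3 / 3) * ennreal 3" by simp
    also have "\<dots> = ennreal (b ^ 3)" using 3 by (subst ennreal_mult[symmetric]) auto
    finally have "ennreal (b ^ 3 / 3) * 3 = ennreal (b ^ 3)" .
    then show ?thesis using 3 unfolding * emeasure_radial_atMost emeasure_sphere_measure[OF B]
      by (simp add: mult.assoc[symmetric])
  qed
qed

text \<open>For a fixed set of directions both sides are measures in the radius, and they agree on
  the half-lines \<open>{..b}\<close> by \<open>emeasure_cone\<close>. These generate the Borel
  sets, and rectangles determine a product measure.\<close>

theorem polar_measure: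
  "radial_measure \<Otimes>\<^sub>M sphere_measure =
    distr lborel (borel \<Otimes>\<^sub>M unit_sphere_borel) (\<lambda>x. (norm x, direction x))" (is "_ = ?D")
proof (rule pair_measure_eqI)
  show "sigma_finite_measure sphere_measure" ..
  show "sets (radial_measure \<Otimes>\<^sub>M sphere_measure) = sets ?D"
    by (simp add: sets_sphere_measure cong: sets_pair_measure_cong)
  fix A :: "real set" and B :: "(real^3) set" assume A: "A \<in> sets radial_measure" and "B \<in> sets sphere_measure"
  then have B[measurable]: "B \<in> sets unit_sphere_borel" and [measurable]: "A \<in> sets borel"
    by (simp_all add: sets_sphere_measure)
  let ?N = "distr (density lborel (indicator {x. direction x \<in> B})) borel norm :: real measure"
  let ?M = "scale_measure (emeasure sphere_measure B) radial_measure"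
  have N: "emeasure ?N A' = emeasure lborel {x. norm x \<in> A' \<and> direction x \<in> B}"
    if [measurable]: "A' \<in> sets borel" for A'
  proof -
    have [measurable]: "(norm :: real^3 \<Rightarrow> real) -` A' \<in> sets borel"
      using measurable_sets_borel[OF borel_measurable_norm that] by simp
    have [measurable]: "{x. direction x \<in> B} \<in> sets borel" by measurable
    have "emeasure ?N A' = (\<integral>\<^sup>+x. indicator {x. direction x \<in> B} x * indicator (norm -` A') x \<partial>lborel)"
      by (simp add: emeasure_distr emeasure_density)
    also have "\<dots> = (\<integral>\<^sup>+x. indicator {x. norm x \<in> A' \<and> direction x \<in> B} x \<partial>lborel)"
      by (intro nn_integral_cong) (auto simp: indicator_def)
    finally show ?thesis by simp
  qed
  have "?N = ?M"
  proof (rule measure_eqI_generator_eq[where E = "range atMost" and A = "\<lambda>i. {..real i}" and \<Omega> = UNIV])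
    show "Int_stable (range atMost :: real set set)" by (auto simp: Int_stable_def intro: rangeI)
    show "sets ?N = sigma_sets UNIV (range atMost)" by (simp add: borel_eq_atMost)
    show "sets ?M = sigma_sets UNIV (range atMost)" by (simp add: borel_eq_atMost)
    show "emeasure ?N X = emeasure ?M X" if "X \<in> range atMost" for X
      using that emeasure_cone[OF B] by (auto simp: N mult.commute)
    show "emeasure ?N {..real i} \<noteq> \<infinity>" for i
      using emeasure_cone[OF B, of "real i"]
      by (simp add: N emeasure_radial_atMost ennreal_mult_eq_top_iff sphere_measure.emeasure_finite)
    show "(\<Union>i. {..real i}) = UNIV" by (auto intro: real_arch_simple)
  qed auto
  then have "emeasure ?N A = emeasure ?M A" by simp
  moreover have "emeasure ?D (A \<times> B) = emeasure lborel {x. norm x \<in> A \<and> direction x \<in> B}"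
    by (subst emeasure_distr) (auto intro!: arg_cong[where f = "emeasure lborel"])
  ultimately show "emeasure radial_measure A * emeasure sphere_measure B = emeasure ?D (A \<times> B)"
    by (simp add: N mult.commute)
qed (rule sigma_finite_radial_measure)

lemma measurable_polar [measurable]: "(\<lambda>z. fst z *\<^sub>R snd z) \<in> borel \<Otimes>\<^sub>M unit_sphere_borel \<rightarrow>\<^sub>M borel"
proof -
  have "(\<lambda>x. x) \<in> unit_sphere_borel \<rightarrow>\<^sub>M borel"
    by (rule measurable_restrict_space1) simp
  from measurable_compose[OF measurable_snd this] show ?thesis
    by (intro borel_measurable_scaleR measurable_fst) auto
qed

lemma measurable_polar' [measurable]: "(\<lambda>z. fst z *\<^sub>R snd z) \<in> radial_measure \<Otimes>\<^sub>M sphere_measure \<rightarrow>\<^sub>M borel"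
  using measurable_polar
  by (simp add: measurable_cong_sets[OF sets_pair_measure_cong[OF sets_radial_measure sets_sphere_measure] refl])

lemma polar_nn_integral:
  assumes [measurable]: "F \<in> borel_measurable borel"
  shows "(\<integral>\<^sup>+x. F x \<partial>lborel) = (\<integral>\<^sup>+z. F (fst z *\<^sub>R snd z) \<partial>(radial_measure \<Otimes>\<^sub>M sphere_measure))"
  unfolding polar_measure by (subst nn_integral_distr) (auto simp: direction_decompose)

interpretation polar: pair_sigma_finite radial_measure sphere_measure
  by (intro pair_sigma_finite.intro sigma_finite_radial_measure sphere_measure.sigma_finite_measure_axioms)

lemma nn_integral_radial:
  assumes [measurable]: "f \<in> borel_measurable borel"
  shows "(\<integral>\<^sup>+r. f r \<partial>radial_measure) = (\<integral>\<^sup>+r. ennreal (r\<^sup>2 * indicator {0..} r) * f r \<partial>lborel)"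
  unfolding radial_measure_def by (subst nn_integral_density) auto

lemma nn_integral_radial_function:
  assumes [measurable]: "f \<in> borel_measurable borel"
  shows "(\<integral>\<^sup>+x. f (norm (x::real^3)) \<partial>lborel) = ennreal sphere_area * (\<integral>\<^sup>+r. f r \<partial>radial_measure)"
proof -
  have "(\<integral>\<^sup>+x. f (norm (x::real^3)) \<partial>lborel) = (\<integral>\<^sup>+r. \<integral>\<^sup>+w. f (norm (r *\<^sub>R w)) \<partial>sphere_measure \<partial>radial_measure)"
  proof -
    have "(\<lambda>z. f (norm (fst z *\<^sub>R snd z))) \<in> borel_measurable (radial_measure \<Otimes>\<^sub>M sphere_measure)"
      by (rule measurable_compose[OF measurable_polar']) measurable
    from sphere_measure.nn_integral_fst[OF this] show ?thesis
      by (subst polar_nn_integral) simp_all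
  qed
  \<comment> \<open>The norm of \<open>r *\<^sub>R w\<close> is \<open>\<bar>r\<bar>\<close>; the
    absolute value disappears afterwards because \<open>radial_measure\<close> lives on nonnegative
    radii.\<close>
  also have "\<dots> = (\<integral>\<^sup>+r. f \<bar>r\<bar> * ennreal sphere_area \<partial>radial_measure)"
  proof (rule nn_integral_cong)
    fix r
    have "(\<integral>\<^sup>+w. f (norm (r *\<^sub>R w)) \<partial>sphere_measure) = (\<integral>\<^sup>+w. f \<bar>r\<bar> \<partial>sphere_measure)"
      by (intro nn_integral_cong) auto
    also have "\<dots> = f \<bar>r\<bar> * ennreal sphere_area"
      by (simp add: sphere_area_def sphere_measure.emeasure_eq_measure)
    finally show "(\<integral>\<^sup>+w. f (norm (r *\<^sub>R w)) \<partial>sphere_measure) = f \<bar>r\<bar> * ennreal sphere_area" .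
  qed
  also have "\<dots> = (\<integral>\<^sup>+r. f \<bar>r\<bar> \<partial>radial_measure) * ennreal sphere_area"
    by (rule nn_integral_multc) measurable
  also have "(\<integral>\<^sup>+r. f \<bar>r\<bar> \<partial>radial_measure) = (\<integral>\<^sup>+r. f r \<partial>radial_measure)"
    by (auto simp: nn_integral_radial indicator_def intro!: nn_integral_cong)
  finally show ?thesis by (simp add: mult.commute)
qed

section \<open>A Sobolev bound\<close>

text \<open>The Jacobian \<open>r\<^sup>2\<close> cancels the singularity, so the integral grows
  only linearly in \<open>R\<close>. This is why the cutoff radius in the Sobolev bound is
  proportional to the square of the level.\<close>

lemma nn_integral_inverse_square_ball:
  assumes "R \<ge> 0"
  shows "(\<integral>\<^sup>+p. ennreal (indicator (cball 0 R) p * (inverse (norm (p::real^3)))\<^sup>2) \<partial>lborel) = ennreal (sphere_area * R)"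
proof -
  have "(\<integral>\<^sup>+p. ennreal (indicator (cball 0 R) p * (inverse (norm (p::real^3)))\<^sup>2) \<partial>lborel) =
     (\<integral>\<^sup>+p. ennreal (indicator {..R} (norm (p::real^3)) * (inverse (norm p))\<^sup>2) \<partial>lborel)"
    by (intro nn_integral_cong) (auto simp: indicator_def)
  also have "\<dots> = ennreal sphere_area * (\<integral>\<^sup>+r. ennreal (indicator {..R} r * (inverse r)\<^sup>2) \<partial>radial_measure)"
    by (rule nn_integral_radial_function) measurable
  also have "(\<integral>\<^sup>+r. ennreal (indicator {..R} r * (inverse r)\<^sup>2) \<partial>radial_measure) = (\<integral>\<^sup>+r. indicator {0..R} r \<partial>lborel)"
  proof (subst nn_integral_radial, measurable, rule nn_integral_cong_AE)
    have "AE r in lborel. r \<noteq> (0::real)" by (rule AE_lborel_singleton)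
    then show "AE r in lborel. ennreal (r\<^sup>2 * indicator {0..} r) * ennreal (indicator {..R} r * (inverse r)\<^sup>2) = indicator {0..R} r"
    proof eventually_elim
      case (elim r)
      have "r\<^sup>2 * (inverse r)\<^sup>2 = 1" using elim by (simp add: power_mult_distrib[symmetric])
      then show ?case
        by (auto simp: indicator_def ennreal_mult[symmetric])
    qed
  qed
  also have "\<dots> = ennreal R" using assms by simp
  finally show ?thesis using assms sphere_area_pos by (simp add: ennreal_mult)
qed

text \<open>The sup norm of the inverse transform is at most a multiple of the L1 norm, which
  Cauchy--Schwarz bounds after writing \<open>\<bar>g\<bar>\<close> as
  \<open>inverse (norm p)\<close> times \<open>norm p * \<bar>g\<bar>\<close>.\<close>

lemma low_frequency_bound:
  assumes [measurable]: "g \<in> borel_measurable borel" and R: "R \<ge> 0"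
    and iD: "integrable lborel (\<lambda>p. (norm p)\<^sup>2 * (cmod (g p))\<^sup>2)"
    and D: "(LINT p|lborel. (norm p)\<^sup>2 * (cmod (g p))\<^sup>2) \<le> D"
    and ig: "integrable lborel (\<lambda>p. indicator (cball 0 R) p * g p)"
  shows "(cmod (inv_fourier (\<lambda>p. indicator (cball 0 R) p * g p) x))\<^sup>2 \<le> ((2 * pi) powr (- 3 / 2))\<^sup>2 * (sphere_area * R * D)"
proof -
  have D0: "D \<ge> 0" using D by (rule order_trans[rotated]) auto
  let ?I = "LINT p|lborel. cmod (indicator (cball 0 R) p * g p)"
  have "ennreal ?I = (\<integral>\<^sup>+p. ennreal (cmod (indicator (cball 0 R) p * g p)) \<partial>lborel)"
    using ig by (subst nn_integral_eq_integral) auto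
  also have "\<dots> = (\<integral>\<^sup>+p. ennreal (indicator (cball 0 R) p * inverse (norm p)) * ennreal (norm p * cmod (g p)) \<partial>lborel)"
  proof (rule nn_integral_cong_AE)
    have "AE p in lborel. p \<noteq> (0::real^3)" by (rule AE_lborel_singleton)
    then show "AE p in lborel. ennreal (cmod (indicator (cball 0 R) p * g p)) =
       ennreal (indicator (cball 0 R) p * inverse (norm p)) * ennreal (norm p * cmod (g p))"
      by eventually_elim (auto simp: indicator_def ennreal_mult[symmetric])
  qed
  finally have I_eq: "ennreal ?I = (\<integral>\<^sup>+p. ennreal (indicator (cball 0 R) p * inverse (norm p)) * ennreal (norm p * cmod (g p)) \<partial>lborel)" .
  have "(ennreal ?I)\<^sup>2 \<le> (\<integral>\<^sup>+p. (ennreal (indicator (cball 0 R) p * inverse (norm (p::real^3))))\<^sup>2 \<partial>lborel) *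
     (\<integral>\<^sup>+p. (ennreal (norm p * cmod (g p)))\<^sup>2 \<partial>lborel)"
    unfolding I_eq
  proof (rule Cauchy_Schwarz_nn_integral)
    have [measurable]: "cball (0::real^3) R \<in> sets borel" by simp
    have "(\<lambda>p::real^3. ennreal (indicator (cball 0 R) p * inverse (norm p))) \<in> borel_measurable borel" by measurable
    then show "(\<lambda>p::real^3. ennreal (indicator (cball 0 R) p * inverse (norm p))) \<in> borel_measurable lborel" by simp
    have "(\<lambda>p. ennreal (norm p * cmod (g p))) \<in> borel_measurable borel" by measurable
    then show "(\<lambda>p. ennreal (norm p * cmod (g p))) \<in> borel_measurable lborel" by simp
  qed
  also have "(\<integral>\<^sup>+p. (ennreal (indicator (cball 0 R) p * inverse (norm (p::real^3))))\<^sup>2 \<partial>lborel) = ennreal (sphere_area * R)"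
    unfolding nn_integral_inverse_square_ball[OF R, symmetric]
    by (intro nn_integral_cong) (auto simp: ennreal_power indicator_def power_mult_distrib)
  also have "(\<integral>\<^sup>+p. (ennreal (norm p * cmod (g p)))\<^sup>2 \<partial>lborel) = (\<integral>\<^sup>+p. ennreal ((norm p)\<^sup>2 * (cmod (g p))\<^sup>2) \<partial>lborel)"
    by (intro nn_integral_cong) (simp add: ennreal_power power_mult_distrib)
  also have "\<dots> = ennreal (LINT p|lborel. (norm p)\<^sup>2 * (cmod (g p))\<^sup>2)"
    by (rule nn_integral_eq_integral[OF iD]) auto
  also have "ennreal (sphere_area * R) * \<dots> \<le> ennreal (sphere_area * R) * ennreal D"
    by (intro mult_left_mono ennreal_leI D) auto
  also have "\<dots> = ennreal (sphere_area * R * D)" using D0 by (subst ennreal_mult''[symmetric]) auto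
  finally have "ennreal (?I\<^sup>2) \<le> ennreal (sphere_area * R * D)" by (simp add: ennreal_power)
  then have I: "?I\<^sup>2 \<le> sphere_area * R * D"
    using R D0 sphere_area_pos by (subst (asm) ennreal_le_iff) auto
  have "(cmod (inv_fourier (\<lambda>p. indicator (cball 0 R) p * g p) x))\<^sup>2 \<le> ((2 * pi) powr (- 3 / 2) * ?I)\<^sup>2"
    unfolding inv_fourier_def by (intro power_mono fourier_bound ig) auto
  also have "\<dots> \<le> ((2 * pi) powr (- 3 / 2))\<^sup>2 * (sphere_area * R * D)"
    unfolding power_mult_distrib by (intro mult_left_mono I) auto
  finally show ?thesis .
qed

section \<open>The Sobolev bound by integration over levels\<close>

lemma nn_integral_power_Icc:
  assumes "b \<ge> 0"
  shows "(\<integral>\<^sup>+t. ennreal (real (Suc n) * t ^ n) * indicator {0..b} t \<partial>lborel) = ennreal (b ^ Suc n)"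
  by (subst nn_integral_FTC_Icc[where F = "\<lambda>t. t ^ Suc n"])
     (use assms in \<open>auto intro!: derivative_eq_intros simp del: power_Suc\<close>)

text \<open>The bound \<open>H\<^sup>1 \<subseteq> L\<^sup>6\<close>, by cutting the frequencies of \<open>f\<close> at a level-dependent radius:
  the part of frequencies below \<open>a t\<^sup>2\<close> is at most \<open>t / 2\<close> in absolute value, so that
  the set where \<open>\<bar>f\<bar> \<ge> t\<close> is controlled by the \<open>L\<^sup>2\<close> norm of the remaining part.\<close>

lemma superlevel_bound:
  assumes [measurable]: "f \<in> borel_measurable borel" "g \<in> borel_measurable borel" and F: "is_fourier_L2 f g"
    and iD: "integrable lborel (\<lambda>p. (norm p)\<^sup>2 * (cmod (g p))\<^sup>2)"
    and D: "(LINT p|lborel. (norm p)\<^sup>2 * (cmod (g p))\<^sup>2) \<le> D" "D > 0" and t: "t > 0"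
    and a: "a = 1 / (4 * ((2 * pi) powr (- 3 / 2))\<^sup>2 * sphere_area * D)"
  shows "emeasure lborel {x. t \<le> cmod (f x)} \<le>
    (\<integral>\<^sup>+p. ennreal (4 / t\<^sup>2 * (indicator {p. a * t\<^sup>2 < norm p} p * (cmod (g p))\<^sup>2)) \<partial>lborel)"
proof -
  let ?c = "(2 * pi) powr (- 3 / 2)"
  have g2: "g \<in> L2 lborel" using F by (simp add: is_fourier_L2_borel)
  have a0: "a > 0" using D(2) sphere_area_pos by (simp add: a)
  define R where "R = a * t\<^sup>2"
  have R: "R \<ge> 0" using a0 by (simp add: R_def)
  define gl where "gl p = indicator (cball 0 R) p * g p" for p
  have gl: "integrable lborel gl" "gl \<in> L2 lborel"
    unfolding gl_def using L2_bounded_support_integrable[OF g2] L2_indicator[OF g2] by auto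
  then have [measurable]: "gl \<in> borel_measurable borel" by auto
  define low where "low = inv_fourier gl"
  have [measurable]: "low \<in> borel_measurable borel" unfolding low_def by measurable
  have low: "cmod (low x) \<le> t / 2" for x
  proof -
    have "(cmod (low x))\<^sup>2 \<le> ?c\<^sup>2 * (sphere_area * R * D)"
      unfolding low_def gl_def
      by (rule low_frequency_bound[OF _ R iD D(1)]) (use gl(1) in \<open>simp_all add: gl_def[abs_def]\<close>)
    \<comment> \<open>This equality is what determines the constant \<open>a\<close>.\<close>
    also have "\<dots> = (t / 2)\<^sup>2"
    proof -
      have c: "?c\<^sup>2 > 0" by (rule zero_less_power) (subst powr_gt_zero, simp)
      have *: "k * (S * (1 / (4 * k * S * D) * t\<^sup>2) * D) = (t / 2)\<^sup>2" if "k > 0" "S > 0" for k S :: real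
        using that D(2) by (simp add: field_simps power2_eq_square)
      show ?thesis unfolding R_def a by (rule *[OF c sphere_area_pos])
    qed
    finally show ?thesis by (rule power2_le_imp_le) (use t in simp)
  qed
  have diff: "is_fourier_L2 (\<lambda>x. f x - low x) (\<lambda>p. g p - gl p)"
    by (rule is_fourier_L2_diff[OF _ _ _ _ F])
       (use is_fourier_L2_inv_fourier[OF gl] in \<open>simp_all add: low_def\<close>)
  then have l2: "(\<lambda>x. f x - low x) \<in> L2 lborel" "(\<lambda>p. g p - gl p) \<in> L2 lborel"
    "sqnorm lborel (\<lambda>x. f x - low x) = sqnorm lborel (\<lambda>p. g p - gl p)"
    using is_fourier_L2_sqnorm[OF _ _ diff] by (simp_all add: is_fourier_L2_borel)
  have "{x. t \<le> cmod (f x)} \<subseteq> {x \<in> UNIV. 1 \<le> ennreal (4 / t\<^sup>2) * ennreal ((cmod (f x - low x))\<^sup>2)}"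
  proof safe
    fix x assume "t \<le> cmod (f x)"
    then have "t / 2 \<le> cmod (f x - low x)"
      using low[of x] norm_triangle_ineq2[of "f x" "low x"] by linarith
    then have "(t / 2)\<^sup>2 \<le> (cmod (f x - low x))\<^sup>2" using t by (intro power_mono) auto
    then have "1 \<le> 4 / t\<^sup>2 * (cmod (f x - low x))\<^sup>2" using t by (simp add: field_simps)
    then show "1 \<le> ennreal (4 / t\<^sup>2) * ennreal ((cmod (f x - low x))\<^sup>2)"
      by (subst ennreal_mult[symmetric]) auto
  qed simp
  then have "emeasure lborel {x. t \<le> cmod (f x)} \<le>
      emeasure lborel ({x \<in> UNIV. 1 \<le> ennreal (4 / t\<^sup>2) * ennreal ((cmod (f x - low x))\<^sup>2)})"
    by (rule emeasure_mono) measurable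
  also have "\<dots> \<le> ennreal (4 / t\<^sup>2) * (\<integral>\<^sup>+x. ennreal ((cmod (f x - low x))\<^sup>2) * indicator UNIV x \<partial>lborel)"
    using nn_integral_Markov_inequality[of "\<lambda>x. ennreal ((cmod (f x - low x))\<^sup>2)" UNIV lborel "ennreal (4 / t\<^sup>2)"]
    by simp
  also have "(\<integral>\<^sup>+x. ennreal ((cmod (f x - low x))\<^sup>2) * indicator UNIV x \<partial>lborel) =
      (\<integral>\<^sup>+p. ennreal ((cmod (g p - gl p))\<^sup>2) \<partial>lborel)"
    using nn_integral_sqnorm[OF l2(1)] nn_integral_sqnorm[OF l2(2)] l2(3) by simp
  also have "ennreal (4 / t\<^sup>2) * \<dots> = (\<integral>\<^sup>+p. ennreal (4 / t\<^sup>2) * ennreal ((cmod (g p - gl p))\<^sup>2) \<partial>lborel)"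
    by (rule nn_integral_cmult[symmetric]) measurable
  also have "\<dots> = (\<integral>\<^sup>+p. ennreal (4 / t\<^sup>2 * (indicator {p. a * t\<^sup>2 < norm p} p * (cmod (g p))\<^sup>2)) \<partial>lborel)"
    by (intro nn_integral_cong) (auto simp: gl_def R_def indicator_def ennreal_mult[symmetric])
  finally show ?thesis .
qed

text \<open>Write \<open>\<bar>f\<bar> ^ 6\<close> as the integral of \<open>6 * t ^ 5\<close> over
  levels. By \<open>superlevel_bound\<close> this becomes an integral of
  \<open>24 * t ^ 3 * \<bar>g\<bar>\<^sup>2\<close> over \<open>a * t\<^sup>2 < norm p\<close>, and
  integrating over \<open>t\<close> first leaves at most \<open>6 / a\<^sup>2\<close> times
  \<open>(norm p)\<^sup>2 * \<bar>g\<bar>\<^sup>2\<close>. \<open>D\<close> is only an upper bound,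
  so that it can be taken positive, as \<open>a\<close> requires.\<close>

lemma sobolev_L6:
  assumes [measurable]: "f \<in> borel_measurable borel" "g \<in> borel_measurable borel" and F: "is_fourier_L2 f g"
    and iD: "integrable lborel (\<lambda>p. (norm p)\<^sup>2 * (cmod (g p))\<^sup>2)"
    and D: "(LINT p|lborel. (norm p)\<^sup>2 * (cmod (g p))\<^sup>2) \<le> D" "D > 0"
  shows "(\<integral>\<^sup>+x. ennreal ((cmod (f x)) ^ 6) \<partial>lborel) \<le> ennreal (96 * ((2 * pi) powr (- 3 / 2)) ^ 4 * sphere_area\<^sup>2 * D ^ 3)"
proof -
  let ?c = "(2 * pi) powr (- 3 / 2)"
  define a where "a = 1 / (4 * ?c\<^sup>2 * sphere_area * D)"
  have a0: "a > 0" using D(2) sphere_area_pos by (simp add: a_def)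
  have "(\<integral>\<^sup>+x. ennreal ((cmod (f x)) ^ 6) \<partial>lborel) =
     (\<integral>\<^sup>+x. \<integral>\<^sup>+t. ennreal (6 * t ^ 5) * indicator {0..cmod (f x)} t \<partial>lborel \<partial>lborel)"
    using nn_integral_power_Icc[of _ 5] by (simp add: numeral_eq_Suc)
  also have "\<dots> = (\<integral>\<^sup>+x. \<integral>\<^sup>+t. ennreal (6 * t ^ 5) * indicator {(t, x). 0 \<le> t \<and> t \<le> cmod (f x)} (t, x) \<partial>lborel \<partial>lborel)"
    by (intro nn_integral_cong) (auto simp: indicator_def)
  also have "\<dots> = (\<integral>\<^sup>+t. \<integral>\<^sup>+x. ennreal (6 * t ^ 5) * indicator {(t, x). 0 \<le> t \<and> t \<le> cmod (f x)} (t, x) \<partial>lborel \<partial>lborel)"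
    by (rule lborel_pair.Fubini') measurable
  also have "\<dots> \<le> (\<integral>\<^sup>+t. \<integral>\<^sup>+p. ennreal (24 * t ^ 3 * (cmod (g p))\<^sup>2) * indicator {(t, p). 0 \<le> t \<and> a * t\<^sup>2 < norm p} (t, p) \<partial>lborel \<partial>lborel)"
  proof (rule nn_integral_mono)
    fix t :: real
    show "(\<integral>\<^sup>+x. ennreal (6 * t ^ 5) * indicator {(t, x). 0 \<le> t \<and> t \<le> cmod (f x)} (t, x) \<partial>lborel) \<le>
      (\<integral>\<^sup>+p. ennreal (24 * t ^ 3 * (cmod (g p))\<^sup>2) * indicator {(t, p). 0 \<le> t \<and> a * t\<^sup>2 < norm p} (t, p) \<partial>lborel)"
    proof (cases "t > 0")
      case True
      have "(\<integral>\<^sup>+x. ennreal (6 * t ^ 5) * indicator {(t, x). 0 \<le> t \<and> t \<le> cmod (f x)} (t, x) \<partial>lborel) =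
         (\<integral>\<^sup>+x. ennreal (6 * t ^ 5) * indicator {x. t \<le> cmod (f x)} x \<partial>lborel)"
        using True by (intro nn_integral_cong) (auto simp: indicator_def)
      also have "\<dots> = ennreal (6 * t ^ 5) * emeasure lborel {x. t \<le> cmod (f x)}"
        by (rule nn_integral_cmult_indicator) measurable
      also have "\<dots> \<le> ennreal (6 * t ^ 5) * (\<integral>\<^sup>+p. ennreal (4 / t\<^sup>2 * (indicator {p. a * t\<^sup>2 < norm p} p * (cmod (g p))\<^sup>2)) \<partial>lborel)"
        by (intro mult_left_mono superlevel_bound[OF _ _ F iD D True a_def]) auto
      also have "\<dots> = (\<integral>\<^sup>+p. ennreal (6 * t ^ 5) * ennreal (4 / t\<^sup>2 * (indicator {p. a * t\<^sup>2 < norm p} p * (cmod (g p))\<^sup>2)) \<partial>lborel)"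
        by (rule nn_integral_cmult[symmetric]) measurable
      also have "\<dots> = (\<integral>\<^sup>+p. ennreal (24 * t ^ 3 * (cmod (g p))\<^sup>2) * indicator {(t, p). 0 \<le> t \<and> a * t\<^sup>2 < norm p} (t, p) \<partial>lborel)"
      proof (intro nn_integral_cong)
        fix p
        have "6 * t ^ 5 * (4 / t\<^sup>2 * (cmod (g p))\<^sup>2) = 24 * t ^ 3 * (cmod (g p))\<^sup>2"
          using True by (simp add: field_simps flip: power_add)
        then show "ennreal (6 * t ^ 5) * ennreal (4 / t\<^sup>2 * (indicator {p. a * t\<^sup>2 < norm p} p * (cmod (g p))\<^sup>2)) =
           ennreal (24 * t ^ 3 * (cmod (g p))\<^sup>2) * indicator {(t, p). 0 \<le> t \<and> a * t\<^sup>2 < norm p} (t, p)"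
          using True by (auto simp: indicator_def ennreal_mult[symmetric])
      qed
      finally show ?thesis .
    next
      case False
      then have "(\<integral>\<^sup>+x. ennreal (6 * t ^ 5) * indicator {(t, x). 0 \<le> t \<and> t \<le> cmod (f x)} (t, x) \<partial>lborel) = (\<integral>\<^sup>+x. 0 \<partial>(lborel :: (real^3) measure))"
        by (intro nn_integral_cong) (auto simp: indicator_def)
      then show ?thesis by simp
    qed
  qed
  also have "\<dots> = (\<integral>\<^sup>+p. \<integral>\<^sup>+t. ennreal (24 * t ^ 3 * (cmod (g p))\<^sup>2) * indicator {(t, p). 0 \<le> t \<and> a * t\<^sup>2 < norm p} (t, p) \<partial>lborel \<partial>lborel)"
    by (rule lborel_pair.Fubini'[symmetric]) measurable
  also have "\<dots> \<le> (\<integral>\<^sup>+p. ennreal (6 / a\<^sup>2) * ennreal ((norm p)\<^sup>2 * (cmod (g p))\<^sup>2) \<partial>lborel)"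
  proof (rule nn_integral_mono)
    fix p :: "real^3"
    \<comment> \<open>The frequency \<open>p\<close> lies above the cutoff exactly for the levels
      below \<open>b\<close>.\<close>
    define b where "b = sqrt (norm p / a)"
    have b: "b \<ge> 0" "b ^ 2 = norm p / a" using a0 by (auto simp: b_def)
    have "b ^ 4 = (b\<^sup>2)\<^sup>2" by simp
    then have b4: "b ^ 4 = (norm p)\<^sup>2 / a\<^sup>2" by (simp add: b(2) power_divide)
    have "(\<integral>\<^sup>+t. ennreal (24 * t ^ 3 * (cmod (g p))\<^sup>2) * indicator {(t, p). 0 \<le> t \<and> a * t\<^sup>2 < norm p} (t, p) \<partial>lborel) \<le>
      (\<integral>\<^sup>+t. ennreal (6 * (cmod (g p))\<^sup>2) * (ennreal (real (Suc 3) * t ^ 3) * indicator {0..b} t) \<partial>lborel)"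
    proof (rule nn_integral_mono)
      fix t :: real
      show "ennreal (24 * t ^ 3 * (cmod (g p))\<^sup>2) * indicator {(t, p). 0 \<le> t \<and> a * t\<^sup>2 < norm p} (t, p) \<le>
         ennreal (6 * (cmod (g p))\<^sup>2) * (ennreal (real (Suc 3) * t ^ 3) * indicator {0..b} t)"
      proof (cases "0 \<le> t \<and> a * t\<^sup>2 < norm p")
        case True
        then have "t\<^sup>2 \<le> b\<^sup>2" using a0 by (simp add: b field_simps)
        then have "t \<le> b" using b(1) by (rule power2_le_imp_le)
        then show ?thesis using True
          by (simp add: ennreal_mult[symmetric] mult_ac)
      qed (auto simp: indicator_def)
    qed
    also have "\<dots> = ennreal (6 * (cmod (g p))\<^sup>2) * ennreal (b ^ Suc 3)"
      by (subst nn_integral_cmult) (simp_all only: nn_integral_power_Icc[OF b(1)], measurable)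
    also have "\<dots> = ennreal (6 / a\<^sup>2) * ennreal ((norm p)\<^sup>2 * (cmod (g p))\<^sup>2)"
      using b4 b(1) by (simp add: ennreal_mult[symmetric] mult_ac numeral_eq_Suc)
    finally show "(\<integral>\<^sup>+t. ennreal (24 * t ^ 3 * (cmod (g p))\<^sup>2) * indicator {(t, p). 0 \<le> t \<and> a * t\<^sup>2 < norm p} (t, p) \<partial>lborel) \<le>
      ennreal (6 / a\<^sup>2) * ennreal ((norm p)\<^sup>2 * (cmod (g p))\<^sup>2)" .
  qed
  also have "\<dots> = ennreal (6 / a\<^sup>2) * ennreal (LINT p|lborel. (norm p)\<^sup>2 * (cmod (g p))\<^sup>2)"
    by (subst nn_integral_cmult) (auto simp: nn_integral_eq_integral[OF iD])
  also have "\<dots> \<le> ennreal (6 / a\<^sup>2) * ennreal D" by (intro mult_left_mono ennreal_leI D) auto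
  also have "\<dots> = ennreal (6 / a\<^sup>2 * D)" using D by (subst ennreal_mult) auto
  also have "6 / a\<^sup>2 * D = 96 * ?c ^ 4 * sphere_area\<^sup>2 * D ^ 3"
    by (simp add: a_def power_divide power_mult_distrib power2_eq_square power3_eq_cube numeral_eq_Suc)
  finally show ?thesis .
qed

text \<open>Young's inequality for the exponents 3/2 and 3, without sharp constants: compare
  \<open>b\<close> with \<open>k * sqrt a\<close> and replace one factor of the product by the
  larger of the two quantities.\<close>

lemma young_cubic:
  fixes a b k :: real
  assumes "a \<ge> 0" "b \<ge> 0" "k > 0"
  shows "a * b \<le> k * a powr (3 / 2) + b ^ 3 / k\<^sup>2"
proof (cases "b \<le> k * sqrt a")
  case True
  have "a * b \<le> a * (k * sqrt a)" using True assms by (intro mult_left_mono) auto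
  also have "\<dots> = k * (a powr 1 * a powr (1 / 2))" using assms by (simp add: powr_half_sqrt)
  also have "\<dots> = k * a powr (3 / 2)" by (simp only: powr_add[symmetric]) simp
  finally show ?thesis using assms by (simp add: add_increasing2)
next
  case False
  then have "(k * sqrt a)\<^sup>2 \<le> b\<^sup>2" using assms by (intro power_mono) auto
  then have "a \<le> b\<^sup>2 / k\<^sup>2" using assms by (simp add: power_mult_distrib field_simps)
  then have "a * b \<le> b\<^sup>2 / k\<^sup>2 * b" using assms by (intro mult_right_mono) auto
  also have "\<dots> = b ^ 3 / k\<^sup>2" by (simp add: power2_eq_square power3_eq_cube)
  finally show ?thesis using assms by (simp add: add_increasing)
qed

definition sobolev_const :: real
  where "sobolev_const = 96 * ((2 * pi) powr (- 3 / 2)) ^ 4 * sphere_area\<^sup>2"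

text \<open>Apply \<open>young_cubic\<close> to \<open>\<bar>W\<bar>\<close> and
  \<open>\<bar>f\<bar>\<^sup>2\<close> with a weight close to \<open>s * D\<close>: the sixth power
  contributes \<open>D ^ 3\<close>, so that both terms become linear in \<open>D\<close>. The
  parameter \<open>s\<close> balances the 3/2-norm of \<open>W\<close> against the Sobolev
  constant.\<close>

lemma form_bound:
  fixes W :: "real^3 \<Rightarrow> real"
  assumes [measurable]: "W \<in> borel_measurable borel" "f \<in> borel_measurable borel" "g \<in> borel_measurable borel"
    and F: "is_fourier_L2 f g"
    and iD: "integrable lborel (\<lambda>p. (norm p)\<^sup>2 * (cmod (g p))\<^sup>2)"
    and W: "integrable lborel (\<lambda>x. \<bar>W x\<bar> powr (3 / 2))" and s: "s > 0"
  defines "D \<equiv> LINT p|lborel. (norm p)\<^sup>2 * (cmod (g p))\<^sup>2"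
  shows "integrable lborel (\<lambda>x. W x * (cmod (f x))\<^sup>2)"
    and "(LINT x|lborel. \<bar>W x\<bar> * (cmod (f x))\<^sup>2) \<le> (s * (LINT x|lborel. \<bar>W x\<bar> powr (3 / 2)) + sobolev_const / s\<^sup>2) * D"
proof -
  let ?w = "LINT x|lborel. \<bar>W x\<bar> powr (3 / 2)"
  let ?K = "s * ?w + sobolev_const / s\<^sup>2"
  have D0: "D \<ge> 0" unfolding D_def by simp
  have K0: "?K \<ge> 0" using s by (auto simp: sobolev_const_def)
  \<comment> \<open>\<open>D\<close> may vanish, and then \<open>s * D\<close> is no admissible
    weight; hence \<open>E > D\<close>, which is sent to \<open>D\<close> at the end.\<close>
  have *: "(\<integral>\<^sup>+x. ennreal (\<bar>W x\<bar> * (cmod (f x))\<^sup>2) \<partial>lborel) \<le> ennreal (?K * E)" if E: "E > D" for E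
  proof -
    have E0: "E > 0" "s * E > 0" using E D0 s by auto
    have f6: "(\<integral>\<^sup>+x. ennreal ((cmod (f x)) ^ 6) \<partial>lborel) \<le> ennreal (sobolev_const * E ^ 3)"
      unfolding sobolev_const_def
      by (rule sobolev_L6[OF _ _ F iD]) (use E E0 in \<open>auto simp: D_def\<close>)
    have "(\<integral>\<^sup>+x. ennreal (\<bar>W x\<bar> * (cmod (f x))\<^sup>2) \<partial>lborel) \<le>
       (\<integral>\<^sup>+x. ennreal (s * E) * ennreal (\<bar>W x\<bar> powr (3 / 2)) + ennreal (1 / (s * E)\<^sup>2) * ennreal ((cmod (f x)) ^ 6) \<partial>lborel)"
    proof (rule nn_integral_mono)
      fix x
      have "\<bar>W x\<bar> * (cmod (f x))\<^sup>2 \<le> s * E * \<bar>W x\<bar> powr (3 / 2) + 1 / (s * E)\<^sup>2 * (cmod (f x)) ^ 6"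
        using young_cubic[OF abs_ge_zero[of "W x"] zero_le_power2[of "cmod (f x)"] E0(2)] by simp
      then show "ennreal (\<bar>W x\<bar> * (cmod (f x))\<^sup>2) \<le>
         ennreal (s * E) * ennreal (\<bar>W x\<bar> powr (3 / 2)) + ennreal (1 / (s * E)\<^sup>2) * ennreal ((cmod (f x)) ^ 6)"
        using E0 by (simp add: ennreal_mult[symmetric] ennreal_plus[symmetric] ennreal_leI del: ennreal_plus)
    qed
    also have "\<dots> = ennreal (s * E) * (\<integral>\<^sup>+x. ennreal (\<bar>W x\<bar> powr (3 / 2)) \<partial>lborel) +
       ennreal (1 / (s * E)\<^sup>2) * (\<integral>\<^sup>+x. ennreal ((cmod (f x)) ^ 6) \<partial>lborel)"
      by (subst nn_integral_add) (auto simp: nn_integral_cmult)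
    also have "\<dots> \<le> ennreal (s * E) * ennreal ?w + ennreal (1 / (s * E)\<^sup>2) * ennreal (sobolev_const * E ^ 3)"
      using nn_integral_eq_integral[OF W] by (intro add_mono mult_left_mono f6) auto
    also have "\<dots> = ennreal (s * E * ?w + 1 / (s * E)\<^sup>2 * (sobolev_const * E ^ 3))"
      using E0 by (simp add: ennreal_mult[symmetric] ennreal_plus[symmetric] sobolev_const_def del: ennreal_plus)
    also have "s * E * ?w + 1 / (s * E)\<^sup>2 * (sobolev_const * E ^ 3) = ?K * E"
      using E0 s by (simp add: field_simps power2_eq_square power3_eq_cube)
    finally show ?thesis .
  qed
  have "(\<integral>\<^sup>+x. ennreal (\<bar>W x\<bar> * (cmod (f x))\<^sup>2) \<partial>lborel) < \<infinity>"
    using *[of "D + 1"] by (auto intro: le_less_trans)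
  then show "integrable lborel (\<lambda>x. W x * (cmod (f x))\<^sup>2)"
    by (intro integrableI_bounded) (auto simp: abs_mult)
  then have i: "integrable lborel (\<lambda>x. \<bar>W x\<bar> * (cmod (f x))\<^sup>2)"
    by (rule integrable_norm[THEN Bochner_Integration.integrable_cong[THEN iffD1, rotated 2]]) (auto simp: abs_mult)
  have le: "(LINT x|lborel. \<bar>W x\<bar> * (cmod (f x))\<^sup>2) \<le> ?K * E" if E: "E > D" for E
    using *[OF E] K0 D0 E by (subst (asm) nn_integral_eq_integral[OF i]) (auto simp: ennreal_le_iff)
  have "((\<lambda>e. ?K * (D + e)) \<longlongrightarrow> ?K * (D + 0)) (at_right 0)" by (intro tendsto_intros)
  moreover have "\<forall>\<^sub>F e in at_right 0. (LINT x|lborel. \<bar>W x\<bar> * (cmod (f x))\<^sup>2) \<le> ?K * (D + e)"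
    using eventually_at_right_less[of "0::real"] by eventually_elim (rule le, simp)
  ultimately show "(LINT x|lborel. \<bar>W x\<bar> * (cmod (f x))\<^sup>2) \<le> ?K * D"
    using tendsto_lowerbound[of "\<lambda>e. ?K * (D + e)" "?K * D" "at_right 0"] by auto
qed

section \<open>Spectra of Hermitian integral operators\<close>

definition ip :: "'a measure \<Rightarrow> ('a \<Rightarrow> complex) \<Rightarrow> ('a \<Rightarrow> complex) \<Rightarrow> complex"
  where "ip M f g = (LINT x|M. cnj (f x) * g x)"

lemma ip_integrable: "f \<in> L2 M \<Longrightarrow> g \<in> L2 M \<Longrightarrow> integrable M (\<lambda>x. cnj (f x) * g x)"
  by (rule L2_prod_integrable[OF L2_cnj])

lemma ip_add_right: "f \<in> L2 M \<Longrightarrow> g \<in> L2 M \<Longrightarrow> h \<in> L2 M \<Longrightarrow> ip M f (\<lambda>x. g x + h x) = ip M f g + ip M f h"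
  using ip_integrable[of f M g] ip_integrable[of f M h] by (simp add: ip_def distrib_left)

lemma ip_scale_right: "ip M f (\<lambda>x. c * g x) = c * ip M f g"
proof -
  have "(\<lambda>x. cnj (f x) * (c * g x)) = (\<lambda>x. c * (cnj (f x) * g x))" by (simp add: mult_ac)
  then show ?thesis by (simp only: ip_def integral_mult_right_zero)
qed

lemma ip_self: "ip M f f = complex_of_real (sqnorm M f)"
proof -
  have "(\<lambda>x. cnj (f x) * f x) = (\<lambda>x. complex_of_real ((cmod (f x))\<^sup>2))"
    by (simp add: complex_norm_square mult.commute del: of_real_power)
  then show ?thesis by (simp only: ip_def sqnorm_def integral_complex_of_real)
qed

lemma ip_commute: "ip M g f = cnj (ip M f g)"
proof -
  have "(\<lambda>x. cnj (g x) * f x) = (\<lambda>x. cnj (cnj (f x) * g x))" by (simp add: mult.commute)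
  then show ?thesis by (simp only: ip_def Bochner_Integration.integral_cnj)
qed

lemma ip_cauchy_schwarz: "f \<in> L2 M \<Longrightarrow> g \<in> L2 M \<Longrightarrow> cmod (ip M f g) \<le> sqrt (sqnorm M f) * sqrt (sqnorm M g)"
  using cauchy_schwarz[OF L2_cnj, of f M g] unfolding ip_def sqnorm_cnj real_sqrt_mult[symmetric]
  by (rule real_le_rsqrt)

lemma Re_ip_le: "f \<in> L2 M \<Longrightarrow> g \<in> L2 M \<Longrightarrow> Re (ip M f g) \<le> sqrt (sqnorm M f) * sqrt (sqnorm M g)"
  using ip_cauchy_schwarz[of f M g] complex_Re_le_cmod[of "ip M f g"] by linarith

lemma sqnorm_zero_AE:
  assumes "f \<in> L2 M" "sqnorm M f = 0" shows "AE x in M. f x = 0"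
  using integral_nonneg_eq_0_iff_AE[OF L2_integrable_sq[OF assms(1)]] assms(2)
  by (auto simp: sqnorm_def)

lemma ennreal_le_suminf: "F n \<le> suminf F" for F :: "nat \<Rightarrow> ennreal"
  using sum_le_suminf[OF summableI, of "{n}" F] by simp

text \<open>This replaces the completeness of \<open>L\<^sup>2\<close>: the weighted sum \<open>\<Sum>n. \<bar>d n\<bar>\<^sup>2 / \<tau> ^ (2 * n)\<close> is
  integrable, and its square root dominates the \<open>d n\<close> by a geometric sequence.\<close>

lemma geometric_L2_domination:
  assumes d: "\<And>n. d n \<in> L2 M" and C: "\<And>n. sqnorm M (d n) \<le> C * \<tau> ^ (4 * n)" and \<tau>: "0 < \<tau>" "\<tau> < 1"
  obtains w where "w \<in> borel_measurable M" "\<And>x. 0 \<le> w x" "integrable M (\<lambda>x. (w x)\<^sup>2)"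
    "AE x in M. \<forall>n. cmod (d n x) \<le> w x * \<tau> ^ n"
proof -
  have [measurable]: "d n \<in> borel_measurable M" for n using d[of n] by (simp add: L2_iff)
  have C0: "C \<ge> 0" using order_trans[OF sqnorm_nonneg C[of 0]] by simp
  define S where "S x = (\<Sum>n. ennreal ((cmod (d n x))\<^sup>2 / \<tau> ^ (2 * n)))" for x
  have [measurable]: "S \<in> borel_measurable M" unfolding S_def by measurable
  have "(\<integral>\<^sup>+x. S x \<partial>M) = (\<Sum>n. \<integral>\<^sup>+x. ennreal ((cmod (d n x))\<^sup>2 / \<tau> ^ (2 * n)) \<partial>M)"
    unfolding S_def by (rule nn_integral_suminf) measurable
  also have "\<dots> \<le> (\<Sum>n. ennreal (C * (\<tau>\<^sup>2) ^ n))"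
  proof (rule suminf_le)
    fix n
    have "(\<integral>\<^sup>+x. ennreal ((cmod (d n x))\<^sup>2 / \<tau> ^ (2 * n)) \<partial>M) = ennreal (LINT x|M. (cmod (d n x))\<^sup>2 / \<tau> ^ (2 * n))"
      using d[of n] \<tau> by (intro nn_integral_eq_integral) (auto simp: L2_iff)
    also have "\<dots> = ennreal (sqnorm M (d n) / \<tau> ^ (2 * n))" by (simp add: sqnorm_def)
    also have "\<dots> \<le> ennreal (C * \<tau> ^ (4 * n) / \<tau> ^ (2 * n))"
      using \<tau> by (intro ennreal_leI divide_right_mono C) auto
    also have "C * \<tau> ^ (4 * n) / \<tau> ^ (2 * n) = C * (\<tau>\<^sup>2) ^ n"
    proof -
      have "\<tau> ^ (4 * n) = \<tau> ^ (2 * n) * \<tau> ^ (2 * n)" by (simp flip: power_add)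
      then show ?thesis using \<tau> by (simp add: power_mult)
    qed
    finally show "(\<integral>\<^sup>+x. ennreal ((cmod (d n x))\<^sup>2 / \<tau> ^ (2 * n)) \<partial>M) \<le> ennreal (C * (\<tau>\<^sup>2) ^ n)" .
  qed auto
  also have "\<dots> = ennreal (\<Sum>n. C * (\<tau>\<^sup>2) ^ n)"
    using \<tau> C0 by (intro suminf_ennreal2 summable_mult summable_geometric) (auto simp: power_less_one_iff abs_square_less_1)
  also have "\<dots> < \<infinity>" by simp
  finally have fin: "(\<integral>\<^sup>+x. S x \<partial>M) < \<infinity>" .
  then have ae: "AE x in M. S x \<noteq> \<infinity>" by (intro nn_integral_PInf_AE) auto
  define w where "w x = sqrt (enn2real (S x))" for x
  show ?thesis
  proof (rule that[of w])
    show [measurable]: "w \<in> borel_measurable M" unfolding w_def by measurable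
    have "(\<integral>\<^sup>+x. ennreal ((w x)\<^sup>2) \<partial>M) = (\<integral>\<^sup>+x. S x \<partial>M)"
    proof (rule nn_integral_cong_AE)
      show "AE x in M. ennreal ((w x)\<^sup>2) = S x" using ae by eventually_elim (simp add: w_def less_top)
    qed
    then show "integrable M (\<lambda>x. (w x)\<^sup>2)" using fin by (intro integrableI_bounded) auto
    show "AE x in M. \<forall>n. cmod (d n x) \<le> w x * \<tau> ^ n"
      using ae
    proof (eventually_elim, intro allI)
      fix x n assume fx: "S x \<noteq> \<infinity>"
      have "ennreal ((cmod (d n x))\<^sup>2 / \<tau> ^ (2 * n)) \<le> S x"
        unfolding S_def by (rule ennreal_le_suminf)
      also have "S x = ennreal ((w x)\<^sup>2)" using fx by (simp add: w_def less_top)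
      finally have "(cmod (d n x))\<^sup>2 / \<tau> ^ (2 * n) \<le> (w x)\<^sup>2" by simp
      then have "(cmod (d n x))\<^sup>2 \<le> (w x)\<^sup>2 * \<tau> ^ (2 * n)" using \<tau> by (simp add: divide_le_eq)
      also have "\<dots> = (w x * \<tau> ^ n)\<^sup>2" by (simp add: power_mult_distrib power_mult[symmetric] mult.commute)
      finally show "cmod (d n x) \<le> w x * \<tau> ^ n"
        by (rule power2_le_imp_le) (use \<tau> in \<open>simp add: w_def\<close>)
    qed
  qed (simp add: w_def)
qed

lemma ip_cong: "(\<And>x. x \<in> space M \<Longrightarrow> f x = f' x) \<Longrightarrow> (\<And>x. x \<in> space M \<Longrightarrow> g x = g' x) \<Longrightarrow> ip M f g = ip M f' g'"
  unfolding ip_def by (intro Bochner_Integration.integral_cong) auto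

text \<open>The operator \<open>A\<close> is a parameter tied to the kernel by an equation, so that
  the result about its spectrum applies verbatim to \<open>sphere_op\<close>. The positive total
  mass provides unit vectors.\<close>

locale hermitian_kernel = finite_measure M for M :: "'a measure" +
  fixes k :: "'a \<Rightarrow> 'a \<Rightarrow> complex" and B :: real and A :: "('a \<Rightarrow> complex) \<Rightarrow> 'a \<Rightarrow> complex"
  assumes k_measurable [measurable]: "case_prod k \<in> borel_measurable (M \<Otimes>\<^sub>M M)"
    and k_bound: "\<And>x y. cmod (k x y) \<le> B"
    and k_hermitian: "\<And>x y. k y x = cnj (k x y)"
    and A_eq: "\<And>f x. A f x = (LINT y|M. k x y * f y)"
    and space_pos: "measure M (space M) > 0"
begin

lemma B_nonneg: "B \<ge> 0"
  using k_bound norm_ge_zero order_trans by blast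

lemma k_section: "x \<in> space M \<Longrightarrow> k x \<in> borel_measurable M"
  using measurable_compose[OF measurable_Pair1' k_measurable, of x] by simp

lemma one_L2: "(\<lambda>x. 1) \<in> L2 M" "sqnorm M (\<lambda>x. 1) = measure M (space M)"
  by (auto simp: L2_iff sqnorm_def)

lemma L2_integrable: "f \<in> L2 M \<Longrightarrow> integrable M f"
  using L2_prod_integrable[OF _ one_L2(1), of f] by simp

lemma L1_le_L2: "f \<in> L2 M \<Longrightarrow> (LINT x|M. cmod (f x))\<^sup>2 \<le> measure M (space M) * sqnorm M f"
  using cauchy_schwarz_cmod[OF _ one_L2(1), of f] by (simp add: one_L2(2) mult.commute)

lemma A_integrable: "integrable M f \<Longrightarrow> x \<in> space M \<Longrightarrow> integrable M (\<lambda>y. k x y * f y)"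
  by (rule Bochner_Integration.integrable_bound[of M "\<lambda>y. B * cmod (f y)"])
     (use k_section B_nonneg in \<open>auto simp: norm_mult intro!: AE_I2 mult_right_mono k_bound\<close>)

lemma A_pointwise:
  assumes "integrable M f" "x \<in> space M"
  shows "cmod (A f x) \<le> B * (LINT y|M. cmod (f y))"
proof -
  have "cmod (A f x) \<le> (LINT y|M. cmod (k x y * f y))" unfolding A_eq by (rule integral_norm_bound)
  also have "\<dots> \<le> (LINT y|M. B * cmod (f y))"
    using assms A_integrable[OF assms] by (intro integral_mono integrable_norm) (auto simp: norm_mult intro: mult_right_mono k_bound)
  finally show ?thesis by simp
qed

lemma A_measurable:
  assumes [measurable]: "f \<in> borel_measurable M"
  shows "A f \<in> borel_measurable M"
  unfolding A_eq[abs_def] by measurable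

text \<open>A bound for the operator norm of \<open>A\<close>, see \<open>A_L2\<close>.\<close>

definition K where "K = B * measure M (space M)"

lemma K_nonneg: "K \<ge> 0" by (simp add: K_def B_nonneg)

lemma A_L2:
  assumes f: "f \<in> L2 M" shows "A f \<in> L2 M" "sqnorm M (A f) \<le> K\<^sup>2 * sqnorm M f"
proof -
  let ?m = "measure M (space M)"
  have b: "cmod (A f x) \<le> B * (LINT y|M. cmod (f y))" if "x \<in> space M" for x
    by (rule A_pointwise[OF L2_integrable[OF f] that])
  show 1: "A f \<in> L2 M"
    by (rule L2_bound[OF one_L2(1) A_measurable, where C = "B * (LINT y|M. cmod (f y))"])
       (use f b in \<open>auto simp: L2_iff\<close>)
  have "sqnorm M (A f) \<le> (LINT x|M. (B * (LINT y|M. cmod (f y)))\<^sup>2)"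
    unfolding sqnorm_def using 1 b by (intro integral_mono) (auto simp: L2_iff intro!: power_mono)
  also have "\<dots> = B\<^sup>2 * ?m * (LINT y|M. cmod (f y))\<^sup>2" by (simp add: power_mult_distrib)
  also have "\<dots> \<le> B\<^sup>2 * ?m * (?m * sqnorm M f)" by (intro mult_left_mono L1_le_L2 f) auto
  finally show "sqnorm M (A f) \<le> K\<^sup>2 * sqnorm M f" by (simp add: K_def power2_eq_square mult_ac)
qed

lemma A_add:
  assumes "integrable M f" "integrable M g" "x \<in> space M"
  shows "A (\<lambda>x. f x + g x) x = A f x + A g x"
  using A_integrable[OF assms(1,3)] A_integrable[OF assms(2,3)] by (simp add: A_eq distrib_left)

lemma A_scale: "A (\<lambda>x. c * f x) x = c * A f x"
  unfolding A_eq mult.left_commute[of _ c] by (rule integral_mult_right_zero)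

text \<open>Fubini, with the bound on the kernel supplying absolute convergence, followed by
  \<open>k_hermitian\<close>.\<close>

lemma A_symmetric:
  assumes f: "f \<in> L2 M" and g: "g \<in> L2 M"
  shows "ip M f (A g) = cnj (ip M g (A f))"
proof -
  note sf = sigma_finite_measure_axioms
  interpret pair_sigma_finite M M ..
  have [measurable]: "f \<in> borel_measurable M" "g \<in> borel_measurable M" using f g by (auto simp: L2_iff)
  have "integrable (M \<Otimes>\<^sub>M M) (\<lambda>z. cnj (f (fst z)) * g (snd z))"
    by (rule pair_mult_integral(1)[of M M "\<lambda>x. cnj (f x)" g])
       (use L2_integrable f g sf in auto)
  then have "integrable (M \<Otimes>\<^sub>M M) (\<lambda>z. B * cmod (cnj (f (fst z)) * g (snd z)))" by auto
  then have i: "integrable (M \<Otimes>\<^sub>M M) (\<lambda>(x, y). cnj (f x) * (k x y * g y))"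
  proof (rule Bochner_Integration.integrable_bound)
    show "AE z in M \<Otimes>\<^sub>M M. norm (case z of (x, y) \<Rightarrow> cnj (f x) * (k x y * g y)) \<le>
       norm (B * cmod (cnj (f (fst z)) * g (snd z)))"
    proof (rule AE_I2)
      fix z
      have "cmod (f (fst z)) * cmod (g (snd z)) * cmod (k (fst z) (snd z)) \<le> cmod (f (fst z)) * cmod (g (snd z)) * B"
        by (intro mult_left_mono k_bound) auto
      then show "norm (case z of (x, y) \<Rightarrow> cnj (f x) * (k x y * g y)) \<le> norm (B * cmod (cnj (f (fst z)) * g (snd z)))"
        using B_nonneg by (simp add: norm_mult mult_ac split_beta)
    qed
  qed measurable
  have "ip M f (A g) = (LINT x|M. LINT y|M. cnj (f x) * (k x y * g y))"
    by (simp add: ip_def A_eq)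
  also have "\<dots> = (LINT y|M. LINT x|M. cnj (f x) * (k x y * g y))"
    by (rule Fubini_integral[OF i, symmetric])
  also have "\<dots> = (LINT y|M. cnj (cnj (g y) * A f y))"
  proof (intro Bochner_Integration.integral_cong refl)
    fix y
    have "(LINT x|M. cnj (f x) * (k x y * g y)) = (LINT x|M. g y * cnj (k y x * f x))"
      by (intro Bochner_Integration.integral_cong refl) (simp add: k_hermitian[of _ y] mult_ac)
    also have "\<dots> = g y * cnj (A f y)"
      by (simp only: A_eq integral_mult_right_zero Bochner_Integration.integral_cnj)
    finally show "(LINT x|M. cnj (f x) * (k x y * g y)) = cnj (cnj (g y) * A f y)" by simp
  qed
  also have "\<dots> = cnj (ip M g (A f))" by (simp only: ip_def Bochner_Integration.integral_cnj)
  finally show ?thesis .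
qed

section \<open>The numerical range\<close>

definition G :: "real \<Rightarrow> ('a \<Rightarrow> complex) \<Rightarrow> 'a \<Rightarrow> complex"
  where "G r f x = A f x - complex_of_real r * f x"

lemma G_L2: "f \<in> L2 M \<Longrightarrow> G r f \<in> L2 M"
  unfolding G_def[abs_def] by (intro L2_diff L2_scale A_L2)

lemma G_sqnorm:
  assumes "f \<in> L2 M" shows "sqnorm M (G r f) \<le> (2 * K\<^sup>2 + 2 * r\<^sup>2) * sqnorm M f"
proof -
  have "sqnorm M (G r f) = sqnorm M (\<lambda>x. A f x + complex_of_real (- r) * f x)"
    by (simp add: G_def[abs_def])
  also have "\<dots> \<le> 2 * sqnorm M (A f) + 2 * sqnorm M (\<lambda>x. complex_of_real (- r) * f x)"
    by (rule sqnorm_add_le[OF A_L2(1) L2_scale]) (use assms in auto)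
  also have "\<dots> \<le> 2 * (K\<^sup>2 * sqnorm M f) + 2 * (r\<^sup>2 * sqnorm M f)"
    unfolding sqnorm_scale using A_L2(2)[OF assms] by simp
  finally show ?thesis by (simp add: algebra_simps)
qed

lemma G_lin:
  assumes "f \<in> L2 M" "g \<in> L2 M" "x \<in> space M"
  shows "G r (\<lambda>x. f x + c * g x) x = G r f x + c * G r g x"
  using A_add[OF L2_integrable[OF assms(1)] L2_integrable[OF L2_scale[OF assms(2)]] assms(3), of c]
  by (simp add: G_def A_scale algebra_simps)

definition num :: "('a \<Rightarrow> complex) \<Rightarrow> real" where "num f = Re (ip M f (A f))"

definition num_inf :: real where "num_inf = Inf (num ` {f \<in> L2 M. sqnorm M f = 1})"

lemma num_bound: "f \<in> L2 M \<Longrightarrow> \<bar>num f\<bar> \<le> K * sqnorm M f"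
proof -
  assume f: "f \<in> L2 M"
  have "\<bar>num f\<bar> \<le> cmod (ip M f (A f))" unfolding num_def by (rule abs_Re_le_cmod)
  also have "\<dots> \<le> sqrt (sqnorm M f) * sqrt (sqnorm M (A f))" by (rule ip_cauchy_schwarz[OF f A_L2(1)[OF f]])
  also have "\<dots> \<le> sqrt (sqnorm M f) * sqrt (K\<^sup>2 * sqnorm M f)"
    by (intro mult_left_mono real_sqrt_le_mono A_L2(2) f) auto
  also have "\<dots> = K * sqnorm M f" using K_nonneg by (simp add: real_sqrt_mult)
  finally show ?thesis .
qed

lemma num_scale: "num (\<lambda>x. complex_of_real c * f x) = c\<^sup>2 * num f"
proof -
  have A: "A (\<lambda>x. complex_of_real c * f x) = (\<lambda>x. complex_of_real c * A f x)" by (intro ext A_scale)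
  have 1: "ip M (\<lambda>x. complex_of_real c * f x) (A f) = complex_of_real c * ip M f (A f)"
    by (subst ip_commute, subst ip_scale_right, subst (2) ip_commute) simp
  have "ip M (\<lambda>x. complex_of_real c * f x) (A (\<lambda>x. complex_of_real c * f x)) =
     complex_of_real (c\<^sup>2) * ip M f (A f)"
    unfolding A ip_scale_right 1 by (simp add: power2_eq_square)
  then show ?thesis by (simp only: num_def Re_complex_of_real times_complex.sel Im_complex_of_real mult_zero_left diff_zero)
qed

lemma num_inf_bdd: "bdd_below (num ` {f \<in> L2 M. sqnorm M f = 1})"
proof (rule bdd_belowI2)
  fix f assume "f \<in> {f \<in> L2 M. sqnorm M f = 1}"
  then show "- K \<le> num f" using num_bound[of f] by auto
qed

lemma exists_unit: "{f \<in> L2 M. sqnorm M f = 1} \<noteq> {}"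
proof -
  define c where "c = 1 / sqrt (measure M (space M))"
  have c: "c\<^sup>2 * measure M (space M) = 1" using space_pos by (simp add: c_def power_divide)
  have "(\<lambda>x. complex_of_real c * 1) \<in> L2 M" by (rule L2_scale[OF one_L2(1)])
  moreover have "sqnorm M (\<lambda>x. complex_of_real c * 1) = 1"
    unfolding sqnorm_scale one_L2(2) using c by simp
  ultimately show ?thesis by blast
qed

text \<open>Homogeneity of degree two extends the infimum over unit vectors to all of
  \<open>L2\<close>; for norm 0 the form vanishes by \<open>num_bound\<close>.\<close>

lemma num_inf_le:
  assumes f: "f \<in> L2 M" shows "num_inf * sqnorm M f \<le> num f"
proof (cases "sqnorm M f = 0")
  case True
  then show ?thesis using num_bound[OF f] by simp
next
  case False
  then have p: "sqnorm M f > 0" using sqnorm_nonneg[of M f] by linarith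
  define c where "c = 1 / sqrt (sqnorm M f)"
  have c: "c\<^sup>2 = 1 / sqnorm M f" using p by (simp add: c_def power_divide)
  let ?g = "\<lambda>x. complex_of_real c * f x"
  have "?g \<in> {f \<in> L2 M. sqnorm M f = 1}"
    using L2_scale[OF f] p unfolding mem_Collect_eq sqnorm_scale by (auto simp: c)
  then have "num_inf \<le> num ?g" unfolding num_inf_def by (intro cINF_lower num_inf_bdd)
  then show ?thesis unfolding num_scale c using p by (simp add: field_simps)
qed

lemma num_inf_approx:
  assumes "e > 0" obtains f where "f \<in> L2 M" "sqnorm M f = 1" "num f < num_inf + e"
proof -
  have "Inf (num ` {f \<in> L2 M. sqnorm M f = 1}) < num_inf + e" using assms by (simp add: num_inf_def)
  then obtain f where "f \<in> {f \<in> L2 M. sqnorm M f = 1}" "num f < num_inf + e"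
    using exists_unit num_inf_bdd by (subst (asm) cInf_less_iff) auto
  then show ?thesis using that by blast
qed

lemma ip_G:
  assumes f: "f \<in> L2 M" and g: "g \<in> L2 M"
  shows "ip M f (G r g) = ip M f (A g) - complex_of_real r * ip M f g"
proof -
  have "G r g = (\<lambda>x. A g x + complex_of_real (- r) * g x)" by (simp add: G_def[abs_def])
  then have "ip M f (G r g) = ip M f (A g) + complex_of_real (- r) * ip M f g"
    by (simp only: ip_add_right[OF f A_L2(1)[OF g] L2_scale[OF g]] ip_scale_right)
  then show ?thesis by simp
qed

lemma Re_ip_G:
  "f \<in> L2 M \<Longrightarrow> Re (ip M f (G r f)) = num f - r * sqnorm M f"
  by (simp add: ip_G ip_self num_def)

lemma G_symmetric:
  assumes f: "f \<in> L2 M" and g: "g \<in> L2 M"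
  shows "ip M f (G r g) = cnj (ip M g (G r f))"
  using A_symmetric[OF f g] ip_commute[of M f g] by (simp add: ip_G f g)

text \<open>Symmetry of \<open>G r\<close> merges the two cross terms of the expanded form;
  \<open>s\<close> is later chosen to make the expansion small.\<close>

lemma G_shifted_quadratic:
  assumes f: "f \<in> L2 M" and w: "w \<in> L2 M"
  shows "Re (ip M (\<lambda>x. f x + complex_of_real s * w x) (G r (\<lambda>x. f x + complex_of_real s * w x))) =
    Re (ip M f (G r f)) + 2 * s * Re (ip M w (G r f)) + s\<^sup>2 * Re (ip M w (G r w))"
proof -
  let ?s = "complex_of_real s"
  let ?v = "\<lambda>x. f x + ?s * w x"
  have v: "?v \<in> L2 M" by (intro L2_add L2_scale f w)
  have "ip M ?v (G r ?v) = ip M ?v (\<lambda>x. G r f x + ?s * G r w x)"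
    by (rule ip_cong) (auto simp: G_lin[OF f w])
  also have "\<dots> = ip M ?v (G r f) + ?s * ip M ?v (G r w)"
    using ip_add_right[OF v G_L2[OF f] L2_scale[OF G_L2[OF w]]] by (simp add: ip_scale_right)
  finally have 1: "ip M ?v (G r ?v) = ip M ?v (G r f) + ?s * ip M ?v (G r w)" .
  have 2: "Re (ip M ?v h) = Re (ip M f h) + s * Re (ip M w h)" if h: "h \<in> L2 M" for h
  proof -
    have "ip M h ?v = ip M h f + ?s * ip M h w"
      using ip_add_right[OF h f L2_scale[OF w]] by (simp add: ip_scale_right)
    then show ?thesis by (simp add: ip_commute[of M _ h])
  qed
  have 3: "Re (ip M f (G r w)) = Re (ip M w (G r f))" using G_symmetric[OF f w, of r] by simp
  have "Re (ip M ?v (G r ?v)) = Re (ip M ?v (G r f)) + s * Re (ip M ?v (G r w))" unfolding 1 by simp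
  then show ?thesis unfolding 2[OF G_L2[OF f]] 2[OF G_L2[OF w]] 3 by (simp add: power2_eq_square algebra_simps)
qed

text \<open>Cauchy--Schwarz for the semidefinite form of \<open>A - num_inf\<close>: an approximate minimizer of
  the quadratic form is an approximate eigenvector.\<close>

lemma G_num_inf_sqnorm:
  assumes f: "f \<in> L2 M"
  shows "sqnorm M (G num_inf f) \<le> (K + \<bar>num_inf\<bar> + 1) * (num f - num_inf * sqnorm M f)"
proof -
  let ?L = "K + \<bar>num_inf\<bar> + 1"
  \<comment> \<open>\<open>?L\<close> bounds the form of \<open>G num_inf\<close> from above; the
    summand 1 keeps it positive.\<close>
  have L: "?L > 0" using K_nonneg by linarith
  let ?w = "G num_inf f"
  have w: "?w \<in> L2 M" by (rule G_L2[OF f])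
  \<comment> \<open>The minimizer of \<open>2 * s + ?L * s\<^sup>2\<close>, which multiplies the
    square norm of \<open>?w\<close> once the quadratic term has been bounded by
    \<open>?L\<close>.\<close>
  let ?s = "- (1 / ?L)"
  let ?v = "\<lambda>x. f x + complex_of_real ?s * ?w x"
  have v: "?v \<in> L2 M" by (intro L2_add L2_scale f w)
  have "0 \<le> Re (ip M ?v (G num_inf ?v))"
    unfolding Re_ip_G[OF v] using num_inf_le[OF v] by simp
  also have "\<dots> = Re (ip M f (G num_inf f)) + 2 * ?s * sqnorm M ?w + ?s\<^sup>2 * Re (ip M ?w (G num_inf ?w))"
    unfolding G_shifted_quadratic[OF f w] ip_self by simp
  also have "Re (ip M ?w (G num_inf ?w)) \<le> ?L * sqnorm M ?w"
  proof -
    have "num ?w \<le> K * sqnorm M ?w" using num_bound[OF w] by linarith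
    moreover have "- num_inf * sqnorm M ?w \<le> (\<bar>num_inf\<bar> + 1) * sqnorm M ?w"
      by (rule mult_right_mono) auto
    ultimately show ?thesis unfolding Re_ip_G[OF w] by (simp add: algebra_simps)
  qed
  finally have "0 \<le> (num f - num_inf * sqnorm M f) + 2 * ?s * sqnorm M ?w + ?s\<^sup>2 * (?L * sqnorm M ?w)"
    unfolding Re_ip_G[OF f] by (simp add: mult_left_mono)
  moreover have "?s\<^sup>2 * (?L * sqnorm M ?w) = sqnorm M ?w / ?L" using L by (simp add: power2_eq_square)
  ultimately have "sqnorm M ?w / ?L \<le> num f - num_inf * sqnorm M f" by simp
  then show ?thesis using L by (simp add: divide_le_eq mult.commute)
qed

text \<open>Unit vectors with \<open>num f\<close> close to \<open>num_inf\<close> are approximate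
  eigenvectors by \<open>G_num_inf_sqnorm\<close>. A bounded inverse \<open>R\<close> would recover
  them from \<open>G num_inf f\<close>, whose norm is as small as desired.\<close>

lemma num_inf_spectrum: "complex_of_real num_inf \<in> L2_spectrum M A"
proof (rule ccontr)
  assume "\<not> ?thesis"
  then obtain R C where R: "\<And>f. f \<in> L2 M \<Longrightarrow> R f \<in> L2 M \<and> Lp_norm 2 M (R f) \<le> C * Lp_norm 2 M f \<and>
      (AE x in M. R (\<lambda>y. A f y - complex_of_real num_inf * f y) x = f x)"
    unfolding L2_spectrum_def L2_resolvent_set_def by fastforce
  let ?L = "K + \<bar>num_inf\<bar> + 1"
  have L: "?L > 0" using K_nonneg by linarith
  \<comment> \<open>Chosen so that \<open>C\<^sup>2 * ?L * e < 1\<close>; the square spares a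
    discussion of the sign of \<open>C\<close>.\<close>
  define e where "e = 1 / (2 * (C\<^sup>2 * ?L + 1))"
  have CL: "C\<^sup>2 * ?L + 1 > 0" using L by (simp add: add_nonneg_pos)
  have e: "e > 0" using CL by (simp add: e_def)
  obtain f where f: "f \<in> L2 M" "sqnorm M f = 1" "num f < num_inf + e" using num_inf_approx[OF e] .
  let ?h = "G num_inf f"
  have h: "?h \<in> L2 M" by (rule G_L2[OF f(1)])
  have hs: "sqnorm M ?h \<le> ?L * e"
  proof -
    have "sqnorm M ?h \<le> ?L * (num f - num_inf)" using G_num_inf_sqnorm[OF f(1)] f(2) by simp
    also have "\<dots> \<le> ?L * e" using L f(3) by (intro mult_left_mono) auto
    finally show ?thesis .
  qed
  have "AE x in M. R ?h x = f x" using R[OF f(1)] by (simp add: G_def[abs_def])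
  then have "sqnorm M (R ?h) = sqnorm M f"
    using R[OF h] f(1) unfolding sqnorm_def by (intro integral_cong_AE) (auto simp: L2_iff)
  then have "1 = sqnorm M (R ?h)" using f(2) by simp
  moreover have "sqrt (sqnorm M (R ?h)) \<le> C * sqrt (sqnorm M ?h)" using R[OF h] by (simp add: Lp_norm_2)
  ultimately have "1 \<le> C * sqrt (sqnorm M ?h)" by simp
  then have "1\<^sup>2 \<le> (C * sqrt (sqnorm M ?h))\<^sup>2" by (intro power_mono) auto
  also have "\<dots> = C\<^sup>2 * sqnorm M ?h" by (simp add: power_mult_distrib)
  also have "\<dots> \<le> C\<^sup>2 * (?L * e)" by (intro mult_left_mono hs) auto
  also have "\<dots> < 1"
  proof -
    have "C\<^sup>2 * (?L * e) = (C\<^sup>2 * ?L) / (2 * (C\<^sup>2 * ?L + 1))" by (simp add: e_def)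
    also have "\<dots> < 1" using CL L by (subst divide_less_eq_1) auto
    finally show ?thesis .
  qed
  finally show False by simp
qed

end

section \<open>Inversion below the numerical range\<close>

context hermitian_kernel
begin

text \<open>For a step \<open>t\<close> the expanded square is at most
  \<open>1 - 2 * t * c + t\<^sup>2 * L\<close> times the square norm of \<open>u\<close>, by
  coercivity and boundedness of \<open>G r\<close>; \<open>t = c / L\<close> minimizes this. The
  summand \<open>c\<^sup>2 + 1\<close> in \<open>L\<close> makes the resulting factor
  positive.\<close>

lemma richardson_contraction:
  assumes u: "u \<in> L2 M" and r: "r < num_inf" and c: "c = num_inf - r" and L: "L = 2 * K\<^sup>2 + 2 * r\<^sup>2 + c\<^sup>2 + 1"
  shows "sqnorm M (\<lambda>x. u x - complex_of_real (c / L) * G r u x) \<le> (1 - c\<^sup>2 / L) * sqnorm M u"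
proof -
  have L0: "L > 0" and LG: "2 * K\<^sup>2 + 2 * r\<^sup>2 \<le> L" unfolding L by (auto simp: add_nonneg_pos)
  have c0: "c > 0" using r by (simp add: c)
  let ?t = "c / L"
  have "sqnorm M (\<lambda>x. u x - complex_of_real ?t * G r u x) =
     sqnorm M u + ?t\<^sup>2 * sqnorm M (G r u) - 2 * (?t * Re (ip M u (G r u)))"
    using sqnorm_diff_expand[OF u L2_scale[OF G_L2[OF u]], of "complex_of_real ?t" r]
    unfolding ip_def[symmetric] ip_scale_right sqnorm_scale norm_of_real power2_abs Re_complex_of_real
      times_complex.sel Im_complex_of_real by simp
  also have "\<dots> \<le> sqnorm M u + ?t\<^sup>2 * (L * sqnorm M u) - 2 * (?t * (c * sqnorm M u))"
  proof -
    have "sqnorm M (G r u) \<le> L * sqnorm M u"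
      by (rule order_trans[OF G_sqnorm[OF u] mult_right_mono[OF LG]]) simp
    moreover have "c * sqnorm M u \<le> Re (ip M u (G r u))"
      using num_inf_le[OF u] by (simp add: Re_ip_G[OF u] c algebra_simps)
    ultimately show ?thesis using c0 L0 by (intro diff_mono add_mono mult_left_mono order_refl) auto
  qed
  also have "\<dots> = (1 - c\<^sup>2 / L) * sqnorm M u" using L0 by (simp add: field_simps power2_eq_square)
  finally show ?thesis .
qed

text \<open>The equation \<open>G r u = f\<close> is solved by the iteration \<open>u \<mapsto> u - t (G r u - f)\<close>, a contraction
  for small \<open>t\<close> because \<open>G r\<close> is bounded and coercive; \<open>u\<close> is the sum of the increments.\<close>

lemma G_surjective:
  assumes r: "r < num_inf" and f: "f \<in> L2 M"
  shows "\<exists>u\<in>L2 M. AE x in M. G r u x = f x"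
proof -
  define c where "c = num_inf - r"
  define L where "L = 2 * K\<^sup>2 + 2 * r\<^sup>2 + c\<^sup>2 + 1"
  define t where "t = complex_of_real (c / L)"
  define \<rho> where "\<rho> = 1 - c\<^sup>2 / L"
  have c0: "c > 0" using r by (simp add: c_def)
  have L0: "L > 0" and Lc: "c\<^sup>2 < L" unfolding L_def by (auto simp: add_nonneg_pos)
  have t0: "t \<noteq> 0" using c0 L0 by (simp add: t_def)
  have \<rho>: "0 < \<rho>" "\<rho> < 1" using c0 L0 Lc by (auto simp: \<rho>_def)
  \<comment> \<open>\<open>geometric_L2_domination\<close> spends half of the decay of the norms on
    summability and half on the pointwise geometric bound, so square norms have to decay like
    \<open>\<tau> ^ (4 * n)\<close>.\<close>
  define \<tau> where "\<tau> = root 4 \<rho>"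
  have \<tau>: "0 < \<tau>" "\<tau> < 1" "\<tau> ^ 4 = \<rho>" using \<rho> by (auto simp: \<tau>_def)
  define T where "T u x = u x - t * G r u x" for u x
  \<comment> \<open>The increments of the iteration started at 0: the inhomogeneous term enters
    once, and differences of iterates are propagated by \<open>T\<close>.\<close>
  define d where "d n = (T ^^ n) (\<lambda>x. t * f x)" for n
  have d0: "d 0 = (\<lambda>x. t * f x)" and dS: "d (Suc n) = T (d n)" for n by (simp_all add: d_def)
  have T2: "T u \<in> L2 M" if "u \<in> L2 M" for u
    unfolding T_def[abs_def] by (intro L2_diff L2_scale G_L2 that)
  have d2: "d n \<in> L2 M" for n by (induction n) (simp_all add: d0 dS T2 L2_scale f)
  have dn: "sqnorm M (d n) \<le> sqnorm M (d 0) * \<tau> ^ (4 * n)" for n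
  proof (induction n)
    case (Suc n)
    have "sqnorm M (d (Suc n)) \<le> \<rho> * sqnorm M (d n)"
      unfolding dS T_def[abs_def] t_def \<rho>_def by (rule richardson_contraction[OF d2 r c_def L_def])
    also have "\<dots> \<le> \<rho> * (sqnorm M (d 0) * \<tau> ^ (4 * n))" using \<rho> Suc by (intro mult_left_mono) auto
    also have "\<dots> = sqnorm M (d 0) * \<tau> ^ (4 * Suc n)" using \<tau>(3) by (simp add: power_add mult_ac)
    finally show ?case .
  qed simp
  obtain w where w: "w \<in> borel_measurable M" "\<And>x. 0 \<le> w x" "integrable M (\<lambda>x. (w x)\<^sup>2)"
    "AE x in M. \<forall>n. cmod (d n x) \<le> w x * \<tau> ^ n"
    using geometric_L2_domination[OF d2 dn \<tau>(1,2)] by blast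
  note [measurable] = w(1)
  have [measurable]: "d n \<in> borel_measurable M" for n using d2[of n] by (simp add: L2_iff)
  define s where "s N x = (\<Sum>n<N. d n x)" for N x
  \<comment> \<open>At points where the partial sums diverge the value is unspecified; by
    \<open>w(4)\<close> these points are negligible.\<close>
  define u where "u x = lim (\<lambda>N. s N x)" for x
  have [measurable]: "s N \<in> borel_measurable M" for N unfolding s_def by measurable
  have [measurable]: "u \<in> borel_measurable M" unfolding u_def by (rule borel_measurable_lim_metric) measurable
  have s2: "s N \<in> L2 M" for N
  proof (induction N)
    case 0
    show ?case by (simp add: s_def[abs_def] L2_iff)
  next
    case (Suc N)
    then show ?case using L2_add[OF Suc d2[of N]] by (simp add: s_def[abs_def])
  qed
  have conv: "(\<lambda>N. s N x) \<longlonglongrightarrow> u x" "cmod (s N x) \<le> w x * (1 / (1 - \<tau>))" "(\<lambda>n. d n x) \<longlonglongrightarrow> 0"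
    if x: "\<forall>n. cmod (d n x) \<le> w x * \<tau> ^ n" for x N
  proof -
    have g: "summable (\<lambda>n. w x * \<tau> ^ n)" using \<tau> by (intro summable_mult summable_geometric) auto
    have sn: "summable (\<lambda>n. norm (d n x))" by (rule summable_comparison_test[OF _ g]) (use x in auto)
    then have sd: "summable (\<lambda>n. d n x)" by (rule summable_norm_cancel)
    show "(\<lambda>N. s N x) \<longlonglongrightarrow> u x"
      using summable_LIMSEQ[OF sd] unfolding u_def s_def by (simp add: suminf_eq_lim)
    show "(\<lambda>n. d n x) \<longlonglongrightarrow> 0" by (rule summable_LIMSEQ_zero[OF sd])
    have "cmod (s N x) \<le> (\<Sum>n<N. w x * \<tau> ^ n)"
      unfolding s_def by (rule order_trans[OF norm_sum sum_mono]) (use x in auto)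
    also have "\<dots> \<le> (\<Sum>n. w x * \<tau> ^ n)" using w(2)[of x] \<tau> by (intro sum_le_suminf[OF g]) auto
    also have "\<dots> = w x * (1 / (1 - \<tau>))" using \<tau> suminf_geometric[of \<tau>]
      by (subst suminf_mult[OF summable_geometric]) auto
    finally show "cmod (s N x) \<le> w x * (1 / (1 - \<tau>))" .
  qed
  have w2: "(\<lambda>x. complex_of_real (w x)) \<in> L2 M" using w(3) by (simp add: L2_iff)
  have ub: "AE x in M. cmod (u x) \<le> 1 / (1 - \<tau>) * cmod (complex_of_real (w x))"
    using w(4)
  proof eventually_elim
    case (elim x)
    have "cmod (u x) \<le> w x * (1 / (1 - \<tau>))"
      using tendsto_upperbound[OF tendsto_norm[OF conv(1)[OF elim]]] conv(2)[OF elim] by auto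
    then show ?case using w(2)[of x] by (simp add: mult.commute)
  qed
  have u2: "u \<in> L2 M" by (rule L2_bound[OF w2 _ ub]) measurable
  have Alim: "(\<lambda>N. A (s N) x) \<longlonglongrightarrow> A u x" if x: "x \<in> space M" for x
    unfolding A_eq
  proof (rule integral_dominated_convergence[where w = "\<lambda>y. B * (w y * (1 / (1 - \<tau>)))"])
    have [measurable]: "k x \<in> borel_measurable M" by (rule k_section[OF x])
    show "(\<lambda>y. k x y * u y) \<in> borel_measurable M" "\<And>N. (\<lambda>y. k x y * s N y) \<in> borel_measurable M" by measurable
    have "integrable M w" using integrable_norm[OF L2_integrable[OF w2]] w(2) by simp
    then show "integrable M (\<lambda>y. B * (w y * (1 / (1 - \<tau>))))" by auto
    show "AE y in M. (\<lambda>N. k x y * s N y) \<longlonglongrightarrow> k x y * u y"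
      using w(4) by eventually_elim (intro tendsto_intros conv(1))
    show "AE y in M. norm (k x y * s N y) \<le> B * (w y * (1 / (1 - \<tau>)))" for N
      using w(4)
    proof eventually_elim
      case (elim y)
      then show ?case unfolding norm_mult by (intro mult_mono conv(2) k_bound B_nonneg norm_ge_zero)
    qed
  qed
  \<comment> \<open>\<open>T\<close> is the identity minus \<open>t * G r\<close>, so applying
    \<open>t * G r\<close> to a sum of powers of \<open>T\<close> telescopes.\<close>
  have tele: "t * G r (s N) x = d 0 x - d N x" if x: "x \<in> space M" for N x
  proof (induction N)
    case 0
    have "A (\<lambda>_. 0) x = 0" by (subst A_eq) simp
    then show ?case by (simp add: s_def[abs_def] G_def)
  next
    case (Suc N)
    have "G r (s (Suc N)) x = G r (\<lambda>x. s N x + 1 * d N x) x" by (simp add: s_def[abs_def])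
    also have "\<dots> = G r (s N) x + 1 * G r (d N) x" by (rule G_lin[OF s2 d2 x])
    finally have "t * G r (s (Suc N)) x = (d 0 x - d N x) + t * G r (d N) x"
      using Suc by (simp add: distrib_left)
    also have "\<dots> = d 0 x - d (Suc N) x" by (simp add: dS T_def)
    finally show ?case .
  qed
  have "AE x in M. G r u x = f x"
    using w(4) AE_space
  proof eventually_elim
    case (elim x)
    have "(\<lambda>N. t * G r (s N) x) \<longlonglongrightarrow> t * G r u x"
      unfolding G_def by (intro tendsto_intros Alim conv(1) elim)
    moreover have "(\<lambda>N. t * G r (s N) x) \<longlonglongrightarrow> d 0 x - 0"
      unfolding tele[OF elim(2)] by (intro tendsto_intros conv(3) elim)
    ultimately have "t * G r u x = d 0 x - 0" by (rule LIMSEQ_unique)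
    then show ?case using t0 by (simp add: d0)
  qed
  then show ?thesis using u2 by blast
qed

text \<open>The lower bound of the form combined with Cauchy--Schwarz. It yields both the bound on
  the inverse and the uniqueness of solutions.\<close>

lemma G_coercive:
  assumes "u \<in> L2 M" shows "(num_inf - r) * sqrt (sqnorm M u) \<le> sqrt (sqnorm M (G r u))"
proof (cases "sqnorm M u = 0")
  case False
  then have p: "sqrt (sqnorm M u) > 0" using sqnorm_nonneg[of M u] by (simp add: less_le)
  have "(num_inf - r) * (sqrt (sqnorm M u) * sqrt (sqnorm M u)) \<le> sqrt (sqnorm M u) * sqrt (sqnorm M (G r u))"
    using Re_ip_le[OF assms G_L2[OF assms, of r]] num_inf_le[OF assms]
    unfolding Re_ip_G[OF assms] by (simp add: left_diff_distrib)
  then have "sqrt (sqnorm M u) * ((num_inf - r) * sqrt (sqnorm M u)) \<le> sqrt (sqnorm M u) * sqrt (sqnorm M (G r u))"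
    by (simp only: mult_ac)
  then show ?thesis using p by (simp only: mult_le_cancel_left_pos)
qed simp

text \<open>\<open>G_surjective\<close> supplies a right inverse by choice; it is also a left
  inverse because coercivity makes solutions unique almost everywhere.\<close>

lemma below_num_inf_resolvent:
  assumes r: "r < num_inf" shows "complex_of_real r \<in> L2_resolvent_set M A"
proof -
  obtain R where R: "\<And>f. f \<in> L2 M \<Longrightarrow> R f \<in> L2 M" "\<And>f. f \<in> L2 M \<Longrightarrow> AE x in M. G r (R f) x = f x"
    using G_surjective[OF r] by metis
  have sq: "sqnorm M (G r (R f)) = sqnorm M f" if "f \<in> L2 M" for f
    using L2_AE_cong(2)[OF that L2_measurable[OF G_L2[OF R(1)[OF that]]] R(2)[OF that]] .
  have 1: "Lp_norm 2 M (R f) \<le> 1 / (num_inf - r) * Lp_norm 2 M f" if "f \<in> L2 M" for f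
    using G_coercive[OF R(1)[OF that], of r] r by (simp add: Lp_norm_2 sq[OF that] field_simps)
  have 2: "AE x in M. A (R f) x - complex_of_real r * R f x = f x" if "f \<in> L2 M" for f
    using R(2)[OF that] by (simp add: G_def)
  have 3: "AE x in M. R (\<lambda>y. A f y - complex_of_real r * f y) x = f x" if f: "f \<in> L2 M" for f
  proof -
    have Gf: "(\<lambda>y. A f y - complex_of_real r * f y) = G r f" by (simp add: G_def[abs_def])
    let ?u = "R (G r f)"
    have u: "?u \<in> L2 M" by (rule R(1)[OF G_L2[OF f]])
    let ?d = "\<lambda>x. ?u x + (-1) * f x"
    have d: "?d \<in> L2 M" by (intro L2_add L2_scale u f)
    have "AE x in M. G r ?d x = 0"
      using R(2)[OF G_L2[OF f, of r]] AE_space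
    proof eventually_elim
      case (elim x)
      show ?case using G_lin[OF u f elim(2), of r "-1"] elim(1) by simp
    qed
    then have "sqnorm M (G r ?d) = sqnorm M (\<lambda>_. 0)"
      by (intro L2_AE_cong(2)) (use L2_measurable[OF G_L2[OF d]] in \<open>auto simp: L2_iff\<close>)
    then have "sqnorm M (G r ?d) = 0" by (simp add: sqnorm_def)
    then have "(num_inf - r) * sqrt (sqnorm M ?d) \<le> 0" using G_coercive[OF d, of r] by simp
    then have "sqnorm M ?d \<le> 0" using r by (simp add: mult_le_0_iff)
    then have "sqnorm M ?d = 0" using sqnorm_nonneg[of M ?d] by linarith
    from sqnorm_zero_AE[OF d this] show ?thesis unfolding Gf by simp
  qed
  show ?thesis unfolding L2_resolvent_set_def using R(1) 1 2 3 by blast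
qed

text \<open>The infimum is attained at \<open>num_inf\<close>, so it remains to exclude the real
  points below it from the spectrum.\<close>

theorem spectrum_inf: "Inf {r. complex_of_real r \<in> L2_spectrum M A} = num_inf"
proof (rule cInf_eq_minimum)
  show "num_inf \<in> {r. complex_of_real r \<in> L2_spectrum M A}" using num_inf_spectrum by simp
  fix r assume "r \<in> {r. complex_of_real r \<in> L2_spectrum M A}"
  then show "num_inf \<le> r" using below_num_inf_resolvent[of r] by (force simp: L2_spectrum_def)
qed

end

section \<open>Restriction to the sphere\<close>

lemma measurable_polar_coordinates [measurable]:
  "(\<lambda>p. (norm p, direction p)) \<in> borel \<rightarrow>\<^sub>M borel \<Otimes>\<^sub>M unit_sphere_borel"
  by measurable

lemma polar_integrable_pair:
  fixes H :: "real \<times> (real^3) \<Rightarrow> 'b::{banach, second_countable_topology}"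
  assumes [measurable]: "H \<in> borel_measurable (borel \<Otimes>\<^sub>M unit_sphere_borel)"
  shows "integrable (radial_measure \<Otimes>\<^sub>M sphere_measure) H \<longleftrightarrow> integrable lborel (\<lambda>p. H (norm p, direction p))"
  unfolding polar_measure by (subst integrable_distr_eq) auto

lemma polar_integral_pair:
  fixes H :: "real \<times> (real^3) \<Rightarrow> 'b::{banach, second_countable_topology}"
  assumes [measurable]: "H \<in> borel_measurable (borel \<Otimes>\<^sub>M unit_sphere_borel)"
  shows "(LINT z|(radial_measure \<Otimes>\<^sub>M sphere_measure). H z) = (LINT p|lborel. H (norm p, direction p))"
  unfolding polar_measure by (subst integral_distr) auto

lemma polar_nn_integral_pair:
  assumes [measurable]: "H \<in> borel_measurable (borel \<Otimes>\<^sub>M unit_sphere_borel)"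
  shows "(\<integral>\<^sup>+z. H z \<partial>(radial_measure \<Otimes>\<^sub>M sphere_measure)) = (\<integral>\<^sup>+p. H (norm p, direction p) \<partial>lborel)"
  unfolding polar_measure by (subst nn_integral_distr) auto

lemma measurable_sphere_ident': "(\<lambda>x. x) \<in> sphere_measure \<rightarrow>\<^sub>M borel"
  by (rule borel_measurable_sphere) simp

lemma measurable_sphere_fst: "fst \<in> sphere_measure \<Otimes>\<^sub>M N \<rightarrow>\<^sub>M borel"
  by (rule measurable_compose[OF measurable_fst measurable_sphere_ident'])

lemma measurable_sphere_snd: "snd \<in> N \<Otimes>\<^sub>M sphere_measure \<rightarrow>\<^sub>M borel"
  by (rule measurable_compose[OF measurable_snd measurable_sphere_ident'])

definition fiber_integral :: "(real^3 \<Rightarrow> complex) \<Rightarrow> real^3 \<Rightarrow> complex"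
  where "fiber_integral g w = (LINT r|radial_measure. g (r *\<^sub>R w))"

lemma fiber_integral_measurable [measurable]:
  assumes [measurable]: "g \<in> borel_measurable borel"
  shows "fiber_integral g \<in> borel_measurable sphere_measure"
proof -
  have "(\<lambda>z. snd z *\<^sub>R fst z) \<in> sphere_measure \<Otimes>\<^sub>M radial_measure \<rightarrow>\<^sub>M borel"
    using measurable_sphere_fst by (intro borel_measurable_scaleR) auto
  from measurable_compose[OF this, of g] show ?thesis
    unfolding fiber_integral_def[abs_def] by (intro sigma_finite_measure.borel_measurable_lebesgue_integral[OF sigma_finite_radial_measure]) (simp add: split_beta')
qed

text \<open>Polar coordinates, \<open>e\<close> being constant along rays. For an exponential
  \<open>e\<close> it turns an inverse Fourier integral with the radius frozen in the phase into an
  integral of \<open>fiber_integral g\<close> over the sphere.\<close>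

lemma fiber_integral_pairing:
  assumes g: "integrable lborel g" and e[measurable]: "e \<in> borel_measurable unit_sphere_borel"
    and e1: "\<And>w. cmod (e w) = 1"
  shows "(LINT w|sphere_measure. fiber_integral g w * e w) = (LINT p|lborel. g p * e (direction p))"
proof -
  have [measurable]: "g \<in> borel_measurable borel" using g by auto
  have m[measurable]: "(\<lambda>z. g (fst z *\<^sub>R snd z)) \<in> borel_measurable (borel \<Otimes>\<^sub>M unit_sphere_borel)"
    by (rule measurable_compose[OF measurable_polar]) measurable
  have H: "(\<lambda>z. g (fst z *\<^sub>R snd z) * e (snd z)) \<in> borel_measurable (borel \<Otimes>\<^sub>M unit_sphere_borel)"
    by measurable
  have "integrable lborel (\<lambda>p. g p * e (direction p))"
    using g by (rule integrable_mult_unimodular) (use e1 in auto)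
  then have i: "integrable (radial_measure \<Otimes>\<^sub>M sphere_measure) (\<lambda>(r, w). g (r *\<^sub>R w) * e w)"
    using polar_integrable_pair[OF H] by (simp add: direction_decompose split_beta')
  have "(LINT w|sphere_measure. fiber_integral g w * e w) = (LINT w|sphere_measure. LINT r|radial_measure. g (r *\<^sub>R w) * e w)"
    by (simp add: fiber_integral_def)
  also have "\<dots> = (LINT z|(radial_measure \<Otimes>\<^sub>M sphere_measure). g (fst z *\<^sub>R snd z) * e (snd z))"
    using polar.integral_snd[OF i] by (simp add: split_beta')
  also have "\<dots> = (LINT p|lborel. g p * e (direction p))"
    unfolding polar_integral_pair[OF H] by (simp add: direction_decompose)
  finally show ?thesis .
qed

text \<open>Cauchy--Schwarz after splitting off the weights \<open>sqrt (1 / Q)\<close> and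
  \<open>sqrt Q\<close>, once along each ray and once over the whole space; in the second case the
  angular integration adds the factor \<open>sphere_area\<close>.\<close>

lemma fiber_integral_bounds:
  fixes g :: "real^3 \<Rightarrow> complex" and Q :: "real \<Rightarrow> real"
  assumes g: "integrable lborel g" and Q[measurable]: "Q \<in> borel_measurable borel" and Q0: "\<And>r. Q r > 0"
    and I[measurable]: "I \<in> sets borel" and supp: "\<And>p. norm p \<notin> I \<Longrightarrow> g p = 0"
    and m: "integrable radial_measure (\<lambda>r. indicator I r / Q r)"
    and N: "integrable lborel (\<lambda>p. Q (norm p) * (cmod (g p))\<^sup>2)"
  defines "mm \<equiv> LINT r|radial_measure. indicator I r / Q r"
    and "NN \<equiv> LINT p|lborel. Q (norm p) * (cmod (g p))\<^sup>2"
  shows "fiber_integral g \<in> L2 sphere_measure" "sqnorm sphere_measure (fiber_integral g) \<le> mm * NN"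
    "(LINT p|lborel. cmod (g p))\<^sup>2 \<le> sphere_area * mm * NN"
proof -
  have [measurable]: "g \<in> borel_measurable borel" using g by auto
  have mm0: "mm \<ge> 0" "NN \<ge> 0" unfolding mm_def NN_def using Q0 by (auto intro!: integral_nonneg_AE AE_I2 simp: less_imp_le)
  have split: "ennreal (cmod (g p)) = ennreal (sqrt (indicator I (norm p) / Q (norm p))) * ennreal (sqrt (Q (norm p)) * cmod (g p))" for p
  proof (cases "norm p \<in> I")
    case True
    then show ?thesis using Q0[of "norm p"] by (simp add: ennreal_mult[symmetric] real_sqrt_divide less_imp_le)
  qed (simp add: supp)
  have sq1: "(ennreal (sqrt (indicator I r / Q r)))\<^sup>2 = ennreal (indicator I r / Q r)" for r
    using Q0[of r] by (simp add: ennreal_power less_imp_le)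
  have sq2: "(ennreal (sqrt (Q r) * cmod a))\<^sup>2 = ennreal (Q r * (cmod a)\<^sup>2)" for r a
    using Q0[of r] by (simp add: ennreal_power power_mult_distrib less_imp_le)
  have nn_m: "(\<integral>\<^sup>+r. ennreal (indicator I r / Q r) \<partial>radial_measure) = ennreal mm"
    unfolding mm_def by (rule nn_integral_eq_integral[OF m]) (use Q0 in \<open>auto simp: less_imp_le\<close>)
  have nn_N: "(\<integral>\<^sup>+p. ennreal (Q (norm p) * (cmod (g p))\<^sup>2) \<partial>lborel) = ennreal NN"
    unfolding NN_def by (rule nn_integral_eq_integral[OF N]) (use Q0 in \<open>auto simp: less_imp_le\<close>)
  have "(ennreal (LINT p|lborel. cmod (g p)))\<^sup>2 = (\<integral>\<^sup>+p. ennreal (cmod (g p)) \<partial>lborel)\<^sup>2"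
    using g by (subst nn_integral_eq_integral) auto
  also have "\<dots> \<le> (\<integral>\<^sup>+p. (ennreal (sqrt (indicator I (norm p) / Q (norm (p::real^3)))))\<^sup>2 \<partial>lborel) *
      (\<integral>\<^sup>+p. (ennreal (sqrt (Q (norm p)) * cmod (g p)))\<^sup>2 \<partial>lborel)"
    unfolding split by (rule Cauchy_Schwarz_nn_integral) (simp_all, measurable)
  also have "\<dots> = (ennreal sphere_area * ennreal mm) * ennreal NN"
    unfolding sq1 sq2 nn_N
    by (subst nn_integral_radial_function[of "\<lambda>r. ennreal (indicator I r / Q r)"]) (simp_all add: nn_m)
  also have "\<dots> = ennreal (sphere_area * mm * NN)"
    using mm0 sphere_area_pos by (simp add: ennreal_mult)
  finally show "(LINT p|lborel. cmod (g p))\<^sup>2 \<le> sphere_area * mm * NN"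
    using mm0 sphere_area_pos by (simp add: ennreal_power)
  have fib: "ennreal ((cmod (fiber_integral g w))\<^sup>2) \<le> ennreal mm * (\<integral>\<^sup>+r. ennreal (Q r * (cmod (g (r *\<^sub>R w)))\<^sup>2) \<partial>radial_measure)"
    if w: "w \<in> sphere 0 1" for w
  proof -
    \<comment> \<open>On a ray where \<open>g\<close> is not integrable the Bochner integral is 0
      and the bound is trivial.\<close>
    have "ennreal (cmod (fiber_integral g w)) \<le> (\<integral>\<^sup>+r. ennreal (cmod (g (r *\<^sub>R w))) \<partial>radial_measure)"
      unfolding fiber_integral_def
      by (cases "integrable radial_measure (\<lambda>r. g (r *\<^sub>R w))")
         (auto simp: integral_norm_bound_ennreal not_integrable_integral_eq)
    also have "\<dots> = (\<integral>\<^sup>+r. ennreal (sqrt (indicator I r / Q r)) * ennreal (sqrt (Q r) * cmod (g (r *\<^sub>R w))) \<partial>radial_measure)"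
    proof -
      have "ennreal (r\<^sup>2 * indicator {0..} r) * ennreal (cmod (g (r *\<^sub>R w))) =
         ennreal (r\<^sup>2 * indicator {0..} r) * (ennreal (sqrt (indicator I r / Q r)) * ennreal (sqrt (Q r) * cmod (g (r *\<^sub>R w))))" for r
      proof (cases "r \<ge> 0")
        case True
        then have "norm (r *\<^sub>R w) = r" using w by simp
        then show ?thesis using split[of "r *\<^sub>R w"] by simp
      qed simp
      then show ?thesis by (subst (1 2) nn_integral_radial) (auto, measurable)
    qed
    finally have "(ennreal (cmod (fiber_integral g w)))\<^sup>2 \<le>
       (\<integral>\<^sup>+r. ennreal (sqrt (indicator I r / Q r)) * ennreal (sqrt (Q r) * cmod (g (r *\<^sub>R w))) \<partial>radial_measure)\<^sup>2"
      by (intro power_mono) auto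
    also have "\<dots> \<le> (\<integral>\<^sup>+r. (ennreal (sqrt (indicator I r / Q r)))\<^sup>2 \<partial>radial_measure) *
       (\<integral>\<^sup>+r. (ennreal (sqrt (Q r) * cmod (g (r *\<^sub>R w))))\<^sup>2 \<partial>radial_measure)"
      by (rule Cauchy_Schwarz_nn_integral) measurable
    finally show ?thesis unfolding sq1 sq2 nn_m by (simp add: ennreal_power)
  qed
  have meas: "(\<lambda>z. ennreal (Q (fst z) * (cmod (g (fst z *\<^sub>R snd z)))\<^sup>2)) \<in> borel_measurable (borel \<Otimes>\<^sub>M unit_sphere_borel)"
  proof -
    have "(\<lambda>z. g (fst z *\<^sub>R snd z)) \<in> borel_measurable (borel \<Otimes>\<^sub>M unit_sphere_borel)"
      by (rule measurable_compose[OF measurable_polar]) measurable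
    then show ?thesis by measurable
  qed
  have meas': "(\<lambda>(r, w). ennreal (Q r * (cmod (g (r *\<^sub>R w)))\<^sup>2)) \<in> borel_measurable (radial_measure \<Otimes>\<^sub>M sphere_measure)"
    using meas by (simp add: split_beta' measurable_cong_sets[OF sets_pair_measure_cong[OF sets_radial_measure sets_sphere_measure] refl])
  have "(\<integral>\<^sup>+w. ennreal ((cmod (fiber_integral g w))\<^sup>2) \<partial>sphere_measure) \<le>
     (\<integral>\<^sup>+w. ennreal mm * (\<integral>\<^sup>+r. ennreal (Q r * (cmod (g (r *\<^sub>R w)))\<^sup>2) \<partial>radial_measure) \<partial>sphere_measure)"
    by (intro nn_integral_mono fib) simp
  also have "\<dots> = ennreal mm * (\<integral>\<^sup>+w. \<integral>\<^sup>+r. ennreal (Q r * (cmod (g (r *\<^sub>R w)))\<^sup>2) \<partial>radial_measure \<partial>sphere_measure)"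
    by (rule nn_integral_cmult) (rule sigma_finite_measure.borel_measurable_nn_integral[OF sigma_finite_radial_measure],
       use measurable_pair_swap[OF meas'] in \<open>simp add: split_beta'\<close>)
  also have "(\<integral>\<^sup>+w. \<integral>\<^sup>+r. ennreal (Q r * (cmod (g (r *\<^sub>R w)))\<^sup>2) \<partial>radial_measure \<partial>sphere_measure) =
     (\<integral>\<^sup>+z. ennreal (Q (fst z) * (cmod (g (fst z *\<^sub>R snd z)))\<^sup>2) \<partial>(radial_measure \<Otimes>\<^sub>M sphere_measure))"
    using polar.nn_integral_snd[OF meas'] by (simp add: split_beta')
  also have "\<dots> = ennreal NN"
    unfolding polar_nn_integral_pair[OF meas] nn_N[symmetric] by (simp add: direction_decompose)
  also have "ennreal mm * ennreal NN = ennreal (mm * NN)" using mm0 by (simp add: ennreal_mult)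
  finally have le: "(\<integral>\<^sup>+w. ennreal ((cmod (fiber_integral g w))\<^sup>2) \<partial>sphere_measure) \<le> ennreal (mm * NN)" .
  show 2: "fiber_integral g \<in> L2 sphere_measure"
    by (rule L2_I_nn) (use le in \<open>auto intro: le_less_trans\<close>)
  show "sqnorm sphere_measure (fiber_integral g) \<le> mm * NN"
    using le mm0 unfolding nn_integral_sqnorm[OF 2] by simp
qed

text \<open>Rests on \<open>V\<close> being real, and is what makes the kernel on the sphere
  Hermitian.\<close>

lemma fourier_real_neg:
  assumes [measurable]: "V \<in> borel_measurable borel"
  shows "fourier (\<lambda>x. complex_of_real (V x)) (- p) = cnj (fourier (\<lambda>x. complex_of_real (V x)) p)"
proof -
  have "(LINT x|lborel. complex_of_real (V x) * exp (- \<i> * complex_of_real (- p \<bullet> x))) =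
     (LINT x|lborel. cnj (complex_of_real (V x) * exp (- \<i> * complex_of_real (p \<bullet> x))))"
    by (simp add: exp_cnj)
  then show ?thesis by (simp only: Bochner_Integration.integral_cnj) (simp add: fourier_lborel)
qed

abbreviation fourier_norm :: real where "fourier_norm \<equiv> (2 * pi) powr (- 3 / 2)"

lemma sphere_exp_measurable: "(\<lambda>w. iexp (a * (w \<bullet> x))) \<in> borel_measurable sphere_measure"
  by (rule borel_measurable_sphere) measurable

text \<open>The cap at 2 keeps the phase error integrable against \<open>V\<close>, for which no
  first moment is assumed.\<close>

lemma iexp_diff_le: "cmod (iexp a - iexp b) \<le> min 2 \<bar>a - b\<bar>"
proof -
  have "cmod (iexp a - iexp b) = cmod (iexp b * (iexp (a - b) - 1))"
    by (simp add: algebra_simps exp_add[symmetric] of_real_diff)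
  also have "\<dots> = cmod (iexp (a - b) - 1)" by (simp add: norm_mult)
  also have "\<dots> \<le> \<bar>a - b\<bar>" using iexp_approx1[of "a - b" 0] by simp
  finally have 1: "cmod (iexp a - iexp b) \<le> \<bar>a - b\<bar>" .
  have "cmod (iexp a - iexp b) \<le> cmod (iexp a) + cmod (iexp b)" by (rule norm_triangle_ineq4)
  then show ?thesis using 1 by simp
qed

section \<open>The operator on the sphere and its quadratic form\<close>

locale sphere_potential =
  fixes V :: "real^3 \<Rightarrow> real" and \<mu> :: real
  assumes V_measurable [measurable]: "V \<in> borel_measurable borel"
    and V_integrable: "integrable lborel V"
    and mu_pos: "\<mu> > 0"
begin

definition kern :: "real^3 \<Rightarrow> real^3 \<Rightarrow> complex"
  where "kern p q = complex_of_real (1 / (2 * pi) powr (3 / 2)) *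
    fourier (\<lambda>x. complex_of_real (V x)) (sqrt \<mu> *\<^sub>R (p - q))"

lemma kern_bound: "cmod (kern p q) \<le> 1 / (2 * pi) powr (3 / 2) * (fourier_norm * (LINT x|lborel. \<bar>V x\<bar>))"
  unfolding kern_def norm_mult norm_of_real
  by (intro mult_mono order_trans[OF fourier_bound]) (use V_integrable in auto)

lemma kern_measurable: "case_prod kern \<in> borel_measurable (sphere_measure \<Otimes>\<^sub>M sphere_measure)"
proof -
  have "(\<lambda>z. sqrt \<mu> *\<^sub>R (fst z - snd z)) \<in> sphere_measure \<Otimes>\<^sub>M sphere_measure \<rightarrow>\<^sub>M borel"
    using measurable_sphere_fst measurable_sphere_snd by (intro borel_measurable_scaleR borel_measurable_diff) auto
  then have "(\<lambda>z. fourier (\<lambda>x. complex_of_real (V x)) (sqrt \<mu> *\<^sub>R (fst z - snd z))) \<in> borel_measurable (sphere_measure \<Otimes>\<^sub>M sphere_measure)"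
    by (rule measurable_compose) measurable
  then show ?thesis unfolding kern_def split_beta' by (rule borel_measurable_times[OF borel_measurable_const])
qed

sublocale hermitian_kernel sphere_measure kern
  "1 / (2 * pi) powr (3 / 2) * (fourier_norm * (LINT x|lborel. \<bar>V x\<bar>))" "sphere_op \<mu> V"
proof
  show "kern y x = cnj (kern x y)" for x y
  proof -
    have "sqrt \<mu> *\<^sub>R (y - x) = - (sqrt \<mu> *\<^sub>R (x - y))" by (simp add: algebra_simps)
    then show ?thesis by (simp add: kern_def fourier_real_neg)
  qed
  show "sphere_op \<mu> V f x = (LINT y|sphere_measure. kern x y * f y)" for f x
    by (simp only: sphere_op_def kern_def mult.assoc integral_mult_right_zero)
  show "0 < measure sphere_measure (space sphere_measure)"
    using sphere_area_pos by (simp add: sphere_area_def)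
qed (rule kern_measurable, rule kern_bound)

lemma e_inf_eq: "e_inf \<mu> V = num_inf"
  unfolding e_inf_def by (rule spectrum_inf)

text \<open>The Fourier extension operator: up to normalization the adjoint of restricting a Fourier
  transform to the sphere of radius \<open>sqrt \<mu>\<close>.\<close>

definition sphere_ext :: "(real^3 \<Rightarrow> complex) \<Rightarrow> real^3 \<Rightarrow> complex"
  where "sphere_ext u x = complex_of_real fourier_norm * (LINT w|sphere_measure. u w * iexp (sqrt \<mu> * (w \<bullet> x)))"

lemma sphere_ext_measurable:
  assumes [measurable]: "u \<in> borel_measurable sphere_measure"
  shows "sphere_ext u \<in> borel_measurable borel"
proof -
  have "(\<lambda>z. iexp (sqrt \<mu> * (snd z \<bullet> fst z))) \<in> borel_measurable (borel \<Otimes>\<^sub>M sphere_measure)"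
  proof -
    have "(\<lambda>z. sqrt \<mu> * (snd z \<bullet> fst z)) \<in> borel_measurable (borel \<Otimes>\<^sub>M sphere_measure)"
      by (rule borel_measurable_times[OF borel_measurable_const borel_measurable_inner[OF measurable_sphere_snd measurable_fst]])
    then show ?thesis by (rule measurable_compose) measurable
  qed
  then have "(\<lambda>x. LINT w|sphere_measure. u w * iexp (sqrt \<mu> * (w \<bullet> x))) \<in> borel_measurable borel"
    by (intro sphere_measure.borel_measurable_lebesgue_integral) (simp add: split_beta')
  then show ?thesis unfolding sphere_ext_def[abs_def] by (rule borel_measurable_times[OF borel_measurable_const])
qed

text \<open>Insert the integral defining the transform of \<open>V\<close> and exchange it with the
  two sphere integrals, which for fixed \<open>x\<close> combine to the square modulus of
  \<open>sphere_ext u x\<close>. The form thereby takes the shape of a potential energy and can be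
  compared with that of a function with frequencies in the shell.\<close>

lemma num_eq:
  assumes u: "u \<in> L2 sphere_measure"
  shows "num u = (LINT x|lborel. V x * (cmod (sphere_ext u x))\<^sup>2)"
proof -
  have [measurable]: "u \<in> borel_measurable sphere_measure" using u by (simp add: L2_iff)
  note iu = L2_integrable[OF u]
  let ?c = "complex_of_real fourier_norm"
  let ?k = "sqrt \<mu>"
  let ?F = "\<lambda>z. cnj (u (fst z)) * u (snd z)"
  let ?E = "\<lambda>z x. exp (- \<i> * complex_of_real ((?k *\<^sub>R (fst z - snd z)) \<bullet> x))"
  let ?H = "\<lambda>z x. ?F z * (complex_of_real (V x) * ?E z x)"
  have c: "complex_of_real (1 / (2 * pi) powr (3 / 2)) = ?c" by (simp add: powr_minus_divide)
  interpret S: pair_sigma_finite sphere_measure sphere_measure ..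
  interpret Q: pair_sigma_finite "sphere_measure \<Otimes>\<^sub>M sphere_measure" "lborel :: (real^3) measure"
    by (intro pair_sigma_finite.intro S.sigma_finite_measure_axioms lborel.sigma_finite_measure_axioms)
  have iF: "integrable (sphere_measure \<Otimes>\<^sub>M sphere_measure) ?F"
    by (rule pair_mult_integral(1)[of sphere_measure sphere_measure "\<lambda>x. cnj (u x)" u])
       (use iu sphere_measure.sigma_finite_measure_axioms in auto)
  have iV: "integrable lborel (\<lambda>x. complex_of_real (V x))" using V_integrable by simp
  have "integrable ((sphere_measure \<Otimes>\<^sub>M sphere_measure) \<Otimes>\<^sub>M lborel) (\<lambda>y. ?F (fst y) * complex_of_real (V (snd y)))"
    by (rule pair_mult_integral(1)[OF S.sigma_finite_measure_axioms lborel.sigma_finite_measure_axioms iF iV])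
  then have "integrable ((sphere_measure \<Otimes>\<^sub>M sphere_measure) \<Otimes>\<^sub>M lborel) (\<lambda>y. ?F (fst y) * complex_of_real (V (snd y)) * ?E (fst y) (snd y))"
  proof (rule integrable_mult_unimodular)
    have m1: "(\<lambda>y. fst (fst y)) \<in> (sphere_measure \<Otimes>\<^sub>M sphere_measure) \<Otimes>\<^sub>M (lborel :: (real^3) measure) \<rightarrow>\<^sub>M borel"
      by (rule measurable_compose[OF measurable_fst measurable_sphere_fst])
    have m2: "(\<lambda>y. snd (fst y)) \<in> (sphere_measure \<Otimes>\<^sub>M sphere_measure) \<Otimes>\<^sub>M (lborel :: (real^3) measure) \<rightarrow>\<^sub>M borel"
      by (rule measurable_compose[OF measurable_fst measurable_sphere_snd])
    have m3: "snd \<in> (sphere_measure \<Otimes>\<^sub>M sphere_measure) \<Otimes>\<^sub>M (lborel :: (real^3) measure) \<rightarrow>\<^sub>M borel"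
      using measurable_snd by simp
    show "(\<lambda>y. ?E (fst y) (snd y)) \<in> borel_measurable ((sphere_measure \<Otimes>\<^sub>M sphere_measure) \<Otimes>\<^sub>M lborel)"
    proof -
      have "(\<lambda>y. (?k *\<^sub>R (fst (fst y) - snd (fst y))) \<bullet> snd y) \<in> borel_measurable ((sphere_measure \<Otimes>\<^sub>M sphere_measure) \<Otimes>\<^sub>M lborel)"
        by (rule borel_measurable_inner[OF borel_measurable_scaleR[OF borel_measurable_const borel_measurable_diff[OF m1 m2]] m3])
      then show ?thesis by (rule measurable_compose[where g = "\<lambda>t. exp (- \<i> * complex_of_real t)"]) measurable
    qed
  qed auto
  then have iH: "integrable ((sphere_measure \<Otimes>\<^sub>M sphere_measure) \<Otimes>\<^sub>M lborel) (\<lambda>(z, x). ?H z x)"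
    by (simp add: split_beta' mult.assoc)
  \<comment> \<open>The phase splits into a factor for each of the two points, so the double
    integral is a number times its conjugate.\<close>
  have inner: "(LINT z|(sphere_measure \<Otimes>\<^sub>M sphere_measure). ?H z x) * ?c\<^sup>2 = complex_of_real (V x * (cmod (sphere_ext u x))\<^sup>2)" for x
  proof -
    let ?a = "\<lambda>w. u w * iexp (?k * (w \<bullet> x))"
    have a: "integrable sphere_measure ?a"
      by (rule integrable_mult_unimodular[OF iu sphere_exp_measurable]) simp
    have "?H z x = complex_of_real (V x) * (cnj (?a (fst z)) * ?a (snd z))" for z
      by (simp add: exp_cnj exp_add[symmetric] exp_diff exp_minus inner_diff_left algebra_simps divide_simps)
    then have "(LINT z|(sphere_measure \<Otimes>\<^sub>M sphere_measure). ?H z x) =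
       complex_of_real (V x) * (LINT z|(sphere_measure \<Otimes>\<^sub>M sphere_measure). cnj (?a (fst z)) * ?a (snd z))"
      by (simp only: integral_mult_right_zero)
    also have "(LINT z|(sphere_measure \<Otimes>\<^sub>M sphere_measure). cnj (?a (fst z)) * ?a (snd z)) =
       (LINT w|sphere_measure. cnj (?a w)) * (LINT w|sphere_measure. ?a w)"
      by (rule pair_mult_integral(2)[of sphere_measure sphere_measure "\<lambda>w. cnj (?a w)" ?a])
         (use a sphere_measure.sigma_finite_measure_axioms in \<open>auto simp del: complex_cnj_mult\<close>)
    also have "\<dots> = complex_of_real ((cmod (LINT w|sphere_measure. ?a w))\<^sup>2)"
      unfolding Bochner_Integration.integral_cnj complex_norm_square by (rule mult.commute)
    finally show ?thesis
      by (simp add: sphere_ext_def norm_mult power_mult_distrib mult_ac)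
  qed
  have "ip sphere_measure u (sphere_op \<mu> V u) = (LINT p|sphere_measure. LINT q|sphere_measure. ?F (p, q) * kern p q)"
    unfolding ip_def A_eq integral_mult_right_zero[symmetric] by (simp add: mult_ac)
  also have "\<dots> = (LINT z|(sphere_measure \<Otimes>\<^sub>M sphere_measure). ?F z * kern (fst z) (snd z))"
  proof -
    let ?B = "1 / (2 * pi) powr (3 / 2) * (fourier_norm * (LINT x|lborel. \<bar>V x\<bar>))"
    have "integrable (sphere_measure \<Otimes>\<^sub>M sphere_measure) (\<lambda>z. ?F z * kern (fst z) (snd z))"
    proof (rule Bochner_Integration.integrable_bound[OF integrable_mult_right[OF integrable_norm[OF iF], of ?B]])
      show "(\<lambda>z. ?F z * kern (fst z) (snd z)) \<in> borel_measurable (sphere_measure \<Otimes>\<^sub>M sphere_measure)"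
        using iF kern_measurable by (intro borel_measurable_times) (auto simp: split_beta')
      have "cmod (?F z * kern (fst z) (snd z)) \<le> ?B * cmod (?F z)" for z
        unfolding norm_mult[of "?F z"] mult.commute[of "cmod (?F z)"] by (intro mult_right_mono kern_bound) auto
      then show "AE z in sphere_measure \<Otimes>\<^sub>M sphere_measure. cmod (?F z * kern (fst z) (snd z)) \<le> norm (?B * cmod (?F z))"
        using abs_ge_self order_trans by (intro AE_I2) (auto simp del: norm_mult abs_mult)
    qed
    from S.integral_fst'[OF this] show ?thesis by simp
  qed
  also have "\<dots> = (LINT z|(sphere_measure \<Otimes>\<^sub>M sphere_measure). ?c\<^sup>2 * (LINT x|lborel. ?H z x))"
  proof (intro Bochner_Integration.integral_cong refl)
    fix z :: "(real^3) \<times> (real^3)"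
    have "kern (fst z) (snd z) = ?c * (?c * (LINT x|lborel. complex_of_real (V x) * ?E z x))"
      unfolding kern_def c by (subst fourier_lborel) auto
    moreover have "(LINT x|lborel. ?H z x) = ?F z * (LINT x|lborel. complex_of_real (V x) * ?E z x)"
      by (rule integral_mult_right_zero)
    ultimately show "?F z * kern (fst z) (snd z) = ?c\<^sup>2 * (LINT x|lborel. ?H z x)"
      by (simp only: power2_eq_square mult_ac)
  qed
  also have "\<dots> = ?c\<^sup>2 * (LINT z|(sphere_measure \<Otimes>\<^sub>M sphere_measure). LINT x|lborel. ?H z x)"
    by (rule integral_mult_right_zero)
  also have "(LINT z|(sphere_measure \<Otimes>\<^sub>M sphere_measure). LINT x|lborel. ?H z x) = (LINT x|lborel. LINT z|(sphere_measure \<Otimes>\<^sub>M sphere_measure). ?H z x)"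
    by (rule Q.Fubini_integral[OF iH, symmetric])
  also have "?c\<^sup>2 * \<dots> = (LINT x|lborel. complex_of_real (V x * (cmod (sphere_ext u x))\<^sup>2))"
    unfolding inner[symmetric] integral_mult_left_zero by (rule mult.commute)
  also have "\<dots> = complex_of_real (LINT x|lborel. V x * (cmod (sphere_ext u x))\<^sup>2)"
    by (rule integral_complex_of_real)
  finally show ?thesis by (simp add: num_def)
qed

text \<open>The phase error on a shell of half-width \<open>d\<close>, averaged with
  \<open>\<bar>V\<bar>\<close>. The factor 2 comes from \<open>\<bar>a\<^sup>2 - b\<^sup>2\<bar>
  \<le> \<bar>a - b\<bar> * (a + b)\<close>, where both moduli are at most
  \<open>fourier_norm\<close> times the L1 norm of the transform.\<close>

definition shell_error :: "real \<Rightarrow> real"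
  where "shell_error d = 2 * fourier_norm\<^sup>2 * (LINT x|lborel. \<bar>V x\<bar> * min 2 (d * norm x))"

lemma shell_error_integrable:
  "d \<ge> 0 \<Longrightarrow> integrable lborel (\<lambda>x. \<bar>V x\<bar> * min 2 (d * norm x))"
  by (rule Bochner_Integration.integrable_bound[of lborel "\<lambda>x. 2 * \<bar>V x\<bar>"])
     (use V_integrable in \<open>auto simp: abs_mult mult.commute[of "\<bar>V _\<bar>"] intro!: mult_right_mono\<close>)

text \<open>Dominated convergence along a sequence of widths, with \<open>2 * \<bar>V\<bar>\<close>
  as bound; monotonicity in \<open>d\<close> extends the estimate to all smaller widths.\<close>

lemma shell_error_small:
  assumes "e > 0" obtains d0 where "d0 > 0" "\<And>d. 0 \<le> d \<Longrightarrow> d \<le> d0 \<Longrightarrow> shell_error d < e"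
proof -
  define s where "s n = 1 / real (Suc n)" for n
  have s: "s n > 0" for n by (simp add: s_def)
  have s0: "s \<longlonglongrightarrow> 0" unfolding s_def using LIMSEQ_inverse_real_of_nat by (simp add: inverse_eq_divide)
  have "(\<lambda>n. LINT x|lborel. \<bar>V x\<bar> * min 2 (s n * norm x)) \<longlonglongrightarrow> (LINT (x::real^3)|lborel. 0)"
  proof (rule integral_dominated_convergence[where w = "\<lambda>x. 2 * \<bar>V x\<bar>"])
    show "AE x in lborel. (\<lambda>n. \<bar>V x\<bar> * min 2 (s n * norm x)) \<longlonglongrightarrow> 0"
    proof (rule AE_I2)
      fix x
      have "(\<lambda>n. \<bar>V x\<bar> * min 2 (s n * norm x)) \<longlonglongrightarrow> \<bar>V x\<bar> * min 2 (0 * norm x)"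
        by (intro tendsto_intros s0)
      then show "(\<lambda>n. \<bar>V x\<bar> * min 2 (s n * norm x)) \<longlonglongrightarrow> 0" by simp
    qed
    show "AE x in lborel. norm (\<bar>V x\<bar> * min 2 (s n * norm x)) \<le> 2 * \<bar>V x\<bar>" for n
      using s[of n] by (auto simp: abs_mult mult.commute[of "\<bar>V _\<bar>"] intro!: mult_right_mono)
  qed (use V_integrable in auto)
  then have "(\<lambda>n. shell_error (s n)) \<longlonglongrightarrow> 2 * fourier_norm\<^sup>2 * 0"
    unfolding shell_error_def by (intro tendsto_intros) simp
  then have "(\<lambda>n. shell_error (s n)) \<longlonglongrightarrow> 0" by simp
  from order_tendstoD(2)[OF this assms] obtain n where n: "shell_error (s n) < e"
    using eventually_happens'[OF sequentially_bot] by blast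
  have "shell_error d < e" if d: "0 \<le> d" "d \<le> s n" for d
  proof -
    have "(LINT x|lborel. \<bar>V x\<bar> * min 2 (d * norm x)) \<le> (LINT x|lborel. \<bar>V x\<bar> * min 2 (s n * norm x))"
      using d s[of n] by (intro integral_mono shell_error_integrable mult_left_mono min.mono mult_right_mono) auto
    then have "shell_error d \<le> shell_error (s n)" unfolding shell_error_def by (intro mult_left_mono) auto
    then show ?thesis using n by linarith
  qed
  then show ?thesis using that s by blast
qed

text \<open>On a thin shell the phase \<open>p \<bullet> x\<close> may be replaced by its value at the radial projection
  of \<open>p\<close> to the sphere of radius \<open>sqrt \<mu>\<close>; the error is controlled since \<open>V\<close> is integrable.\<close>

lemma shell_estimate:
  assumes g: "integrable lborel g" and supp: "\<And>p. \<not> \<bar>norm p - sqrt \<mu>\<bar> < d \<Longrightarrow> g p = 0" and d: "d \<ge> 0"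
    and fib: "fiber_integral g \<in> L2 sphere_measure"
  shows "integrable lborel (\<lambda>x. V x * (cmod (inv_fourier g x))\<^sup>2)"
    and "\<bar>(LINT x|lborel. V x * (cmod (inv_fourier g x))\<^sup>2) - num (fiber_integral g)\<bar> \<le>
      shell_error d * (LINT p|lborel. cmod (g p))\<^sup>2"
proof -
  have [measurable]: "g \<in> borel_measurable borel" using g by auto
  let ?G = "LINT p|lborel. cmod (g p)"
  let ?c = "fourier_norm"
  define \<phi> where "\<phi> = inv_fourier g"
  define \<phi>0 where "\<phi>0 = sphere_ext (fiber_integral g)"
  have [measurable]: "\<phi> \<in> borel_measurable borel" "\<phi>0 \<in> borel_measurable borel"
    unfolding \<phi>_def \<phi>0_def using fib by (auto intro!: sphere_ext_measurable simp: L2_iff)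
  have \<phi>: "\<phi> x = complex_of_real ?c * (LINT p|lborel. g p * iexp (p \<bullet> x))" for x
    unfolding \<phi>_def by (rule inv_fourier_lborel) measurable
  \<comment> \<open>Back on frequency space, \<open>\<phi>0\<close> differs from
    \<open>\<phi>\<close> only in the phase, where \<open>norm p\<close> is replaced by
    \<open>sqrt \<mu>\<close>.\<close>
  have \<phi>0: "\<phi>0 x = complex_of_real ?c * (LINT p|lborel. g p * iexp (sqrt \<mu> * (direction p \<bullet> x)))" for x
    unfolding \<phi>0_def sphere_ext_def
    by (subst fiber_integral_pairing[OF g]) (auto intro: measurable_restrict_space1)
  have i1: "integrable lborel (\<lambda>p. g p * iexp (p \<bullet> x))" for x
    using g by (rule integrable_mult_unimodular) auto
  have i2: "integrable lborel (\<lambda>p. g p * iexp (sqrt \<mu> * (direction p \<bullet> x)))" for x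
    using g by (rule integrable_mult_unimodular) auto
  have b1: "cmod (\<phi> x) \<le> ?c * ?G" for x
    unfolding \<phi>_def inv_fourier_def by (rule fourier_bound[OF g])
  have b2: "cmod (\<phi>0 x) \<le> ?c * ?G" for x
    using integral_norm_bound[of lborel "\<lambda>p. g p * iexp (sqrt \<mu> * (direction p \<bullet> x))"]
    by (simp add: \<phi>0 norm_mult mult_left_mono)
  have diff: "cmod (\<phi> x - \<phi>0 x) \<le> ?c * (?G * min 2 (d * norm x))" for x
  proof -
    have "cmod (LINT p|lborel. g p * iexp (p \<bullet> x) - g p * iexp (sqrt \<mu> * (direction p \<bullet> x))) \<le>
       (LINT p|lborel. cmod (g p) * min 2 (d * norm x))"
    proof (rule order_trans[OF integral_norm_bound integral_mono])
      show "integrable lborel (\<lambda>p. norm (g p * iexp (p \<bullet> x) - g p * iexp (sqrt \<mu> * (direction p \<bullet> x))))"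
        using i1 i2 by auto
      show "integrable lborel (\<lambda>p. cmod (g p) * min 2 (d * norm x))" using g by auto
      fix p :: "real^3"
      show "norm (g p * iexp (p \<bullet> x) - g p * iexp (sqrt \<mu> * (direction p \<bullet> x))) \<le> cmod (g p) * min 2 (d * norm x)"
      proof (cases "\<bar>norm p - sqrt \<mu>\<bar> < d")
        case True
        have "p \<bullet> x = norm p * (direction p \<bullet> x)"
          by (metis direction_decompose inner_scaleR_left)
        then have "\<bar>p \<bullet> x - sqrt \<mu> * (direction p \<bullet> x)\<bar> = \<bar>norm p - sqrt \<mu>\<bar> * \<bar>direction p \<bullet> x\<bar>"
          by (simp add: abs_mult[symmetric] left_diff_distrib)
        also have "\<dots> \<le> d * norm x"
          using True d Cauchy_Schwarz_ineq2[of "direction p" x] by (intro mult_mono) auto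
        finally have "min 2 \<bar>p \<bullet> x - sqrt \<mu> * (direction p \<bullet> x)\<bar> \<le> min 2 (d * norm x)" by simp
        then have "cmod (iexp (p \<bullet> x) - iexp (sqrt \<mu> * (direction p \<bullet> x))) \<le> min 2 (d * norm x)"
          using iexp_diff_le[of "p \<bullet> x" "sqrt \<mu> * (direction p \<bullet> x)"] by linarith
        then show ?thesis unfolding right_diff_distrib[symmetric] norm_mult by (intro mult_left_mono) auto
      qed (simp add: supp)
    qed
    then have "cmod ((LINT p|lborel. g p * iexp (p \<bullet> x)) - (LINT p|lborel. g p * iexp (sqrt \<mu> * (direction p \<bullet> x)))) \<le> ?G * min 2 (d * norm x)"
      using i1 i2 by simp
    then have "?c * cmod ((LINT p|lborel. g p * iexp (p \<bullet> x)) - (LINT p|lborel. g p * iexp (sqrt \<mu> * (direction p \<bullet> x)))) \<le> ?c * (?G * min 2 (d * norm x))"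
      by (rule mult_left_mono) simp
    then show ?thesis unfolding \<phi> \<phi>0 right_diff_distrib[symmetric] norm_mult by simp
  qed
  have bounded: "integrable lborel (\<lambda>x. V x * (cmod (h x))\<^sup>2)"
    if [measurable]: "h \<in> borel_measurable borel" and b: "\<And>x. cmod (h x) \<le> ?c * ?G" for h :: "real^3 \<Rightarrow> complex"
  proof (rule Bochner_Integration.integrable_bound[of lborel "\<lambda>x. (?c * ?G)\<^sup>2 * V x"])
    show "AE x in lborel. norm (V x * (cmod (h x))\<^sup>2) \<le> norm ((?c * ?G)\<^sup>2 * V x)"
    proof (rule AE_I2)
      fix x
      have "(cmod (h x))\<^sup>2 \<le> (?c * ?G)\<^sup>2" by (intro power_mono b) auto
      then have "\<bar>V x\<bar> * (cmod (h x))\<^sup>2 \<le> \<bar>V x\<bar> * (?c * ?G)\<^sup>2" by (intro mult_left_mono) auto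
      then show "norm (V x * (cmod (h x))\<^sup>2) \<le> norm ((?c * ?G)\<^sup>2 * V x)" by (simp add: abs_mult mult.commute)
    qed
  qed (use V_integrable in auto)
  show int: "integrable lborel (\<lambda>x. V x * (cmod (inv_fourier g x))\<^sup>2)"
    using bounded[of \<phi>] b1 unfolding \<phi>_def by simp
  have int0: "integrable lborel (\<lambda>x. V x * (cmod (\<phi>0 x))\<^sup>2)" by (rule bounded) (use b2 in auto)
  have "\<bar>(LINT x|lborel. V x * (cmod (\<phi> x))\<^sup>2) - (LINT x|lborel. V x * (cmod (\<phi>0 x))\<^sup>2)\<bar> =
     \<bar>LINT x|lborel. V x * (cmod (\<phi> x))\<^sup>2 - V x * (cmod (\<phi>0 x))\<^sup>2\<bar>"
    using int int0 unfolding \<phi>_def by simp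
  also have "\<dots> \<le> (LINT x|lborel. 2 * ?c\<^sup>2 * ?G\<^sup>2 * (\<bar>V x\<bar> * min 2 (d * norm x)))"
  proof (rule order_trans[OF integral_abs_bound integral_mono])
    show "integrable lborel (\<lambda>x. \<bar>V x * (cmod (\<phi> x))\<^sup>2 - V x * (cmod (\<phi>0 x))\<^sup>2\<bar>)"
      using int int0 unfolding \<phi>_def by auto
    show "integrable lborel (\<lambda>x. 2 * ?c\<^sup>2 * ?G\<^sup>2 * (\<bar>V x\<bar> * min 2 (d * norm x)))"
      by (intro integrable_mult_right shell_error_integrable d)
    fix x
    have "\<bar>(cmod (\<phi> x))\<^sup>2 - (cmod (\<phi>0 x))\<^sup>2\<bar> = \<bar>cmod (\<phi> x) - cmod (\<phi>0 x)\<bar> * (cmod (\<phi> x) + cmod (\<phi>0 x))"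
      by (simp add: power2_eq_square square_diff_square_factored abs_mult mult.commute)
    also have "\<dots> \<le> cmod (\<phi> x - \<phi>0 x) * (?c * ?G + ?c * ?G)"
      using b1[of x] b2[of x] by (intro mult_mono norm_triangle_ineq3 add_mono) auto
    also have "\<dots> \<le> ?c * (?G * min 2 (d * norm x)) * (?c * ?G + ?c * ?G)"
      by (intro mult_right_mono diff) auto
    also have "\<dots> = 2 * ?c\<^sup>2 * ?G\<^sup>2 * min 2 (d * norm x)" by (simp only: power2_eq_square) (simp only: mult_2 algebra_simps)
    finally have "\<bar>V x\<bar> * \<bar>(cmod (\<phi> x))\<^sup>2 - (cmod (\<phi>0 x))\<^sup>2\<bar> \<le> \<bar>V x\<bar> * (2 * ?c\<^sup>2 * ?G\<^sup>2 * min 2 (d * norm x))"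
      by (rule mult_left_mono) simp
    then show "\<bar>V x * (cmod (\<phi> x))\<^sup>2 - V x * (cmod (\<phi>0 x))\<^sup>2\<bar> \<le> 2 * ?c\<^sup>2 * ?G\<^sup>2 * (\<bar>V x\<bar> * min 2 (d * norm x))"
      unfolding right_diff_distrib[symmetric] abs_mult[of "V x"] by (simp only: mult_ac)
  qed
  also have "\<dots> = shell_error d * ?G\<^sup>2" unfolding shell_error_def by simp
  finally show "\<bar>(LINT x|lborel. V x * (cmod (inv_fourier g x))\<^sup>2) - num (fiber_integral g)\<bar> \<le> shell_error d * ?G\<^sup>2"
    unfolding num_eq[OF fib] \<phi>_def \<phi>0_def .
qed

end

section \<open>The kinetic energy near the sphere\<close>

text \<open>The derivative of the difference is \<open>tanh x ^ 2\<close>.\<close>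

lemma tanh_le_self:
  fixes y :: real assumes "y \<ge> 0" shows "tanh y \<le> y"
proof -
  have "0 - tanh 0 \<le> y - tanh y"
  proof (rule DERIV_nonneg_imp_nondecreasing[OF assms])
    fix x :: real
    have "((\<lambda>y. y - tanh y) has_real_derivative 1 - (1 - tanh x ^ 2)) (at x)"
      by (auto intro!: derivative_eq_intros)
    then show "\<exists>z. ((\<lambda>y. y - tanh y) has_real_derivative z) (at x) \<and> 0 \<le> z" by (intro exI conjI) auto
  qed
  then show ?thesis by simp
qed

definition K_energy :: "real \<Rightarrow> real \<Rightarrow> real"
  where "K_energy T s = (if s = 0 then 2 * T else s / tanh (s / (2 * T)))"

lemma K_energy_abs: "K_energy T \<bar>s\<bar> = K_energy T s"
  by (auto simp: K_energy_def abs_if)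

text \<open>The lower bounds come from \<open>tanh y \<le> y\<close> and \<open>tanh y < 1\<close>.
  The last part is a converse outside the thermal window \<open>\<bar>s\<bar> < L * T\<close>, with
  a constant that tends to 1 as \<open>L\<close> grows.\<close>

lemma K_energy_bounds:
  assumes T: "T > 0"
  shows "2 * T \<le> K_energy T s" "\<bar>s\<bar> \<le> K_energy T s"
    "L > 0 \<Longrightarrow> L * T \<le> \<bar>s\<bar> \<Longrightarrow> K_energy T s \<le> \<bar>s\<bar> / tanh (L / 2)"
proof -
  have *: "2 * T \<le> K_energy T s \<and> s \<le> K_energy T s" if "s > 0" for s
  proof -
    have t: "0 < tanh (s / (2 * T))" "tanh (s / (2 * T)) < 1" "tanh (s / (2 * T)) \<le> s / (2 * T)"
      using that T tanh_le_self[of "s / (2 * T)"] by (auto simp: tanh_real_lt_1)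
    have "2 * T * tanh (s / (2 * T)) \<le> s" using t(3) T by (simp add: field_simps)
    moreover have "s * tanh (s / (2 * T)) \<le> s * 1" using that t by (intro mult_left_mono) auto
    ultimately show ?thesis using that t by (simp add: K_energy_def pos_le_divide_eq)
  qed
  show "2 * T \<le> K_energy T s"
    using *[of "\<bar>s\<bar>"] by (cases "s = 0") (auto simp: K_energy_abs, simp add: K_energy_def)
  then show "\<bar>s\<bar> \<le> K_energy T s"
    using *[of "\<bar>s\<bar>"] T by (cases "s = 0") (auto simp: K_energy_abs)
  show "K_energy T s \<le> \<bar>s\<bar> / tanh (L / 2)" if "L > 0" "L * T \<le> \<bar>s\<bar>"
  proof -
    have p: "\<bar>s\<bar> > 0" using that T by (smt (verit) mult_pos_pos)
    have "L / 2 \<le> \<bar>s\<bar> / (2 * T)" using that T by (simp add: field_simps)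
    then have "tanh (L / 2) \<le> tanh (\<bar>s\<bar> / (2 * T))" by simp
    then have "\<bar>s\<bar> / tanh (\<bar>s\<bar> / (2 * T)) \<le> \<bar>s\<bar> / tanh (L / 2)"
      using that p by (intro divide_left_mono mult_pos_pos) (auto intro: less_le_trans)
    moreover have "K_energy T \<bar>s\<bar> = \<bar>s\<bar> / tanh (\<bar>s\<bar> / (2 * T))" using p by (simp add: K_energy_def)
    ultimately show ?thesis by (simp add: K_energy_abs)
  qed
qed

definition K_radial :: "real \<Rightarrow> real \<Rightarrow> real \<Rightarrow> real"
  where "K_radial \<mu> T r = K_energy T (r\<^sup>2 - \<mu>)"

lemma K_symbol_eq: "K_symbol \<mu> T p = K_radial \<mu> T (norm p)"
  by (simp add: K_symbol_def K_radial_def K_energy_def)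

lemma K_radial_measurable [measurable]: "K_radial \<mu> T \<in> borel_measurable borel"
proof -
  have [measurable]: "(tanh :: real \<Rightarrow> real) \<in> borel_measurable borel"
    by (intro borel_measurable_continuous_onI continuous_intros) auto
  show ?thesis unfolding K_radial_def[abs_def] K_energy_def by measurable
qed

lemma K_radial_pos: "T > 0 \<Longrightarrow> K_radial \<mu> T r > 0"
  using K_energy_bounds(1)[of T "r\<^sup>2 - \<mu>"] by (simp add: K_radial_def)

section \<open>The logarithmic growth of the shell mass\<close>

definition shell :: "real \<Rightarrow> real \<Rightarrow> real set"
  where "shell \<mu> d = {r. \<bar>r - sqrt \<mu>\<bar> \<le> d}"

lemma shell_sets [measurable]: "shell \<mu> d \<in> sets borel"
  unfolding shell_def by measurable

definition shell_mass :: "real \<Rightarrow> real \<Rightarrow> real \<Rightarrow> real"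
  where "shell_mass \<mu> d T = (LINT r|radial_measure. indicator (shell \<mu> d) r / K_radial \<mu> T r)"

lemma sq_diff_sqrt: "\<mu> > 0 \<Longrightarrow> r\<^sup>2 - \<mu> = (r + sqrt \<mu>) * (r - sqrt \<mu>)" for r :: real
  using square_diff_square_factored[of r "sqrt \<mu>"] by (simp add: power2_eq_square)

text \<open>The energy is at least \<open>\<bar>r - sqrt \<mu>\<bar> * (r + sqrt \<mu>)\<close>.
  Above the shell \<open>d * r \<le> (sqrt \<mu> + d) * (r - sqrt \<mu>)\<close>; below it
  \<open>r\<^sup>2 \<le> \<mu>\<close>, while the distance to the sphere exceeds
  \<open>d\<close>.\<close>

lemma K_radial_far:
  assumes mu: "\<mu> > 0" and T: "T > 0" and d: "d > 0" and r: "r \<ge> 0" "r \<notin> shell \<mu> d"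
  shows "d / (sqrt \<mu> + d) * r\<^sup>2 \<le> K_radial \<mu> T r"
proof -
  let ?k = "sqrt \<mu>"
  have k: "?k > 0" "?k\<^sup>2 = \<mu>" using mu by auto
  have "\<bar>r\<^sup>2 - \<mu>\<bar> = \<bar>r - ?k\<bar> * (r + ?k)"
    using r k by (simp add: sq_diff_sqrt[OF mu] abs_mult mult.commute)
  moreover have "d * r\<^sup>2 \<le> (?k + d) * (\<bar>r - ?k\<bar> * (r + ?k))"
  proof (cases "r > ?k")
    case True
    then have "r - ?k > d" using r by (simp add: shell_def)
    then have "?k * d \<le> ?k * (r - ?k)" using k by (intro mult_left_mono) auto
    then have "d * r \<le> (?k + d) * (r - ?k)" by (simp add: algebra_simps)
    then have "d * r * (r + 0) \<le> (?k + d) * (r - ?k) * (r + ?k)"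
    proof (rule mult_mono)
      show "0 \<le> (?k + d) * (r - ?k)" using k d True by (intro mult_nonneg_nonneg) linarith+
      show "r + 0 \<le> r + ?k" "0 \<le> r + 0" using k r(1) by linarith+
    qed
    then show ?thesis using True by (simp add: power2_eq_square mult.assoc)
  next
    case False
    then have dr: "\<bar>r - ?k\<bar> > d" "r \<le> ?k" using r by (auto simp: shell_def)
    have "d * r\<^sup>2 \<le> d * (?k * ?k)" unfolding power2_eq_square using d dr r k(1) by (intro mult_left_mono mult_mono) linarith+
    also have "\<dots> \<le> (?k + d) * (d * (r + ?k))"
    proof -
      have "d * (?k * ?k) \<le> d * ((?k + d) * (r + ?k))" using d k r by (intro mult_left_mono mult_mono) auto
      then show ?thesis by (simp only: mult_ac)
    qed
    also have "\<dots> \<le> (?k + d) * (\<bar>r - ?k\<bar> * (r + ?k))" using d k r dr by (intro mult_left_mono mult_right_mono) auto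
    finally show ?thesis .
  qed
  ultimately have "d * r\<^sup>2 \<le> (?k + d) * \<bar>r\<^sup>2 - \<mu>\<bar>" by simp
  also have "\<dots> \<le> (?k + d) * K_radial \<mu> T r"
    unfolding K_radial_def using k d by (intro mult_left_mono K_energy_bounds(2) T) auto
  finally show ?thesis using k d by (simp add: field_simps add_pos_pos)
qed

lemma nn_integral_log_right:
  assumes "0 < a" "a \<le> b"
  shows "(\<integral>\<^sup>+r. ennreal (1 / (r - k)) * indicator {k + a..k + b} r \<partial>lborel) = ennreal (ln (b / a))"
  by (subst nn_integral_FTC_Icc[where F = "\<lambda>r. ln (r - k)"])
     (use assms in \<open>auto intro!: derivative_eq_intros simp: ln_div\<close>)

lemma nn_integral_log_left:
  assumes "0 < a" "a \<le> b"
  shows "(\<integral>\<^sup>+r. ennreal (1 / (k - r)) * indicator {k - b..k - a} r \<partial>lborel) = ennreal (ln (b / a))"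
  by (subst nn_integral_FTC_Icc[where F = "\<lambda>r. - ln (k - r)"])
     (use assms in \<open>auto intro!: derivative_eq_intros simp: ln_div\<close>)

lemma shell_energy_bounds:
  assumes mu: "\<mu> > 0" and d: "0 < d" "d < sqrt \<mu>" and r: "r \<in> shell \<mu> d"
  shows "(2 * sqrt \<mu> - d) * \<bar>r - sqrt \<mu>\<bar> \<le> \<bar>r\<^sup>2 - \<mu>\<bar>" "\<bar>r\<^sup>2 - \<mu>\<bar> \<le> (2 * sqrt \<mu> + d) * \<bar>r - sqrt \<mu>\<bar>"
    "r > 0" "(sqrt \<mu> - d)\<^sup>2 \<le> r\<^sup>2" "r\<^sup>2 \<le> (sqrt \<mu> + d)\<^sup>2"
proof -
  let ?k = "sqrt \<mu>"
  have k: "?k > 0" "?k\<^sup>2 = \<mu>" using mu by auto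
  have r': "r \<ge> ?k - d" "r \<le> ?k + d" using r by (auto simp: shell_def)
  then show "r > 0" using d by linarith
  have "\<bar>r\<^sup>2 - \<mu>\<bar> = (r + ?k) * \<bar>r - ?k\<bar>"
    using \<open>r > 0\<close> k by (simp add: sq_diff_sqrt[OF mu] abs_mult)
  then show "(2 * ?k - d) * \<bar>r - ?k\<bar> \<le> \<bar>r\<^sup>2 - \<mu>\<bar>" "\<bar>r\<^sup>2 - \<mu>\<bar> \<le> (2 * ?k + d) * \<bar>r - ?k\<bar>"
    using r' by (auto intro!: mult_right_mono)
  show "(?k - d)\<^sup>2 \<le> r\<^sup>2" "r\<^sup>2 \<le> (?k + d)\<^sup>2" using r' d by (auto intro!: power_mono)
qed

text \<open>The window \<open>\<bar>r - sqrt \<mu>\<bar> \<le> T\<close> has length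
  \<open>2 * T\<close> and energy at least \<open>2 * T\<close>, so it contributes a constant; on
  each side of it the energy is at least \<open>2 * sqrt \<mu> - d\<close> times the distance to
  \<open>sqrt \<mu>\<close>, which gives a logarithm.\<close>

lemma shell_mass_nn_le:
  assumes mu: "\<mu> > 0" and d: "0 < d" "d < sqrt \<mu>" and T: "0 < T" "T \<le> d"
  shows "(\<integral>\<^sup>+r. ennreal (indicator (shell \<mu> d) r / K_radial \<mu> T r) \<partial>radial_measure) \<le>
    ennreal ((sqrt \<mu> + d)\<^sup>2 * (1 + 2 / (2 * sqrt \<mu> - d) * ln (d / T)))"
proof -
  let ?k = "sqrt \<mu>" let ?A = "(sqrt \<mu> + d)\<^sup>2" let ?c = "2 * sqrt \<mu> - d"
  have k: "?k > 0" using mu by simp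
  have c: "?c > 0" using k d by linarith
  have ln0: "ln (d / T) \<ge> 0" using T by simp
  have "(\<integral>\<^sup>+r. ennreal (indicator (shell \<mu> d) r / K_radial \<mu> T r) \<partial>radial_measure) =
     (\<integral>\<^sup>+r. ennreal (r\<^sup>2 * indicator {0..} r) * ennreal (indicator (shell \<mu> d) r / K_radial \<mu> T r) \<partial>lborel)"
    by (rule nn_integral_radial) measurable
  \<comment> \<open>The three intervals share only end points, where the right-hand side is merely
    larger.\<close>
  also have "\<dots> \<le> (\<integral>\<^sup>+r. ennreal (?A / (2 * T)) * indicator {?k - T..?k + T} r +
     (ennreal (?A / ?c) * (ennreal (1 / (r - ?k)) * indicator {?k + T..?k + d} r) +
      ennreal (?A / ?c) * (ennreal (1 / (?k - r)) * indicator {?k - d..?k - T} r)) \<partial>lborel)"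
  proof (rule nn_integral_mono)
    fix r
    let ?R = "ennreal (?A / (2 * T)) * indicator {?k - T..?k + T} r +
     (ennreal (?A / ?c) * (ennreal (1 / (r - ?k)) * indicator {?k + T..?k + d} r) +
      ennreal (?A / ?c) * (ennreal (1 / (?k - r)) * indicator {?k - d..?k - T} r))"
    show "ennreal (r\<^sup>2 * indicator {0..} r) * ennreal (indicator (shell \<mu> d) r / K_radial \<mu> T r) \<le> ?R"
    proof (cases "r \<in> shell \<mu> d")
      case True
      note b = shell_energy_bounds[OF mu d True]
      have Kp: "K_radial \<mu> T r > 0" using T by (intro K_radial_pos) auto
      have lhs: "ennreal (r\<^sup>2 * indicator {0..} r) * ennreal (indicator (shell \<mu> d) r / K_radial \<mu> T r) = ennreal (r\<^sup>2 / K_radial \<mu> T r)"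
        using True b(3) Kp by (simp add: ennreal_mult[symmetric])
      show ?thesis
      proof (cases "\<bar>r - ?k\<bar> \<le> T")
        case True
        have "r\<^sup>2 / K_radial \<mu> T r \<le> ?A / (2 * T)"
          using b(5) T K_energy_bounds(1)[of T "r\<^sup>2 - \<mu>"] by (intro frac_le) (auto simp: K_radial_def)
        then have "ennreal (r\<^sup>2 / K_radial \<mu> T r) \<le> ennreal (?A / (2 * T)) * indicator {?k - T..?k + T} r"
          using True by (auto simp: abs_le_iff intro: ennreal_leI)
        then show ?thesis unfolding lhs by (rule order_trans) simp
      next
        case False
        then have y: "\<bar>r - ?k\<bar> > 0" using T by linarith
        have "?c * \<bar>r - ?k\<bar> \<le> K_radial \<mu> T r"
          using order_trans[OF b(1) K_energy_bounds(2)[OF T(1)]] by (simp add: K_radial_def)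
        then have le: "r\<^sup>2 / K_radial \<mu> T r \<le> ?A / (?c * \<bar>r - ?k\<bar>)"
          using b(5) y c by (intro frac_le mult_pos_pos) auto
        show ?thesis
        proof (cases "r > ?k")
          case r: True
          then have "indicator {?k + T..?k + d} r = (1::ennreal)" using False True by (auto simp: shell_def)
          moreover have "?A / (?c * \<bar>r - ?k\<bar>) = ?A / ?c * (1 / (r - ?k))" using r by simp
          ultimately have "ennreal (r\<^sup>2 / K_radial \<mu> T r) \<le> ennreal (?A / ?c) * (ennreal (1 / (r - ?k)) * indicator {?k + T..?k + d} r)"
            using le c r by (simp add: ennreal_mult[symmetric] ennreal_leI)
          then show ?thesis unfolding lhs by (rule order_trans) (simp add: add_increasing)
        next
          case r: False
          then have r2: "r < ?k" using y by auto
          have "indicator {?k - d..?k - T} r = (1::ennreal)" using False True r by (auto simp: shell_def)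
          moreover have "?A / (?c * \<bar>r - ?k\<bar>) = ?A / ?c * (1 / (?k - r))" using r by simp
          ultimately have "ennreal (r\<^sup>2 / K_radial \<mu> T r) \<le> ennreal (?A / ?c) * (ennreal (1 / (?k - r)) * indicator {?k - d..?k - T} r)"
            using le c r2 by (simp add: ennreal_mult[symmetric] ennreal_leI)
          then show ?thesis unfolding lhs by (rule order_trans) (simp add: add_increasing)
        qed
      qed
    qed simp
  qed
  also have "\<dots> = ennreal (?A / (2 * T)) * ennreal (2 * T) +
     (ennreal (?A / ?c) * ennreal (ln (d / T)) + ennreal (?A / ?c) * ennreal (ln (d / T)))"
  proof -
    have m1: "(\<lambda>r. ennreal (1 / (r - ?k)) * indicator {?k + T..?k + d} r) \<in> borel_measurable borel"
      and m2: "(\<lambda>r. ennreal (1 / (?k - r)) * indicator {?k - d..?k - T} r) \<in> borel_measurable borel"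
      by measurable
    have "emeasure lborel {?k - T..?k + T} = ennreal (2 * T)" using T by (simp add: emeasure_lborel_Icc_eq)
    then show ?thesis using m1 m2
      by (simp add: nn_integral_add nn_integral_cmult nn_integral_log_right[OF T] nn_integral_log_left[OF T] nn_integral_cmult_indicator
        del: emeasure_lborel_Icc)
  qed
  also have "\<dots> = ennreal (?A / (2 * T) * (2 * T) + (?A / ?c * ln (d / T) + ?A / ?c * ln (d / T)))"
    using T c ln0 by (simp add: ennreal_mult[symmetric] ennreal_plus[symmetric] del: ennreal_plus)
  also have "?A / (2 * T) * (2 * T) + (?A / ?c * ln (d / T) + ?A / ?c * ln (d / T)) = ?A * (1 + 2 / ?c * ln (d / T))"
    using T by (simp add: distrib_left)
  finally show ?thesis .
qed

lemma shell_mass_integrable: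
  assumes mu: "\<mu> > 0" and d: "0 < d" "d < sqrt \<mu>" and T: "0 < T" "T \<le> d"
  shows "integrable radial_measure (\<lambda>r. indicator (shell \<mu> d) r / K_radial \<mu> T r)"
    "ennreal (shell_mass \<mu> d T) = (\<integral>\<^sup>+r. ennreal (indicator (shell \<mu> d) r / K_radial \<mu> T r) \<partial>radial_measure)"
    "shell_mass \<mu> d T \<le> (sqrt \<mu> + d)\<^sup>2 * (1 + 2 / (2 * sqrt \<mu> - d) * ln (d / T))"
proof -
  have p: "0 \<le> indicator (shell \<mu> d) r / K_radial \<mu> T r" for r
    using K_radial_pos[OF T(1), of \<mu> r] by simp
  show i: "integrable radial_measure (\<lambda>r. indicator (shell \<mu> d) r / K_radial \<mu> T r)"
  proof (rule integrableI_bounded)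
    show "(\<integral>\<^sup>+r. ennreal (norm (indicator (shell \<mu> d) r / K_radial \<mu> T r)) \<partial>radial_measure) < \<infinity>"
      unfolding real_norm_def abs_of_nonneg[OF p] by (rule le_less_trans[OF shell_mass_nn_le[OF assms]]) simp
  qed measurable
  show e: "ennreal (shell_mass \<mu> d T) = (\<integral>\<^sup>+r. ennreal (indicator (shell \<mu> d) r / K_radial \<mu> T r) \<partial>radial_measure)"
    unfolding shell_mass_def by (rule nn_integral_eq_integral[OF i, symmetric]) (use p in auto)
  have "0 \<le> (sqrt \<mu> + d)\<^sup>2 * (1 + 2 / (2 * sqrt \<mu> - d) * ln (d / T))"
    using d T mu by (intro mult_nonneg_nonneg add_nonneg_nonneg) auto
  then show "shell_mass \<mu> d T \<le> (sqrt \<mu> + d)\<^sup>2 * (1 + 2 / (2 * sqrt \<mu> - d) * ln (d / T))"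
    using shell_mass_nn_le[OF assms] unfolding e[symmetric] by simp
qed

text \<open>Beyond the distance \<open>y\<close> from \<open>sqrt \<mu>\<close> one has
  \<open>\<bar>r\<^sup>2 - \<mu>\<bar> \<ge> L * T\<close>, so the energy is at most
  \<open>\<bar>r\<^sup>2 - \<mu>\<bar> / tanh (L / 2)\<close>; the window of half-width
  \<open>y\<close> is dropped.\<close>

lemma shell_mass_ge:
  assumes mu: "\<mu> > 0" and d: "0 < d" "d < sqrt \<mu>" and T: "0 < T" "T \<le> d" and L: "L > 0"
    and y: "y = L * T / (2 * sqrt \<mu> - d)" "y \<le> d"
  shows "(sqrt \<mu> - d)\<^sup>2 * tanh (L / 2) * (2 / (2 * sqrt \<mu> + d)) * ln (d / y) \<le> shell_mass \<mu> d T"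
proof -
  let ?k = "sqrt \<mu>" let ?A = "(sqrt \<mu> - d)\<^sup>2 * tanh (L / 2) / (2 * sqrt \<mu> + d)"
  have k: "?k > 0" using mu by simp
  have c: "2 * ?k - d > 0" "2 * ?k + d > 0" using k d by linarith+
  have y0: "y > 0" using c L T by (simp add: y)
  have ln0: "ln (d / y) \<ge> 0" using y0 y(2) by simp
  have A0: "?A \<ge> 0" using L c by simp
  have "ennreal (?A * ln (d / y) + ?A * ln (d / y)) = ennreal ?A * ennreal (ln (d / y)) + ennreal ?A * ennreal (ln (d / y))"
    using A0 ln0 by (simp only: ennreal_mult ennreal_plus mult_nonneg_nonneg)
  also have "\<dots> = (\<integral>\<^sup>+r. ennreal ?A * (ennreal (1 / (r - ?k)) * indicator {?k + y..?k + d} r) +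
      ennreal ?A * (ennreal (1 / (?k - r)) * indicator {?k - d..?k - y} r) \<partial>lborel)"
  proof -
    have m1: "(\<lambda>r. ennreal (1 / (r - ?k)) * indicator {?k + y..?k + d} r) \<in> borel_measurable borel"
      and m2: "(\<lambda>r. ennreal (1 / (?k - r)) * indicator {?k - d..?k - y} r) \<in> borel_measurable borel"
      by measurable
    then show ?thesis
      by (simp add: nn_integral_add nn_integral_cmult nn_integral_log_right[OF y0 y(2)] nn_integral_log_left[OF y0 y(2)])
  qed
  also have "\<dots> \<le> (\<integral>\<^sup>+r. ennreal (r\<^sup>2 * indicator {0..} r) * ennreal (indicator (shell \<mu> d) r / K_radial \<mu> T r) \<partial>lborel)"
  proof (rule nn_integral_mono)
    fix r
    let ?R = "ennreal (r\<^sup>2 * indicator {0..} r) * ennreal (indicator (shell \<mu> d) r / K_radial \<mu> T r)"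
    have main: "ennreal (?A * (1 / \<bar>r - ?k\<bar>)) \<le> ?R" if yr: "y \<le> \<bar>r - ?k\<bar>" "\<bar>r - ?k\<bar> \<le> d"
    proof -
      have sh: "r \<in> shell \<mu> d" using yr by (simp add: shell_def)
      note b = shell_energy_bounds[OF mu d sh]
      have Kp: "K_radial \<mu> T r > 0" using T by (intro K_radial_pos) auto
      have th: "tanh (L / 2) > 0" using L by simp
      have "L * T = (2 * ?k - d) * y" using c by (simp add: y)
      also have "\<dots> \<le> (2 * ?k - d) * \<bar>r - ?k\<bar>" using c yr by (intro mult_left_mono) auto
      also have "\<dots> \<le> \<bar>r\<^sup>2 - \<mu>\<bar>" by (rule b(1))
      finally have "K_radial \<mu> T r \<le> \<bar>r\<^sup>2 - \<mu>\<bar> / tanh (L / 2)"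
        unfolding K_radial_def by (rule K_energy_bounds(3)[OF T(1) L])
      also have "\<dots> \<le> (2 * ?k + d) * \<bar>r - ?k\<bar> / tanh (L / 2)" using th b(2) by (intro divide_right_mono) auto
      finally have "(?k - d)\<^sup>2 / ((2 * ?k + d) * \<bar>r - ?k\<bar> / tanh (L / 2)) \<le> r\<^sup>2 / K_radial \<mu> T r"
        using b(4) Kp by (intro frac_le) auto
      moreover have "(?k - d)\<^sup>2 / ((2 * ?k + d) * \<bar>r - ?k\<bar> / tanh (L / 2)) = ?A * (1 / \<bar>r - ?k\<bar>)" by simp
      moreover have "?R = ennreal (r\<^sup>2 / K_radial \<mu> T r)"
        using sh b(3) Kp by (simp add: ennreal_mult[symmetric])
      ultimately show ?thesis by (simp add: ennreal_leI)
    qed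
    consider "r \<in> {?k + y..?k + d}" | "r \<in> {?k - d..?k - y}" | "r \<notin> {?k + y..?k + d} \<union> {?k - d..?k - y}" by blast
    then show "ennreal ?A * (ennreal (1 / (r - ?k)) * indicator {?k + y..?k + d} r) +
      ennreal ?A * (ennreal (1 / (?k - r)) * indicator {?k - d..?k - y} r) \<le> ?R"
    proof cases
      case 1
      then have "r \<notin> {?k - d..?k - y}" "\<bar>r - ?k\<bar> = r - ?k" using y0 by auto
      then show ?thesis using main 1 A0 by (simp add: ennreal_mult[symmetric])
    next
      case 2
      then have "r \<notin> {?k + y..?k + d}" "\<bar>r - ?k\<bar> = ?k - r" using y0 by auto
      then show ?thesis using main 2 A0 by (simp add: ennreal_mult[symmetric])
    qed simp
  qed
  also have "\<dots> = ennreal (shell_mass \<mu> d T)"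
    unfolding shell_mass_integrable(2)[OF mu d T] by (rule nn_integral_radial[symmetric]) measurable
  finally have "?A * ln (d / y) + ?A * ln (d / y) \<le> shell_mass \<mu> d T"
  proof (subst (asm) ennreal_le_iff)
    show "0 \<le> shell_mass \<mu> d T"
      unfolding shell_mass_def using K_radial_pos[OF T(1)] by (intro integral_nonneg_AE AE_I2) (simp add: less_imp_le)
  qed
  then show ?thesis by (simp add: mult_ac)
qed

text \<open>Up to additive constants both bounds are multiples of \<open>ln (1 / T)\<close>. The
  hypotheses \<open>up\<close> and \<open>lo\<close> leave a strict margin in the coefficients,
  which absorbs the constants for small \<open>T\<close>; \<open>L\<close> is fixed beforehand, so
  large that \<open>tanh (L / 2)\<close> does not use up the margin from below.\<close>

lemma shell_mass_asymp:
  assumes mu: "\<mu> > 0" and d: "0 < d" "d < sqrt \<mu>"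
    and up: "2 * (sqrt \<mu> + d)\<^sup>2 / (2 * sqrt \<mu> - d) < sqrt \<mu> + e"
    and lo: "sqrt \<mu> - e < 2 * (sqrt \<mu> - d)\<^sup>2 / (2 * sqrt \<mu> + d)"
  shows "\<forall>\<^sub>F T in at_right 0. (sqrt \<mu> - e) * ln (1 / T) \<le> shell_mass \<mu> d T \<and> shell_mass \<mu> d T \<le> (sqrt \<mu> + e) * ln (1 / T)"
proof -
  let ?k = "sqrt \<mu>"
  let ?a = "2 * (?k + d)\<^sup>2 / (2 * ?k - d)" and ?b = "2 * (?k - d)\<^sup>2 / (2 * ?k + d)"
  have k: "?k > 0" using mu by simp
  have c: "2 * ?k - d > 0" "2 * ?k + d > 0" using k d by linarith+
  have lnT: "filterlim (\<lambda>T::real. ln (1 / T)) at_top (at_right 0)" by real_asymp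
  have "((\<lambda>L. ?b * tanh (L / 2)) \<longlongrightarrow> ?b * 1) at_top"
    by (intro tendsto_intros filterlim_compose[OF tanh_real_at_top]) real_asymp
  then have "\<forall>\<^sub>F L in at_top. ?k - e < ?b * tanh (L / 2)" using lo by (intro order_tendstoD) auto
  then have "\<forall>\<^sub>F L in at_top. ?k - e < ?b * tanh (L / 2) \<and> L > 0"
    using eventually_gt_at_top[of "0::real"] by eventually_elim auto
  then obtain L where L: "?k - e < ?b * tanh (L / 2)" "L > 0"
    using eventually_happens' trivial_limit_at_top_linorder by blast
  let ?b' = "?b * tanh (L / 2)"
  \<comment> \<open>The thresholds in \<open>ev1\<close> and \<open>ev2\<close> solve the linear
    inequalities for \<open>ln (1 / T)\<close> that remain below; the second bound on
    \<open>T\<close> in \<open>ev3\<close> ensures \<open>y \<le> d\<close>.\<close>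
  have ev1: "\<forall>\<^sub>F T in at_right 0. ln (1 / T) \<ge> ((?k + d)\<^sup>2 + ?a * ln d) / (?k + e - ?a)"
    using lnT by (simp add: filterlim_at_top)
  have ev2: "\<forall>\<^sub>F T in at_right 0. ln (1 / T) \<ge> - (?b' * ln (d * (2 * ?k - d) / L)) / (?b' - (?k - e))"
    using lnT by (simp add: filterlim_at_top)
  have ev3: "\<forall>\<^sub>F T in at_right 0. 0 < T \<and> T < min d (d * (2 * ?k - d) / L)"
    using d c L by (auto simp: eventually_at_right_field intro!: exI[of _ "min d (d * (2 * ?k - d) / L)"])
  show ?thesis
    using ev1 ev2 ev3
  proof eventually_elim
    case (elim T)
    then have T: "0 < T" "T \<le> d" "T < d * (2 * ?k - d) / L" by auto
    have "shell_mass \<mu> d T \<le> (?k + d)\<^sup>2 * (1 + 2 / (2 * ?k - d) * ln (d / T))"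
      by (rule shell_mass_integrable(3)[OF mu d T(1,2)])
    also have "\<dots> = (?k + d)\<^sup>2 + ?a * ln (d / T)" by (simp add: distrib_left)
    also have "ln (d / T) = ln d + ln (1 / T)" using d T by (simp add: ln_div)
    also have "(?k + d)\<^sup>2 + ?a * (ln d + ln (1 / T)) \<le> (?k + e) * ln (1 / T)"
    proof -
      have *: "A + a * (x + t) \<le> K * t" if "A + a * x \<le> t * (K - a)" for A a x t K :: real
        using that by (simp add: algebra_simps)
      show ?thesis
        by (rule *) (use elim(1) up in \<open>simp add: pos_divide_le_eq\<close>)
    qed
    finally have 1: "shell_mass \<mu> d T \<le> (?k + e) * ln (1 / T)" .
    define y where "y = L * T / (2 * ?k - d)"
    have y: "y > 0" "y \<le> d" using T c L by (auto simp: y_def field_simps)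
    have "(?k - e) * ln (1 / T) \<le> ?b' * (ln (d * (2 * ?k - d) / L) + ln (1 / T))"
    proof -
      have *: "K * t \<le> b * (x + t)" if "K < b" "- (b * x) / (b - K) \<le> t" for b x t K :: real
      proof -
        have "- (b * x) \<le> t * (b - K)" using that(2) by (subst (asm) pos_divide_le_eq) (use that(1) in auto)
        then show ?thesis by (simp add: algebra_simps)
      qed
      show ?thesis by (rule *[OF L(1) elim(2)])
    qed
    also have "ln (d * (2 * ?k - d) / L) + ln (1 / T) = ln (d / y)"
      using d c L T by (simp add: y_def ln_div ln_mult)
    also have "?b' * ln (d / y) = (?k - d)\<^sup>2 * tanh (L / 2) * (2 / (2 * ?k + d)) * ln (d / y)" by simp
    also have "\<dots> \<le> shell_mass \<mu> d T" by (rule shell_mass_ge[OF mu d T(1,2) L(2) y_def y(2)])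
    finally show ?case using 1 by simp
  qed
qed

text \<open>Both coefficients tend to \<open>2 * (sqrt \<mu>)\<^sup>2 / (2 * sqrt \<mu>)\<close>:
  two sides of the sphere, the Jacobian, and the slope of the energy in the denominator.\<close>

lemma shell_width_small:
  assumes mu: "\<mu> > 0" and e: "e > 0"
  shows "\<forall>\<^sub>F d in at_right 0. 0 < d \<and> d < sqrt \<mu> \<and> 2 * (sqrt \<mu> + d)\<^sup>2 / (2 * sqrt \<mu> - d) < sqrt \<mu> + e \<and>
    sqrt \<mu> - e < 2 * (sqrt \<mu> - d)\<^sup>2 / (2 * sqrt \<mu> + d)"
proof -
  let ?k = "sqrt \<mu>"
  have k: "?k > 0" using mu by simp
  have k1: "2 * ?k\<^sup>2 / (2 * ?k) = ?k" using k by (simp add: power2_eq_square del: real_sqrt_mult_self)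
  have "((\<lambda>d. 2 * (?k + d)\<^sup>2 / (2 * ?k - d)) \<longlongrightarrow> 2 * (?k + 0)\<^sup>2 / (2 * ?k - 0)) (at_right 0)"
    using k by (intro tendsto_intros) auto
  then have a: "((\<lambda>d. 2 * (?k + d)\<^sup>2 / (2 * ?k - d)) \<longlongrightarrow> ?k) (at_right 0)" by (simp only: add_0_right diff_zero k1)
  have "((\<lambda>d. 2 * (?k - d)\<^sup>2 / (2 * ?k + d)) \<longlongrightarrow> 2 * (?k - 0)\<^sup>2 / (2 * ?k + 0)) (at_right 0)"
    using k by (intro tendsto_intros) auto
  then have b: "((\<lambda>d. 2 * (?k - d)\<^sup>2 / (2 * ?k + d)) \<longlongrightarrow> ?k) (at_right 0)" by (simp only: add_0_right diff_zero k1)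
  have "\<forall>\<^sub>F d in at_right 0. 0 < d \<and> d < ?k"
    using k by (auto simp: eventually_at_right_field intro!: exI[of _ ?k])
  with order_tendstoD(2)[OF a, of "?k + e"] order_tendstoD(1)[OF b, of "?k - e"] e
  show ?thesis by (auto elim: eventually_elim2 simp: eventually_conj_iff)
qed

section \<open>The two bounds on the critical temperature\<close>

lemma K_plus_nonneg_cong_AE:
  assumes U: "U \<in> borel_measurable lebesgue" "U' \<in> borel_measurable lebesgue" "AE x in lebesgue. U x = U' x"
    and K: "K_plus_nonneg \<mu> T U"
  shows "K_plus_nonneg \<mu> T U'"
  unfolding K_plus_nonneg_def
proof (intro allI impI)
  fix \<psi> \<psi>h assume F: "is_fourier_L2 \<psi> \<psi>h"
    and 1: "integrable lebesgue (\<lambda>p. K_symbol \<mu> T p * (cmod (\<psi>h p))\<^sup>2)"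
    and 2: "integrable lebesgue (\<lambda>x. U' x * (cmod (\<psi> x))\<^sup>2)"
  have [measurable]: "\<psi> \<in> borel_measurable lebesgue" using F by (auto simp: is_fourier_L2_def L2_iff)
  note [measurable] = U(1,2)
  have ae: "AE x in lebesgue. U x * (cmod (\<psi> x))\<^sup>2 = U' x * (cmod (\<psi> x))\<^sup>2"
    using U(3) by eventually_elim simp
  have m: "(\<lambda>x. U x * (cmod (\<psi> x))\<^sup>2) \<in> borel_measurable lebesgue" "(\<lambda>x. U' x * (cmod (\<psi> x))\<^sup>2) \<in> borel_measurable lebesgue"
    by measurable
  have "integrable lebesgue (\<lambda>x. U x * (cmod (\<psi> x))\<^sup>2)"
    unfolding integrable_cong_AE[OF m ae] by (rule 2)
  note K[unfolded K_plus_nonneg_def, rule_format, OF F 1 this]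
  moreover have "(LINT x|lebesgue. U x * (cmod (\<psi> x))\<^sup>2) = (LINT x|lebesgue. U' x * (cmod (\<psi> x))\<^sup>2)"
    by (rule integral_cong_AE[OF m ae])
  ultimately show "0 \<le> (LINT p|lebesgue. K_symbol \<mu> T p * (cmod (\<psi>h p))\<^sup>2) + (LINT x|lebesgue. U' x * (cmod (\<psi> x))\<^sup>2)"
    by (simp only:)
qed

lemma K_symbol_measurable [measurable]: "K_symbol \<mu> T \<in> borel_measurable borel"
  unfolding K_symbol_eq[abs_def] by measurable

text \<open>Replacing both functions by Borel representatives changes none of the integrals.\<close>

lemma K_plus_nonneg_borel:
  assumes [measurable]: "U \<in> borel_measurable borel"
  shows "K_plus_nonneg \<mu> T U \<longleftrightarrow>
    (\<forall>f g. f \<in> borel_measurable borel \<longrightarrow> g \<in> borel_measurable borel \<longrightarrow> is_fourier_L2 f g \<longrightarrow>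
      integrable lborel (\<lambda>p. K_radial \<mu> T (norm p) * (cmod (g p))\<^sup>2) \<longrightarrow>
      integrable lborel (\<lambda>x. U x * (cmod (f x))\<^sup>2) \<longrightarrow>
      0 \<le> (LINT p|lborel. K_radial \<mu> T (norm p) * (cmod (g p))\<^sup>2) + (LINT x|lborel. U x * (cmod (f x))\<^sup>2))"
    (is "_ \<longleftrightarrow> (\<forall>f g. ?P f g)")
proof
  assume K: "K_plus_nonneg \<mu> T U"
  show "\<forall>f g. ?P f g"
  proof (intro allI impI)
    fix f g :: "real^3 \<Rightarrow> complex"
    assume [measurable]: "f \<in> borel_measurable borel" "g \<in> borel_measurable borel"
      and F: "is_fourier_L2 f g"
      and i: "integrable lborel (\<lambda>p. K_radial \<mu> T (norm p) * (cmod (g p))\<^sup>2)" "integrable lborel (\<lambda>x. U x * (cmod (f x))\<^sup>2)"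
    have m: "(\<lambda>p. K_symbol \<mu> T p * (cmod (g p))\<^sup>2) \<in> borel_measurable lborel"
      "(\<lambda>x. U x * (cmod (f x))\<^sup>2) \<in> borel_measurable lborel" by simp_all
    have "0 \<le> (LINT p|lebesgue. K_symbol \<mu> T p * (cmod (g p))\<^sup>2) + (LINT x|lebesgue. U x * (cmod (f x))\<^sup>2)"
    proof (rule K[unfolded K_plus_nonneg_def, rule_format, OF F])
      show "integrable lebesgue (\<lambda>p. K_symbol \<mu> T p * (cmod (g p))\<^sup>2)"
        unfolding integrable_completion[OF m(1)] using i(1) by (simp add: K_symbol_eq)
      show "integrable lebesgue (\<lambda>x. U x * (cmod (f x))\<^sup>2)"
        unfolding integrable_completion[OF m(2)] by (rule i(2))
    qed
    then show "0 \<le> (LINT p|lborel. K_radial \<mu> T (norm p) * (cmod (g p))\<^sup>2) + (LINT x|lborel. U x * (cmod (f x))\<^sup>2)"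
      unfolding integral_completion[OF m(1)] integral_completion[OF m(2)] by (simp add: K_symbol_eq)
  qed
next
  assume P: "\<forall>f g. ?P f g"
  show "K_plus_nonneg \<mu> T U"
    unfolding K_plus_nonneg_def
  proof (intro allI impI)
    fix \<psi> \<psi>h assume F: "is_fourier_L2 \<psi> \<psi>h"
      and 1: "integrable lebesgue (\<lambda>p. K_symbol \<mu> T p * (cmod (\<psi>h p))\<^sup>2)"
      and 2: "integrable lebesgue (\<lambda>x. U x * (cmod (\<psi> x))\<^sup>2)"
    have ml: "\<psi> \<in> borel_measurable lebesgue" "\<psi>h \<in> borel_measurable lebesgue"
      using F by (auto simp: is_fourier_L2_def L2_iff)
    obtain f where f[measurable]: "f \<in> borel_measurable borel" and fa: "AE x in lebesgue. \<psi> x = f x"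
      using complex_borel_representative[OF ml(1)] .
    obtain g where g[measurable]: "g \<in> borel_measurable borel" and ga: "AE x in lebesgue. \<psi>h x = g x"
      using complex_borel_representative[OF ml(2)] .
    have fl: "f \<in> borel_measurable lebesgue" "g \<in> borel_measurable lebesgue"
      using f g by (auto intro: measurable_completion)
    have Kl: "K_symbol \<mu> T \<in> borel_measurable lebesgue" "U \<in> borel_measurable lebesgue"
      by (auto intro: measurable_completion)
    have Fb: "is_fourier_L2 f g" by (rule is_fourier_L2_cong_AE[OF F fl(1) fa fl(2) ga])
    have m: "(\<lambda>p. K_symbol \<mu> T p * (cmod (g p))\<^sup>2) \<in> borel_measurable lborel"
      "(\<lambda>x. U x * (cmod (f x))\<^sup>2) \<in> borel_measurable lborel" by simp_all
    have ml2: "(\<lambda>p. K_symbol \<mu> T p * (cmod (\<psi>h p))\<^sup>2) \<in> borel_measurable lebesgue"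
      "(\<lambda>p. K_symbol \<mu> T p * (cmod (g p))\<^sup>2) \<in> borel_measurable lebesgue"
      "(\<lambda>x. U x * (cmod (\<psi> x))\<^sup>2) \<in> borel_measurable lebesgue"
      "(\<lambda>x. U x * (cmod (f x))\<^sup>2) \<in> borel_measurable lebesgue"
      using ml fl Kl by (auto intro!: borel_measurable_times borel_measurable_power)
    have ae1: "AE p in lebesgue. K_symbol \<mu> T p * (cmod (\<psi>h p))\<^sup>2 = K_symbol \<mu> T p * (cmod (g p))\<^sup>2"
      using ga by eventually_elim simp
    have ae2: "AE x in lebesgue. U x * (cmod (\<psi> x))\<^sup>2 = U x * (cmod (f x))\<^sup>2"
      using fa by eventually_elim simp
    have "integrable lborel (\<lambda>p. K_symbol \<mu> T p * (cmod (g p))\<^sup>2)"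
      using 1 unfolding integrable_cong_AE[OF ml2(1,2) ae1] integrable_completion[OF m(1)] .
    moreover have "integrable lborel (\<lambda>x. U x * (cmod (f x))\<^sup>2)"
      using 2 unfolding integrable_cong_AE[OF ml2(3,4) ae2] integrable_completion[OF m(2)] .
    ultimately have "0 \<le> (LINT p|lborel. K_symbol \<mu> T p * (cmod (g p))\<^sup>2) + (LINT x|lborel. U x * (cmod (f x))\<^sup>2)"
      using P f g Fb unfolding K_symbol_eq by blast
    then show "0 \<le> (LINT p|lebesgue. K_symbol \<mu> T p * (cmod (\<psi>h p))\<^sup>2) + (LINT x|lebesgue. U x * (cmod (\<psi> x))\<^sup>2)"
      unfolding integral_cong_AE[OF ml2(1,2) ae1] integral_cong_AE[OF ml2(3,4) ae2]
        integral_completion[OF m(1)] integral_completion[OF m(2)] .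
  qed
qed

text \<open>The absolute value is needed because \<open>V\<close> has no sign. The summand
  \<open>a\<close> stands for the frequencies near the sphere, whose energy balance is critical, so
  its weight \<open>t\<close> must be free to be small.\<close>

lemma cmod_add_sq_young:
  assumes "t > 0"
  shows "\<bar>(cmod (a + b))\<^sup>2 - (cmod a)\<^sup>2\<bar> \<le> t * (cmod a)\<^sup>2 + (1 + 1 / t) * (cmod b)\<^sup>2"
proof -
  have "\<bar>(cmod (a + b))\<^sup>2 - (cmod a)\<^sup>2\<bar> \<le> 2 * (cmod a * cmod b) + (cmod b)\<^sup>2"
  proof -
    have "\<bar>cmod (a + b) - cmod a\<bar> \<le> cmod b" using norm_triangle_ineq3[of "a + b" a] by simp
    moreover have "cmod (a + b) + cmod a \<le> 2 * cmod a + cmod b" using norm_triangle_ineq[of a b] by linarith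
    ultimately have "\<bar>cmod (a + b) - cmod a\<bar> * (cmod (a + b) + cmod a) \<le> cmod b * (2 * cmod a + cmod b)"
      by (intro mult_mono) auto
    moreover have "\<bar>(cmod (a + b))\<^sup>2 - (cmod a)\<^sup>2\<bar> = \<bar>cmod (a + b) - cmod a\<bar> * (cmod (a + b) + cmod a)"
      by (simp add: power2_eq_square square_diff_square_factored abs_mult mult.commute)
    ultimately show ?thesis by (simp add: algebra_simps power2_eq_square)
  qed
  note young = this
  have "2 * (x * y) \<le> t * x\<^sup>2 + 1 / t * y\<^sup>2" for x y :: real
  proof -
    have "0 \<le> (t * x - y)\<^sup>2 / t" using assms by simp
    also have "\<dots> = t * x\<^sup>2 + 1 / t * y\<^sup>2 - 2 * (x * y)"
      using assms by (simp add: power2_eq_square field_simps)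
    finally show ?thesis by simp
  qed
  from this[of "cmod a" "cmod b"] young show ?thesis unfolding distrib_right mult_1 by linarith
qed

section \<open>Nonnegativity of the form at small coupling\<close>

locale bcs_potential = sphere_potential +
  assumes V_powr: "integrable lborel (\<lambda>x. \<bar>V x\<bar> powr (3 / 2))"
begin

lemma shell_norm_sets [measurable]: "{p::real^3. norm p \<in> shell \<mu> d} \<in> sets borel"
  by measurable

lemma shell_supported_integrable:
  assumes g: "g \<in> L2 lborel" and supp: "\<And>p. norm p \<notin> shell \<mu> d \<Longrightarrow> g p = 0"
  shows "integrable lborel g"
proof -
  have "(\<lambda>p. indicator (cball 0 (sqrt \<mu> + d)) p * g p) = g"
    using supp by (auto simp: fun_eq_iff indicator_def shell_def)
  then show ?thesis using L2_bounded_support_integrable[OF g, of "sqrt \<mu> + d"] by simp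
qed

lemma V_bounded_form:
  assumes [measurable]: "h \<in> borel_measurable borel" and b: "\<And>x. cmod (h x) \<le> C"
  shows "integrable lborel (\<lambda>x. \<bar>V x\<bar> * (cmod (h x))\<^sup>2)"
    "(LINT x|lborel. \<bar>V x\<bar> * (cmod (h x))\<^sup>2) \<le> C\<^sup>2 * (LINT x|lborel. \<bar>V x\<bar>)"
proof -
  have le: "\<bar>V x\<bar> * (cmod (h x))\<^sup>2 \<le> C\<^sup>2 * \<bar>V x\<bar>" for x
    unfolding mult.commute[of "C\<^sup>2"] by (intro mult_left_mono power_mono b) auto
  have iV: "integrable lborel (\<lambda>x. C\<^sup>2 * \<bar>V x\<bar>)" using V_integrable by auto
  show i: "integrable lborel (\<lambda>x. \<bar>V x\<bar> * (cmod (h x))\<^sup>2)"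
    by (rule Bochner_Integration.integrable_bound[OF iV]) (use le in \<open>auto simp: abs_mult\<close>)
  show "(LINT x|lborel. \<bar>V x\<bar> * (cmod (h x))\<^sup>2) \<le> C\<^sup>2 * (LINT x|lborel. \<bar>V x\<bar>)"
    using integral_mono[OF i iV le] by simp
qed

text \<open>Bounds the energy of \<open>\<bar>V\<bar>\<close> for frequencies in the shell, relative
  to shell mass times kinetic energy: the sup bound for the inverse transform, then
  \<open>fiber_integral_bounds\<close>.\<close>

definition C1 :: real where "C1 = fourier_norm\<^sup>2 * (LINT x|lborel. \<bar>V x\<bar>) * sphere_area"

text \<open>The constant of \<open>form_bound\<close> at \<open>s = 1\<close>, divided by the
  constant of \<open>K_radial_far\<close>; it diverges as the shell shrinks.\<close>

definition C2 :: "real \<Rightarrow> real"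
  where "C2 d = ((LINT x|lborel. \<bar>V x\<bar> powr (3 / 2)) + sobolev_const) / (d / (sqrt \<mu> + d))"

lemma C1_nonneg: "C1 \<ge> 0" using sphere_area_pos by (simp add: C1_def)

lemma C2_nonneg: "d > 0 \<Longrightarrow> C2 d \<ge> 0"
  using mu_pos by (auto simp: C2_def sobolev_const_def intro!: divide_nonneg_nonneg add_nonneg_nonneg)

text \<open>The part of \<open>f\<close> with frequencies near the sphere \<open>p\<^sup>2 = \<mu>\<close> is treated by the numerical range
  of \<open>sphere_op\<close>, the remaining part by the Sobolev bound, and the cross term by Young's inequality.\<close>

lemma K_plus_nonnegI:
  assumes d: "0 < d" "d < sqrt \<mu>" and T: "0 < T" "T \<le> d" and t: "t > 0" and l: "l > 0" and neg: "num_inf \<le> 0"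
    and near: "l * shell_mass \<mu> d T * (- num_inf + sphere_area * shell_error (2 * d) + t * C1) \<le> 1"
    and far: "l * ((1 + 1 / t) * C2 d) \<le> 1"
  shows "K_plus_nonneg \<mu> T (\<lambda>x. l * V x)"
proof -
  have lV: "(\<lambda>x. l * V x) \<in> borel_measurable borel" by measurable
  show ?thesis
    unfolding K_plus_nonneg_borel[OF lV]
  proof (intro allI impI)
    fix f g :: "real^3 \<Rightarrow> complex"
    assume [measurable]: "f \<in> borel_measurable borel" "g \<in> borel_measurable borel" and F: "is_fourier_L2 f g"
      and iK: "integrable lborel (\<lambda>p. K_radial \<mu> T (norm p) * (cmod (g p))\<^sup>2)"
    let ?K = "\<lambda>p::real^3. K_radial \<mu> T (norm p)"
    let ?m = "shell_mass \<mu> d T"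
    have Kp: "K_radial \<mu> T r > 0" for r by (rule K_radial_pos[OF T(1)])
    have g2: "g \<in> L2 lborel" using F by (simp add: is_fourier_L2_borel)
    define sh where "sh = {p::real^3. norm p \<in> shell \<mu> d}"
    have [measurable]: "sh \<in> sets borel" unfolding sh_def by measurable
    define g1 where "g1 p = indicator sh p * g p" for p
    define g2' where "g2' p = g p - g1 p" for p
    have [measurable]: "g1 \<in> borel_measurable borel" "g2' \<in> borel_measurable borel" unfolding g1_def g2'_def by measurable
    have g1L: "g1 \<in> L2 lborel" unfolding g1_def by (rule L2_indicator[OF g2]) simp
    have g1i: "integrable lborel g1" by (rule shell_supported_integrable[OF g1L, where d = d]) (simp add: g1_def sh_def)
    define f1 where "f1 = inv_fourier g1"
    define f2 where "f2 x = f x - f1 x" for x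
    have [measurable]: "f1 \<in> borel_measurable borel" "f2 \<in> borel_measurable borel" unfolding f1_def f2_def by measurable
    have F1: "is_fourier_L2 f1 g1" unfolding f1_def by (rule is_fourier_L2_inv_fourier[OF g1i g1L])
    have F2: "is_fourier_L2 f2 g2'" unfolding f2_def g2'_def by (rule is_fourier_L2_diff[OF _ _ _ _ F F1]) auto
    have iN: "integrable lborel (\<lambda>p. ?K p * (cmod (g1 p))\<^sup>2)"
      by (rule Bochner_Integration.integrable_bound[OF iK]) (auto simp: g1_def indicator_def)
    have iF: "integrable lborel (\<lambda>p. ?K p * (cmod (g2' p))\<^sup>2)"
      by (rule Bochner_Integration.integrable_bound[OF iK]) (auto simp: g1_def g2'_def indicator_def)
    define N where "N = (LINT p|lborel. ?K p * (cmod (g1 p))\<^sup>2)"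
    define Fr where "Fr = (LINT p|lborel. ?K p * (cmod (g2' p))\<^sup>2)"
    have N0: "N \<ge> 0" "Fr \<ge> 0" unfolding N_def Fr_def using Kp by (auto intro!: integral_nonneg_AE AE_I2 simp: less_imp_le)
    \<comment> \<open>The two parts have disjoint frequency supports, so the kinetic energy splits
      without a cross term.\<close>
    have "(LINT p|lborel. ?K p * (cmod (g p))\<^sup>2) = (LINT p|lborel. ?K p * (cmod (g1 p))\<^sup>2 + ?K p * (cmod (g2' p))\<^sup>2)"
      by (intro Bochner_Integration.integral_cong) (auto simp: g1_def g2'_def indicator_def)
    then have NF: "(LINT p|lborel. ?K p * (cmod (g p))\<^sup>2) = N + Fr" using iN iF by (simp add: N_def Fr_def)
    let ?cc = "d / (sqrt \<mu> + d)"
    have cc: "?cc > 0" using d mu_pos by (intro divide_pos_pos add_pos_pos) auto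
    have far_le: "(norm p)\<^sup>2 * (cmod (g2' p))\<^sup>2 \<le> 1 / ?cc * (?K p * (cmod (g2' p))\<^sup>2)" for p
    proof (cases "p \<in> sh")
      case True
      then show ?thesis by (simp add: g2'_def g1_def)
    next
      case False
      then have "?cc * (norm p)\<^sup>2 \<le> ?K p" using K_radial_far[OF mu_pos T(1) d(1) norm_ge_zero] by (simp add: sh_def)
      moreover have "x \<le> 1 / c * y" if "c > 0" "c * x \<le> y" for c x y :: real
        using that by (simp add: field_simps)
      ultimately have "(norm p)\<^sup>2 \<le> 1 / ?cc * ?K p" using cc by blast
      then show ?thesis unfolding mult.assoc[symmetric] by (rule mult_right_mono) simp
    qed
    have iFc: "integrable lborel (\<lambda>p. 1 / ?cc * (?K p * (cmod (g2' p))\<^sup>2))" by (rule integrable_mult_right[OF iF])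
    have iD: "integrable lborel (\<lambda>p. (norm p)\<^sup>2 * (cmod (g2' p))\<^sup>2)"
    proof (rule Bochner_Integration.integrable_bound[OF iFc])
      have "norm ((norm p)\<^sup>2 * (cmod (g2' p))\<^sup>2) \<le> norm (1 / ?cc * (?K p * (cmod (g2' p))\<^sup>2))" for p
      proof -
        have "0 \<le> (norm p)\<^sup>2 * (cmod (g2' p))\<^sup>2" by simp
        then show ?thesis unfolding real_norm_def using far_le[of p] by (simp only: abs_of_nonneg)
      qed
      then show "AE p in lborel. norm ((norm p)\<^sup>2 * (cmod (g2' p))\<^sup>2) \<le> norm (1 / ?cc * (?K p * (cmod (g2' p))\<^sup>2))" by simp
    qed simp_all
    have D: "(LINT p|lborel. (norm p)\<^sup>2 * (cmod (g2' p))\<^sup>2) \<le> Fr / ?cc"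
      using integral_mono[OF iD iFc far_le] unfolding integral_mult_right_zero Fr_def[symmetric] by (simp add: mult.commute)
    \<comment> \<open>The parameter \<open>s\<close> is 1 here: smallness of the far part is left to
      the coupling \<open>l\<close>.\<close>
    note fb = form_bound[OF V_measurable _ _ F2 iD V_powr zero_less_one]
    have i2: "integrable lborel (\<lambda>x. \<bar>V x\<bar> * (cmod (f2 x))\<^sup>2)"
      using integrable_norm[OF fb(1)] by (simp add: abs_mult)
    have far2: "(LINT x|lborel. \<bar>V x\<bar> * (cmod (f2 x))\<^sup>2) \<le> C2 d * Fr"
    proof -
      have "(LINT x|lborel. \<bar>V x\<bar> * (cmod (f2 x))\<^sup>2) \<le> ((LINT x|lborel. \<bar>V x\<bar> powr (3 / 2)) + sobolev_const) * (LINT p|lborel. (norm p)\<^sup>2 * (cmod (g2' p))\<^sup>2)"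
        using fb(2) by simp
      also have "\<dots> \<le> ((LINT x|lborel. \<bar>V x\<bar> powr (3 / 2)) + sobolev_const) * (Fr / ?cc)"
        by (intro mult_left_mono D add_nonneg_nonneg) (auto simp: sobolev_const_def)
      finally show ?thesis by (simp add: C2_def mult_ac)
    qed
    have supp: "norm p \<notin> shell \<mu> d \<Longrightarrow> g1 p = 0" for p by (simp add: g1_def sh_def)
    note fb0 = fiber_integral_bounds[OF g1i K_radial_measurable Kp shell_sets _ shell_mass_integrable(1)[OF mu_pos d T] iN]
    have fib: "fiber_integral g1 \<in> L2 sphere_measure" "sqnorm sphere_measure (fiber_integral g1) \<le> ?m * N"
      "(LINT p|lborel. cmod (g1 p))\<^sup>2 \<le> sphere_area * ?m * N"
      unfolding shell_mass_def N_def by (rule fb0, rule supp, assumption)+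
    define G where "G = (LINT p|lborel. cmod (g1 p))"
    have G: "G\<^sup>2 \<le> sphere_area * ?m * N" using fib(3) by (simp add: G_def)
    \<comment> \<open>The shell is closed whereas \<open>shell_estimate\<close> asks for a strict
      inequality, hence the doubled width.\<close>
    have supp2: "\<not> \<bar>norm p - sqrt \<mu>\<bar> < 2 * d \<Longrightarrow> g1 p = 0" for p using d by (intro supp) (auto simp: shell_def)
    have d2: "0 \<le> 2 * d" using d by simp
    have se: "integrable lborel (\<lambda>x. V x * (cmod (inv_fourier g1 x))\<^sup>2)"
      "\<bar>(LINT x|lborel. V x * (cmod (inv_fourier g1 x))\<^sup>2) - num (fiber_integral g1)\<bar> \<le> shell_error (2 * d) * (LINT p|lborel. cmod (g1 p))\<^sup>2"
      by (rule shell_estimate[OF g1i _ d2 fib(1)], rule supp2, assumption)+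
    have err0: "shell_error (2 * d) \<ge> 0" using d by (simp add: shell_error_def)
    have nearV: "(LINT x|lborel. V x * (cmod (f1 x))\<^sup>2) \<ge> - (- num_inf + sphere_area * shell_error (2 * d)) * (?m * N)"
    proof -
      \<comment> \<open>As \<open>num_inf \<le> 0\<close>, the upper bound for the norm of the
        radial integral becomes a lower bound for the energy.\<close>
      have "num_inf * (?m * N) \<le> num_inf * sqnorm sphere_measure (fiber_integral g1)"
        using fib(2) neg by (rule mult_left_mono_neg)
      also have "\<dots> \<le> num (fiber_integral g1)" by (rule num_inf_le[OF fib(1)])
      finally have "num_inf * (?m * N) - shell_error (2 * d) * G\<^sup>2 \<le> (LINT x|lborel. V x * (cmod (f1 x))\<^sup>2)"
        using se(2) unfolding f1_def G_def by linarith
      moreover have "shell_error (2 * d) * G\<^sup>2 \<le> shell_error (2 * d) * (sphere_area * ?m * N)"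
        by (rule mult_left_mono[OF G err0])
      ultimately show ?thesis by (simp add: algebra_simps)
    qed
    have f1b: "cmod (f1 x) \<le> fourier_norm * G" for x
      unfolding f1_def G_def inv_fourier_def by (rule fourier_bound[OF g1i])
    note V1 = V_bounded_form[OF _ f1b]
    have nearA: "(LINT x|lborel. \<bar>V x\<bar> * (cmod (f1 x))\<^sup>2) \<le> C1 * (?m * N)"
    proof -
      have "(LINT x|lborel. \<bar>V x\<bar> * (cmod (f1 x))\<^sup>2) \<le> (fourier_norm * G)\<^sup>2 * (LINT x|lborel. \<bar>V x\<bar>)" by (rule V1(2)) simp
      also have "\<dots> = (fourier_norm\<^sup>2 * (LINT x|lborel. \<bar>V x\<bar>)) * G\<^sup>2" by (simp add: power_mult_distrib)
      also have "\<dots> \<le> (fourier_norm\<^sup>2 * (LINT x|lborel. \<bar>V x\<bar>)) * (sphere_area * ?m * N)" by (intro mult_left_mono G) auto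
      finally show ?thesis by (simp add: C1_def mult_ac)
    qed
    have i1: "integrable lborel (\<lambda>x. \<bar>V x\<bar> * (cmod (f1 x))\<^sup>2)" by (rule V1(1)) simp
    have i1': "integrable lborel (\<lambda>x. V x * (cmod (f1 x))\<^sup>2)" unfolding f1_def by (rule se(1))
    assume ilV: "integrable lborel (\<lambda>x. l * V x * (cmod (f x))\<^sup>2)"
    then have ilV': "integrable lborel (\<lambda>x. V x * (cmod (f x))\<^sup>2)" using l by (simp add: mult.assoc)
    have point: "V x * (cmod (f1 x))\<^sup>2 - (t * (\<bar>V x\<bar> * (cmod (f1 x))\<^sup>2) + (1 + 1 / t) * (\<bar>V x\<bar> * (cmod (f2 x))\<^sup>2)) \<le> V x * (cmod (f x))\<^sup>2" for x
    proof -
      have "f x = f1 x + f2 x" by (simp add: f2_def)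
      then have "\<bar>V x\<bar> * \<bar>(cmod (f x))\<^sup>2 - (cmod (f1 x))\<^sup>2\<bar> \<le> \<bar>V x\<bar> * (t * (cmod (f1 x))\<^sup>2 + (1 + 1 / t) * (cmod (f2 x))\<^sup>2)"
        using cmod_add_sq_young[OF t, of "f1 x" "f2 x"] by (intro mult_left_mono) auto
      also have "\<dots> = t * (\<bar>V x\<bar> * (cmod (f1 x))\<^sup>2) + (1 + 1 / t) * (\<bar>V x\<bar> * (cmod (f2 x))\<^sup>2)"
        by (simp only: distrib_left mult_ac)
      finally have "\<bar>V x * (cmod (f x))\<^sup>2 - V x * (cmod (f1 x))\<^sup>2\<bar> \<le> \<dots>"
        by (simp only: abs_mult[symmetric] right_diff_distrib)
      then show ?thesis by linarith
    qed
    have "(LINT x|lborel. V x * (cmod (f1 x))\<^sup>2) - (t * (LINT x|lborel. \<bar>V x\<bar> * (cmod (f1 x))\<^sup>2) + (1 + 1 / t) * (LINT x|lborel. \<bar>V x\<bar> * (cmod (f2 x))\<^sup>2))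
       = (LINT x|lborel. V x * (cmod (f1 x))\<^sup>2 - (t * (\<bar>V x\<bar> * (cmod (f1 x))\<^sup>2) + (1 + 1 / t) * (\<bar>V x\<bar> * (cmod (f2 x))\<^sup>2)))"
      using i1 i1' i2 by simp
    also have "\<dots> \<le> (LINT x|lborel. V x * (cmod (f x))\<^sup>2)"
      by (rule integral_mono[OF _ ilV' point]) (use i1 i1' i2 in auto)
    finally have low: "(LINT x|lborel. V x * (cmod (f1 x))\<^sup>2) - (t * (LINT x|lborel. \<bar>V x\<bar> * (cmod (f1 x))\<^sup>2) + (1 + 1 / t) * (LINT x|lborel. \<bar>V x\<bar> * (cmod (f2 x))\<^sup>2))
       \<le> (LINT x|lborel. V x * (cmod (f x))\<^sup>2)" .
    let ?a = "- num_inf + sphere_area * shell_error (2 * d)"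
    have "- (?a + t * C1) * (?m * N) - (1 + 1 / t) * C2 d * Fr \<le> (LINT x|lborel. V x * (cmod (f x))\<^sup>2)"
    proof -
      have "t * (LINT x|lborel. \<bar>V x\<bar> * (cmod (f1 x))\<^sup>2) \<le> t * (C1 * (?m * N))"
        using nearA t by (intro mult_left_mono) auto
      moreover have "(1 + 1 / t) * (LINT x|lborel. \<bar>V x\<bar> * (cmod (f2 x))\<^sup>2) \<le> (1 + 1 / t) * (C2 d * Fr)"
        using far2 t by (intro mult_left_mono) auto
      moreover have "- (?a + t * C1) * (?m * N) - (1 + 1 / t) * C2 d * Fr = - ?a * (?m * N) - (t * (C1 * (?m * N)) + (1 + 1 / t) * (C2 d * Fr))"
        by (simp only: minus_add_distrib distrib_right mult_minus_left mult.assoc diff_conv_add_uminus add.assoc)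
      ultimately show ?thesis using low nearV by linarith
    qed
    then have "l * (- (?a + t * C1) * (?m * N) - (1 + 1 / t) * C2 d * Fr) \<le> l * (LINT x|lborel. V x * (cmod (f x))\<^sup>2)"
      using l by (intro mult_left_mono) auto
    also have "l * (- (?a + t * C1) * (?m * N) - (1 + 1 / t) * C2 d * Fr) =
       - (l * ?m * (?a + t * C1) * N) - l * ((1 + 1 / t) * C2 d) * Fr"
      by (simp only: right_diff_distrib mult_minus_left mult_minus_right mult_ac)
    finally have "- (l * ?m * (?a + t * C1) * N) - l * ((1 + 1 / t) * C2 d) * Fr \<le> (LINT x|lborel. l * V x * (cmod (f x))\<^sup>2)"
      by (simp add: mult.assoc)
    \<comment> \<open>By \<open>near\<close> and \<open>far\<close>, the potential energy charged to
      each part is at most the kinetic energy of that part.\<close>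
    moreover have "l * ?m * (?a + t * C1) * N \<le> 1 * N" using near N0 by (intro mult_right_mono) auto
    moreover have "l * ((1 + 1 / t) * C2 d) * Fr \<le> 1 * Fr" using far N0 by (intro mult_right_mono) auto
    ultimately show "0 \<le> (LINT p|lborel. ?K p * (cmod (g p))\<^sup>2) + (LINT x|lborel. l * V x * (cmod (f x))\<^sup>2)"
      unfolding NF by linarith
  qed
qed

end

section \<open>Trial states at low temperature\<close>

lemma AE_radial_pos: "AE r in radial_measure. r > 0"
proof -
  have "AE r in lborel. 0 < ennreal (r\<^sup>2 * indicator {0..} r) \<longrightarrow> r > 0"
  proof (rule AE_I2, rule impI)
    fix r :: real assume "0 < ennreal (r\<^sup>2 * indicator {0..} r)"
    then show "r > 0" by (cases r "0::real" rule: linorder_cases) auto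
  qed
  then show ?thesis unfolding radial_measure_def by (subst AE_density) auto
qed

lemma exp_small:
  fixes \<theta> b :: real
  assumes "\<theta> > 0" "b > 0" shows "\<forall>\<^sub>F l in at_right 0. exp (- \<theta> / l) < b"
proof -
  have "((\<lambda>l. exp (- \<theta> / l)) \<longlongrightarrow> 0) (at_right 0)"
  proof (rule filterlim_compose[OF exp_at_bot])
    have "LIM l at_right 0. - \<theta> * inverse l :> at_bot"
      by (rule filterlim_tendsto_neg_mult_at_bot[OF tendsto_const _ filterlim_inverse_at_top_right]) (use assms(1) in simp)
    then show "LIM l at_right 0. - \<theta> / l :> at_bot" by (simp add: divide_inverse)
  qed
  then show ?thesis using assms(2) by (rule order_tendstoD(2))
qed

context bcs_potential
begin

text \<open>In \<open>trial_state\<close> the radial integral is computed only at unit vectors, so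
  the congruence has to be restricted to the sphere.\<close>

lemma num_cong:
  assumes "\<And>x. x \<in> sphere 0 1 \<Longrightarrow> f x = g x" shows "num f = num g"
proof -
  have "sphere_op \<mu> V f x = sphere_op \<mu> V g x" for x
    unfolding A_eq using assms by (intro Bochner_Integration.integral_cong) auto
  then have "ip sphere_measure f (sphere_op \<mu> V f) = ip sphere_measure g (sphere_op \<mu> V g)"
    using assms by (intro ip_cong) auto
  then show ?thesis by (simp add: num_def)
qed

text \<open>The function \<open>u / K_radial\<close> on the shell is the equality case of
  Cauchy--Schwarz, left unnormalized: its kinetic energy is the shell mass \<open>m\<close> and its
  radial integral is \<open>m * u\<close>. The potential term is thus quadratic in \<open>m\<close>
  and wins as soon as \<open>l * m * num u\<close> is below \<open>- 1\<close>, up to the shell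
  error.\<close>

lemma trial_state:
  assumes u: "u \<in> L2 sphere_measure" "sqnorm sphere_measure u = 1"
    and d: "0 < d" "d < sqrt \<mu>" and T: "0 < T" "T \<le> d" and l: "l > 0"
    and K: "K_plus_nonneg \<mu> T (\<lambda>x. l * V x)"
  shows "0 \<le> shell_mass \<mu> d T + l * ((shell_mass \<mu> d T)\<^sup>2 * (num u + sphere_area * shell_error (2 * d)))"
proof -
  let ?m = "shell_mass \<mu> d T"
  have [measurable]: "u \<in> borel_measurable unit_sphere_borel"
    using u(1) measurable_cong_sets[OF sets_sphere_measure refl] by (auto simp: L2_iff)
  have Kp: "K_radial \<mu> T r > 0" for r by (rule K_radial_pos[OF T(1)])
  define g where "g p = complex_of_real (indicator (shell \<mu> d) (norm p) / K_radial \<mu> T (norm p)) * u (direction p)" for p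
  have [measurable]: "g \<in> borel_measurable borel" unfolding g_def by measurable
  note mi = shell_mass_integrable(1)[OF mu_pos d T]
  have g_sq: "K_radial \<mu> T (norm p) * (cmod (g p))\<^sup>2 = indicator (shell \<mu> d) (norm p) / K_radial \<mu> T (norm p) * (cmod (u (direction p)))\<^sup>2" for p
    using Kp[of "norm p"] by (simp add: g_def norm_mult norm_divide power_mult_distrib power_divide power2_eq_square indicator_def)
  let ?H = "\<lambda>z. indicator (shell \<mu> d) (fst z) / K_radial \<mu> T (fst z) * (cmod (u (snd z)))\<^sup>2"
  have Hm: "?H \<in> borel_measurable (borel \<Otimes>\<^sub>M unit_sphere_borel)" by measurable
  have Hi: "integrable (radial_measure \<Otimes>\<^sub>M sphere_measure) ?H"
    "(LINT z|(radial_measure \<Otimes>\<^sub>M sphere_measure). ?H z) = ?m * sqnorm sphere_measure u"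
    using pair_mult_integral[OF sigma_finite_radial_measure sphere_measure.sigma_finite_measure_axioms mi L2_integrable_sq[OF u(1)]]
    by (simp_all add: shell_mass_def sqnorm_def)
  have iN: "integrable lborel (\<lambda>p. K_radial \<mu> T (norm p) * (cmod (g p))\<^sup>2)"
    using Hi(1) unfolding g_sq polar_integrable_pair[OF Hm] by simp
  have N: "(LINT p|lborel. K_radial \<mu> T (norm p) * (cmod (g p))\<^sup>2) = ?m"
    using Hi(2) unfolding g_sq polar_integral_pair[OF Hm] by (simp add: u(2))
  have gL: "g \<in> L2 lborel"
    unfolding L2_iff
  proof
    \<comment> \<open>Since the energy is at least \<open>2 * T\<close>, finite kinetic energy
      implies square integrability.\<close>
    have "(cmod (g p))\<^sup>2 \<le> 1 / (2 * T) * (K_radial \<mu> T (norm p) * (cmod (g p))\<^sup>2)" for p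
    proof -
      have "1 \<le> 1 / (2 * T) * K_radial \<mu> T (norm p)"
        using K_energy_bounds(1)[OF T(1), of "(norm p)\<^sup>2 - \<mu>"] T(1) by (simp add: K_radial_def)
      then have "1 * (cmod (g p))\<^sup>2 \<le> 1 / (2 * T) * K_radial \<mu> T (norm p) * (cmod (g p))\<^sup>2" by (rule mult_right_mono) simp
      then show ?thesis by (simp add: mult.assoc)
    qed
    then have "norm ((cmod (g p))\<^sup>2) \<le> norm (1 / (2 * T) * (K_radial \<mu> T (norm p) * (cmod (g p))\<^sup>2))" for p
      unfolding real_norm_def by (metis abs_ge_self abs_of_nonneg order_trans zero_le_power2)
    then show "integrable lborel (\<lambda>p. (cmod (g p))\<^sup>2)"
      by (intro Bochner_Integration.integrable_bound[OF integrable_mult_right[OF iN, of "1 / (2 * T)"]]) auto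
  qed simp
  have supp: "norm p \<notin> shell \<mu> d \<Longrightarrow> g p = 0" for p by (simp add: g_def)
  have gi: "integrable lborel g" by (rule shell_supported_integrable[OF gL supp])
  define f where "f = inv_fourier g"
  have [measurable]: "f \<in> borel_measurable borel" unfolding f_def by measurable
  have F: "is_fourier_L2 f g" unfolding f_def by (rule is_fourier_L2_inv_fourier[OF gi gL])
  note fb0 = fiber_integral_bounds[OF gi K_radial_measurable Kp shell_sets _ mi iN]
  have fib: "fiber_integral g \<in> L2 sphere_measure" by (rule fb0(1), rule supp, assumption)
  have "(LINT p|lborel. cmod (g p))\<^sup>2 \<le> sphere_area * (LINT r|radial_measure. indicator (shell \<mu> d) r / K_radial \<mu> T r) *
      (LINT p|lborel. K_radial \<mu> T (norm p) * (cmod (g p))\<^sup>2)"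
    by (rule fb0(3), rule supp, assumption)
  then have G: "(LINT p|lborel. cmod (g p))\<^sup>2 \<le> sphere_area * ?m * ?m"
    unfolding N shell_mass_def[symmetric] .
  have fg: "fiber_integral g w = complex_of_real ?m * u w" if w: "w \<in> sphere 0 1" for w
  proof -
    have "fiber_integral g w = (LINT r|radial_measure. complex_of_real (indicator (shell \<mu> d) r / K_radial \<mu> T r) * u w)"
      unfolding fiber_integral_def
    proof (rule integral_cong_AE)
      show "AE r in radial_measure. g (r *\<^sub>R w) = complex_of_real (indicator (shell \<mu> d) r / K_radial \<mu> T r) * u w"
        using AE_radial_pos by eventually_elim (use w in \<open>simp add: g_def direction_scaleR direction_sphere\<close>)
    qed measurable
    also have "\<dots> = complex_of_real ?m * u w"
      unfolding shell_mass_def integral_mult_left_zero integral_complex_of_real ..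
    finally show ?thesis .
  qed
  have nf: "num (fiber_integral g) = ?m\<^sup>2 * num u"
    using num_cong[OF fg] num_scale by simp
  have supp2: "\<not> \<bar>norm p - sqrt \<mu>\<bar> < 2 * d \<Longrightarrow> g p = 0" for p using d by (intro supp) (auto simp: shell_def)
  have d2: "0 \<le> 2 * d" using d by simp
  have se: "integrable lborel (\<lambda>x. V x * (cmod (inv_fourier g x))\<^sup>2)"
    "\<bar>(LINT x|lborel. V x * (cmod (inv_fourier g x))\<^sup>2) - num (fiber_integral g)\<bar> \<le> shell_error (2 * d) * (LINT p|lborel. cmod (g p))\<^sup>2"
    by (rule shell_estimate[OF gi _ d2 fib], rule supp2, assumption)+
  have err0: "shell_error (2 * d) \<ge> 0" using d by (simp add: shell_error_def)
  have Vf: "(LINT x|lborel. V x * (cmod (f x))\<^sup>2) \<le> ?m\<^sup>2 * (num u + sphere_area * shell_error (2 * d))"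
  proof -
    have "shell_error (2 * d) * (LINT p|lborel. cmod (g p))\<^sup>2 \<le> shell_error (2 * d) * (sphere_area * ?m * ?m)"
      using G err0 by (intro mult_left_mono) auto
    moreover have "(LINT x|lborel. V x * (cmod (f x))\<^sup>2) \<le> ?m\<^sup>2 * num u + shell_error (2 * d) * (LINT p|lborel. cmod (g p))\<^sup>2"
      using se(2) unfolding nf f_def by linarith
    ultimately show ?thesis by (simp add: algebra_simps power2_eq_square)
  qed
  have lV: "(\<lambda>x. l * V x) \<in> borel_measurable borel" by measurable
  have "0 \<le> (LINT p|lborel. K_radial \<mu> T (norm p) * (cmod (g p))\<^sup>2) + (LINT x|lborel. l * V x * (cmod (f x))\<^sup>2)"
  proof (rule K[unfolded K_plus_nonneg_borel[OF lV], rule_format, OF _ _ F iN])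
    show "integrable lborel (\<lambda>x. l * V x * (cmod (f x))\<^sup>2)" using se(1) unfolding f_def by (simp add: mult.assoc)
  qed auto
  also have "\<dots> = ?m + l * (LINT x|lborel. V x * (cmod (f x))\<^sup>2)" by (simp add: N mult.assoc)
  also have "\<dots> \<le> ?m + l * (?m\<^sup>2 * (num u + sphere_area * shell_error (2 * d)))"
    using l by (intro add_left_mono mult_left_mono Vf) auto
  finally show ?thesis .
qed

text \<open>A single width serves both purposes: the phase error is small even on the doubled shell,
  and the coefficient of the shell mass is within \<open>e\<close> of
  \<open>sqrt \<mu>\<close>.\<close>

lemma shell_parameters:
  assumes e: "e > 0"
  obtains d where "0 < d" "d < sqrt \<mu>" "sphere_area * shell_error (2 * d) \<le> e"
    "\<forall>\<^sub>F T in at_right 0. (sqrt \<mu> - e) * ln (1 / T) \<le> shell_mass \<mu> d T \<and> shell_mass \<mu> d T \<le> (sqrt \<mu> + e) * ln (1 / T)"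
proof -
  obtain d0 where d0: "d0 > 0" "\<And>d. 0 \<le> d \<Longrightarrow> d \<le> d0 \<Longrightarrow> shell_error d < e / sphere_area"
    using shell_error_small[of "e / sphere_area"] e sphere_area_pos by auto
  have "\<forall>\<^sub>F d in at_right 0. d < d0 / 2"
    using d0 by (auto simp: eventually_at_right_field intro!: exI[of _ "d0 / 2"])
  with shell_width_small[OF mu_pos e]
  have "\<forall>\<^sub>F d in at_right 0. d < d0 / 2 \<and> 0 < d \<and> d < sqrt \<mu> \<and> 2 * (sqrt \<mu> + d)\<^sup>2 / (2 * sqrt \<mu> - d) < sqrt \<mu> + e \<and>
    sqrt \<mu> - e < 2 * (sqrt \<mu> - d)\<^sup>2 / (2 * sqrt \<mu> + d)" by eventually_elim auto
  then obtain d where d: "d < d0 / 2" "0 < d" "d < sqrt \<mu>" "2 * (sqrt \<mu> + d)\<^sup>2 / (2 * sqrt \<mu> - d) < sqrt \<mu> + e"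
    "sqrt \<mu> - e < 2 * (sqrt \<mu> - d)\<^sup>2 / (2 * sqrt \<mu> + d)"
    using eventually_happens'[OF trivial_limit_at_right_real] by blast
  have "shell_error (2 * d) < e / sphere_area" using d by (intro d0(2)) auto
  then have "sphere_area * shell_error (2 * d) \<le> e" using sphere_area_pos by (simp add: field_simps)
  then show ?thesis using that d(2,3) shell_mass_asymp[OF mu_pos d(2,3,4,5)] by blast
qed

text \<open>The strict inequality for \<open>\<theta>\<close> leaves room for a tolerance
  \<open>e\<close>, which determines the width \<open>d\<close> and the Young parameter
  \<open>t\<close>; then \<open>l0\<close> is taken small against the far constant, which depends on
  both. The temperature enters only through a fixed upper bound and
  \<open>l * ln (1 / T) \<le> \<theta>\<close>.\<close>

lemma K_plus_nonneg_above:
  assumes neg: "num_inf < 0" and \<theta>: "0 < \<theta>" "\<theta> * (sqrt \<mu> * - num_inf) < 1"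
  obtains l0 T1 where "l0 > 0" "T1 > 0"
    "\<And>l T. 0 < l \<Longrightarrow> l < l0 \<Longrightarrow> 0 < T \<Longrightarrow> T < T1 \<Longrightarrow> l * ln (1 / T) \<le> \<theta> \<Longrightarrow> K_plus_nonneg \<mu> T (\<lambda>x. l * V x)"
proof -
  let ?k = "sqrt \<mu>" let ?e = "- num_inf"
  have "((\<lambda>e. \<theta> * ((?k + e) * (?e + 2 * e))) \<longlongrightarrow> \<theta> * ((?k + 0) * (?e + 2 * 0))) (at_right 0)"
    by (intro tendsto_intros)
  then have "\<forall>\<^sub>F e in at_right 0. \<theta> * ((?k + e) * (?e + 2 * e)) < 1" using \<theta> by (intro order_tendstoD) auto
  then have "\<forall>\<^sub>F e in at_right 0. \<theta> * ((?k + e) * (?e + 2 * e)) < 1 \<and> 0 < e"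
    using eventually_at_right_less[of "0::real"] by eventually_elim auto
  then obtain e where e: "\<theta> * ((?k + e) * (?e + 2 * e)) < 1" "0 < e"
    using eventually_happens'[OF trivial_limit_at_right_real] by blast
  obtain d where d: "0 < d" "d < ?k" "sphere_area * shell_error (2 * d) \<le> e"
    and as: "\<forall>\<^sub>F T in at_right 0. (?k - e) * ln (1 / T) \<le> shell_mass \<mu> d T \<and> shell_mass \<mu> d T \<le> (?k + e) * ln (1 / T)"
    using shell_parameters[OF e(2)] .
  from as obtain b where b: "b > 0" "\<And>T. 0 < T \<Longrightarrow> T < b \<Longrightarrow> shell_mass \<mu> d T \<le> (?k + e) * ln (1 / T)"
    by (auto simp: eventually_at_right_field)
  \<comment> \<open>Gives \<open>t * C1 \<le> e\<close>; the summand 1 avoids a division by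
    0.\<close>
  define t where "t = e / (C1 + 1)"
  have t: "t > 0" "t * C1 \<le> e" using e(2) C1_nonneg by (auto simp: t_def field_simps add_nonneg_pos)
  define l0 where "l0 = 1 / ((1 + 1 / t) * C2 d + 1)"
  have X0: "(1 + 1 / t) * C2 d \<ge> 0" using t C2_nonneg[OF d(1)] by auto
  show ?thesis
  proof (rule that[of l0 "min b d"])
    show "l0 > 0" using X0 by (simp add: l0_def)
    show "min b d > 0" using b d by simp
    fix l T :: real assume l: "0 < l" "l < l0" and T: "0 < T" "T < min b d" and lT: "l * ln (1 / T) \<le> \<theta>"
    have k: "?k > 0" using mu_pos by simp
    have a: "?e + sphere_area * shell_error (2 * d) + t * C1 \<le> ?e + 2 * e" using d(3) t(2) by simp
    have err0: "shell_error (2 * d) \<ge> 0" using d by (simp add: shell_error_def)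
    have a0: "0 \<le> ?e + sphere_area * shell_error (2 * d) + t * C1"
      using neg err0 sphere_area_pos C1_nonneg t by (intro add_nonneg_nonneg mult_nonneg_nonneg) auto
    have "l * shell_mass \<mu> d T \<le> l * ((?k + e) * ln (1 / T))" using b(2)[of T] T l by (intro mult_left_mono) auto
    also have "\<dots> = (?k + e) * (l * ln (1 / T))" by simp
    also have "\<dots> \<le> (?k + e) * \<theta>" using lT k e by (intro mult_left_mono) auto
    finally have m: "l * shell_mass \<mu> d T \<le> (?k + e) * \<theta>" .
    have "l * shell_mass \<mu> d T * (?e + sphere_area * shell_error (2 * d) + t * C1) \<le> (?k + e) * \<theta> * (?e + 2 * e)"
      by (rule mult_mono[OF m a]) (use a0 k e \<theta> in auto)
    also have "\<dots> \<le> 1" using e(1) by (simp add: mult_ac)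
    finally have near: "l * shell_mass \<mu> d T * (?e + sphere_area * shell_error (2 * d) + t * C1) \<le> 1" .
    have "l * ((1 + 1 / t) * C2 d) \<le> l0 * ((1 + 1 / t) * C2 d + 1)"
      using l X0 by (intro mult_mono) auto
    also have "\<dots> = 1" using X0 by (simp add: l0_def)
    finally have far: "l * ((1 + 1 / t) * C2 d) \<le> 1" .
    show "K_plus_nonneg \<mu> T (\<lambda>x. l * V x)"
      by (rule K_plus_nonnegI[OF d(1,2) T(1) _ t(1) l(1) _ near far]) (use T neg in auto)
  qed
qed

text \<open>A near minimizer \<open>u\<close> of the numerical range makes the right-hand side of
  \<open>trial_state\<close> negative. The threshold \<open>T1\<close> does not depend on
  \<open>l\<close>, as the trial state has no frequencies off the shell; this is what yields a
  nonzero critical temperature at every coupling.\<close>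

lemma not_K_plus_nonneg_below:
  assumes neg: "num_inf < 0" and \<theta>: "\<theta> * (sqrt \<mu> * - num_inf) > 1"
  obtains T1 where "T1 > 0"
    "\<And>l T. 0 < l \<Longrightarrow> 0 < T \<Longrightarrow> T < T1 \<Longrightarrow> \<theta> \<le> l * ln (1 / T) \<Longrightarrow> \<not> K_plus_nonneg \<mu> T (\<lambda>x. l * V x)"
proof -
  let ?k = "sqrt \<mu>" let ?e = "- num_inf"
  have k: "?k > 0" using mu_pos by simp
  have th0: "\<theta> > 0" using \<theta> neg k by (smt (verit) mult_nonpos_nonneg mult_pos_pos)
  have "((\<lambda>e. \<theta> * ((?k - e) * (?e - 2 * e))) \<longlongrightarrow> \<theta> * ((?k - 0) * (?e - 2 * 0))) (at_right 0)"
    by (intro tendsto_intros)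
  then have "\<forall>\<^sub>F e in at_right 0. 1 < \<theta> * ((?k - e) * (?e - 2 * e))" using \<theta> by (intro order_tendstoD) auto
  \<comment> \<open>Keeps \<open>?k - e\<close> and \<open>?e - 2 * e\<close> positive separately,
    which a bound on their product would not.\<close>
  moreover have "\<forall>\<^sub>F e in at_right 0. 0 < e \<and> e < min ?k (?e / 2)"
    using k neg by (auto simp: eventually_at_right_field intro!: exI[of _ "min ?k (?e / 2)"])
  ultimately have "\<forall>\<^sub>F e in at_right 0. 1 < \<theta> * ((?k - e) * (?e - 2 * e)) \<and> 0 < e \<and> e < min ?k (?e / 2)"
    by eventually_elim auto
  then obtain e where e: "1 < \<theta> * ((?k - e) * (?e - 2 * e))" "0 < e" "e < min ?k (?e / 2)"
    using eventually_happens'[OF trivial_limit_at_right_real] by blast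
  obtain d where d: "0 < d" "d < ?k" "sphere_area * shell_error (2 * d) \<le> e"
    and as: "\<forall>\<^sub>F T in at_right 0. (?k - e) * ln (1 / T) \<le> shell_mass \<mu> d T \<and> shell_mass \<mu> d T \<le> (?k + e) * ln (1 / T)"
    using shell_parameters[OF e(2)] .
  from as obtain b where b: "b > 0" "\<And>T. 0 < T \<Longrightarrow> T < b \<Longrightarrow> (?k - e) * ln (1 / T) \<le> shell_mass \<mu> d T"
    by (auto simp: eventually_at_right_field)
  obtain u where u: "u \<in> L2 sphere_measure" "sqnorm sphere_measure u = 1" "num u < num_inf + e"
    using num_inf_approx[OF e(2)] .
  show ?thesis
  proof (rule that[of "min b d"])
    show "min b d > 0" using b d by simp
    fix l T :: real assume l: "0 < l" and T: "0 < T" "T < min b d" and lT: "\<theta> \<le> l * ln (1 / T)"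
    let ?m = "shell_mass \<mu> d T"
    have "(?k - e) * \<theta> \<le> (?k - e) * (l * ln (1 / T))" using lT e by (intro mult_left_mono) auto
    also have "\<dots> = l * ((?k - e) * ln (1 / T))" by simp
    also have "\<dots> \<le> l * ?m" using b(2)[of T] T l by (intro mult_left_mono) auto
    finally have m: "(?k - e) * \<theta> \<le> l * ?m" .
    have "0 < (?k - e) * \<theta>" using e th0 by auto
    then have mp: "?m > 0" using m l by (metis less_le_trans zero_less_mult_pos)
    have "1 < (?k - e) * \<theta> * (?e - 2 * e)" using e(1) by (simp add: mult_ac)
    also have "\<dots> \<le> l * ?m * (?e - 2 * e)" using m e(3) by (intro mult_right_mono) auto
    finally have big: "1 < l * ?m * (?e - 2 * e)" .
    show "\<not> K_plus_nonneg \<mu> T (\<lambda>x. l * V x)"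
    proof
      assume "K_plus_nonneg \<mu> T (\<lambda>x. l * V x)"
      from trial_state[OF u(1,2) d(1,2) T(1) _ l this]
      have "0 \<le> ?m + l * (?m\<^sup>2 * (num u + sphere_area * shell_error (2 * d)))" using T by simp
      also have "\<dots> \<le> ?m + l * (?m\<^sup>2 * (num_inf + 2 * e))"
        using l u(3) d(3) by (intro add_left_mono mult_left_mono) auto
      also have "\<dots> = ?m * (1 - l * ?m * (?e - 2 * e))" by (simp add: algebra_simps power2_eq_square)
      also have "\<dots> < 0" using mp big by (intro mult_pos_neg) auto
      finally show False by simp
    qed
  qed
qed

text \<open>Cutting at a height \<open>c\<close> splits \<open>V\<close> into a bounded part and one
  of small 3/2-norm, which the kinetic energy can absorb at any given coupling.\<close>

lemma V_tail_small:
  assumes "e > 0"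
  obtains c where "c > 0" "(LINT x|lborel. \<bar>indicator {x. c < \<bar>V x\<bar>} x * V x\<bar> powr (3 / 2)) < e"
    "integrable lborel (\<lambda>x. \<bar>indicator {x. c < \<bar>V x\<bar>} x * V x\<bar> powr (3 / 2))"
proof -
  have eq: "\<bar>indicator {x. c < \<bar>V x\<bar>} x * V x\<bar> powr (3 / 2) = indicator {x. c < \<bar>V x\<bar>} x * \<bar>V x\<bar> powr (3 / 2)" for c x
    by (simp add: indicator_def)
  have i: "integrable lborel (\<lambda>x. indicator {x. c < \<bar>V x\<bar>} x * \<bar>V x\<bar> powr (3 / 2))" for c
    by (rule Bochner_Integration.integrable_bound[OF V_powr]) (auto simp: indicator_def)
  have "(\<lambda>n. LINT x|lborel. indicator {x. real n < \<bar>V x\<bar>} x * \<bar>V x\<bar> powr (3 / 2)) \<longlonglongrightarrow> (LINT (x::real^3)|lborel. 0)"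
  proof (rule integral_dominated_convergence[where w = "\<lambda>x. \<bar>V x\<bar> powr (3 / 2)"])
    show "AE x in lborel. (\<lambda>n. indicator {x. real n < \<bar>V x\<bar>} x * \<bar>V x\<bar> powr (3 / 2)) \<longlonglongrightarrow> 0"
    proof (rule AE_I2)
      fix x
      have "\<not> real n < \<bar>V x\<bar>" if "nat \<lceil>\<bar>V x\<bar>\<rceil> \<le> n" for n using that by linarith
      then have "\<forall>\<^sub>F n in sequentially. indicator {x. real n < \<bar>V x\<bar>} x * \<bar>V x\<bar> powr (3 / 2) = 0"
        by (intro eventually_sequentiallyI[of "nat \<lceil>\<bar>V x\<bar>\<rceil>"]) simp
      then show "(\<lambda>n. indicator {x. real n < \<bar>V x\<bar>} x * \<bar>V x\<bar> powr (3 / 2)) \<longlonglongrightarrow> 0" by (rule tendsto_eventually)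
    qed
  qed (use V_powr in \<open>auto simp: indicator_def\<close>)
  then have "(\<lambda>n. LINT x|lborel. indicator {x. real n < \<bar>V x\<bar>} x * \<bar>V x\<bar> powr (3 / 2)) \<longlonglongrightarrow> 0" by simp
  from order_tendstoD(2)[OF this assms] eventually_gt_at_top[of "0::nat"]
  have "\<forall>\<^sub>F n in sequentially. (LINT x|lborel. indicator {x. real n < \<bar>V x\<bar>} x * \<bar>V x\<bar> powr (3 / 2)) < e \<and> 0 < n"
    by eventually_elim auto
  then obtain n where "(LINT x|lborel. indicator {x. real n < \<bar>V x\<bar>} x * \<bar>V x\<bar> powr (3 / 2)) < e" "0 < n"
    using eventually_happens'[OF sequentially_bot] by blast
  then show ?thesis using that[of "real n"] i[of "real n"] unfolding eq by simp
qed

text \<open>Ensures that the infimum in \<open>critical_temperature\<close> is taken over a nonempty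
  set at every coupling. The part of \<open>V\<close> below the height \<open>c\<close> is absorbed
  by the lower bound \<open>2 * T\<close> of the energy, as \<open>T \<ge> l * c\<close>; the tail
  by \<open>form_bound\<close>, where \<open>T \<ge> \<mu>\<close> gives
  \<open>(norm p)\<^sup>2 \<le> 2 * K_radial \<mu> T (norm p)\<close>. Each takes half of the
  kinetic energy.\<close>

lemma K_plus_nonneg_high:
  assumes l: "l > 0" obtains T where "T > 0" "K_plus_nonneg \<mu> T (\<lambda>x. l * V x)"
proof -
  \<comment> \<open>With this \<open>s\<close> the Sobolev term costs at most 1/8, and
    \<open>c\<close> is then chosen so that the tail costs at most another 1/8; comparing
    \<open>(norm p)\<^sup>2\<close> with the energy doubles the sum to 1/2.\<close>
  define s where "s = sqrt (8 * l * sobolev_const + 1)"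
  have sc: "sobolev_const \<ge> 0" by (simp add: sobolev_const_def)
  have s: "s > 0" "s\<^sup>2 = 8 * l * sobolev_const + 1" using l sc by (auto simp: s_def add_nonneg_pos)
  obtain c where c: "c > 0" "(LINT x|lborel. \<bar>indicator {x. c < \<bar>V x\<bar>} x * V x\<bar> powr (3 / 2)) < 1 / (8 * l * s)"
    and W: "integrable lborel (\<lambda>x. \<bar>indicator {x. c < \<bar>V x\<bar>} x * V x\<bar> powr (3 / 2))"
    using V_tail_small[of "1 / (8 * l * s)"] l s by auto
  define T where "T = max \<mu> (l * c)"
  have T: "T > 0" "\<mu> \<le> T" "l * c \<le> T" using mu_pos by (auto simp: T_def)
  define W where "W x = indicator {x. c < \<bar>V x\<bar>} x * V x" for x
  have [measurable]: "W \<in> borel_measurable borel" unfolding W_def by measurable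
  let ?w = "LINT x|lborel. \<bar>W x\<bar> powr (3 / 2)"
  have small: "l * (s * ?w + sobolev_const / s\<^sup>2) * 2 \<le> 1 / 2"
  proof -
    have "l * (s * ?w) \<le> l * (s * (1 / (8 * l * s)))" using c(2) l s unfolding W_def by (intro mult_left_mono) auto
    also have "\<dots> = 1 / 8" using l s by simp
    finally have 1: "l * (s * ?w) \<le> 1 / 8" .
    have "8 * (l * sobolev_const) \<le> s\<^sup>2" using s(2) by simp
    then have "l * (sobolev_const / s\<^sup>2) \<le> 1 / 8" using s(1) by (simp add: field_simps)
    moreover have "l * (x + y) * 2 \<le> 1 / 2" if "l * x \<le> 1 / 8" "l * y \<le> 1 / 8" for x y
      using that by (simp add: distrib_left)
    ultimately show ?thesis using 1 by blast
  qed
  have lV: "(\<lambda>x. l * V x) \<in> borel_measurable borel" by measurable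
  have "K_plus_nonneg \<mu> T (\<lambda>x. l * V x)"
    unfolding K_plus_nonneg_borel[OF lV]
  proof (intro allI impI)
    fix f g :: "real^3 \<Rightarrow> complex"
    assume [measurable]: "f \<in> borel_measurable borel" "g \<in> borel_measurable borel" and F: "is_fourier_L2 f g"
      and iK: "integrable lborel (\<lambda>p. K_radial \<mu> T (norm p) * (cmod (g p))\<^sup>2)"
      and ilV: "integrable lborel (\<lambda>x. l * V x * (cmod (f x))\<^sup>2)"
    define N where "N = (LINT p|lborel. K_radial \<mu> T (norm p) * (cmod (g p))\<^sup>2)"
    have L: "f \<in> L2 lborel" "g \<in> L2 lborel" using F by (simp_all add: is_fourier_L2_borel)
    have sq: "sqnorm lborel f = sqnorm lborel g" by (rule is_fourier_L2_sqnorm[OF _ _ F]) auto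
    have N0: "N \<ge> 0" unfolding N_def using K_radial_pos[OF T(1)] by (intro integral_nonneg_AE AE_I2) (simp add: less_imp_le)
    have Kb: "2 * T \<le> K_radial \<mu> T r" "r\<^sup>2 \<le> 2 * K_radial \<mu> T r" for r
      using K_energy_bounds(1,2)[OF T(1), of "r\<^sup>2 - \<mu>"] T(1,2) unfolding K_radial_def by linarith+
    have p1: "2 * T * (cmod (g p))\<^sup>2 \<le> K_radial \<mu> T (norm p) * (cmod (g p))\<^sup>2" for p
      by (rule mult_right_mono[OF Kb(1)]) simp
    have p2: "(norm p)\<^sup>2 * (cmod (g p))\<^sup>2 \<le> 2 * (K_radial \<mu> T (norm p) * (cmod (g p))\<^sup>2)" for p
      using mult_right_mono[OF Kb(2), of "(cmod (g p))\<^sup>2" "norm p"] by (simp add: mult.assoc)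
    have i2: "integrable lborel (\<lambda>p. 2 * (K_radial \<mu> T (norm p) * (cmod (g p))\<^sup>2))" using iK by auto
    have iD: "integrable lborel (\<lambda>p. (norm p)\<^sup>2 * (cmod (g p))\<^sup>2)"
    proof (rule Bochner_Integration.integrable_bound[OF i2])
      have "norm ((norm p)\<^sup>2 * (cmod (g p))\<^sup>2) \<le> norm (2 * (K_radial \<mu> T (norm p) * (cmod (g p))\<^sup>2))" for p
      proof -
        have "0 \<le> (norm p)\<^sup>2 * (cmod (g p))\<^sup>2" by simp
        then show ?thesis unfolding real_norm_def using p2[of p] by (simp only: abs_of_nonneg)
      qed
      then show "AE p in lborel. norm ((norm p)\<^sup>2 * (cmod (g p))\<^sup>2) \<le> norm (2 * (K_radial \<mu> T (norm p) * (cmod (g p))\<^sup>2))" by simp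
    qed simp_all
    have D: "(LINT p|lborel. (norm p)\<^sup>2 * (cmod (g p))\<^sup>2) \<le> 2 * N"
      using integral_mono[OF iD i2 p2] by (simp add: N_def)
    have sg: "2 * T * sqnorm lborel g \<le> N"
      using integral_mono[OF integrable_mult_right[OF L2_integrable_sq[OF L(2)]] iK p1] by (simp add: N_def sqnorm_def)
    have iW: "integrable lborel (\<lambda>x. \<bar>W x\<bar> powr (3 / 2))" using W by (simp add: W_def)
    note fb = form_bound[OF _ _ _ F iD iW s(1)]
    have iWf: "integrable lborel (\<lambda>x. \<bar>W x\<bar> * (cmod (f x))\<^sup>2)"
      using integrable_norm[OF fb(1)] by (simp add: abs_mult)
    have Wf: "(LINT x|lborel. \<bar>W x\<bar> * (cmod (f x))\<^sup>2) \<le> (s * ?w + sobolev_const / s\<^sup>2) * (2 * N)"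
    proof -
      have "(LINT x|lborel. \<bar>W x\<bar> * (cmod (f x))\<^sup>2) \<le> (s * ?w + sobolev_const / s\<^sup>2) * (LINT p|lborel. (norm p)\<^sup>2 * (cmod (g p))\<^sup>2)"
        by (rule fb(2)) auto
      also have "\<dots> \<le> (s * ?w + sobolev_const / s\<^sup>2) * (2 * N)"
        using s(1) sc by (intro mult_left_mono D add_nonneg_nonneg mult_nonneg_nonneg divide_nonneg_nonneg integral_nonneg_AE) auto
      finally show ?thesis .
    qed
    have pw: "- (c * (cmod (f x))\<^sup>2 + \<bar>W x\<bar> * (cmod (f x))\<^sup>2) \<le> V x * (cmod (f x))\<^sup>2" for x
    proof -
      have "- V x \<le> c + \<bar>W x\<bar>" using c(1) by (auto simp: W_def indicator_def abs_if)
      then have "- V x * (cmod (f x))\<^sup>2 \<le> (c + \<bar>W x\<bar>) * (cmod (f x))\<^sup>2" by (rule mult_right_mono) simp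
      then show ?thesis by (simp add: distrib_right)
    qed
    have "- (c * sqnorm lborel f + (LINT x|lborel. \<bar>W x\<bar> * (cmod (f x))\<^sup>2)) =
       (LINT x|lborel. - (c * (cmod (f x))\<^sup>2 + \<bar>W x\<bar> * (cmod (f x))\<^sup>2))"
      using L2_integrable_sq[OF L(1)] iWf by (simp add: sqnorm_def)
    also have "\<dots> \<le> (LINT x|lborel. V x * (cmod (f x))\<^sup>2)"
      using L2_integrable_sq[OF L(1)] iWf ilV l by (intro integral_mono pw) (auto simp: mult.assoc)
    finally have low: "- (c * sqnorm lborel f + (LINT x|lborel. \<bar>W x\<bar> * (cmod (f x))\<^sup>2)) \<le> (LINT x|lborel. V x * (cmod (f x))\<^sup>2)" .
    have "l * (c * sqnorm lborel f) \<le> N / 2"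
    proof -
      have "l * c * sqnorm lborel g \<le> T * sqnorm lborel g" using T(3) by (rule mult_right_mono) simp
      then show ?thesis using sg sq by simp
    qed
    moreover have "l * (LINT x|lborel. \<bar>W x\<bar> * (cmod (f x))\<^sup>2) \<le> N / 2"
    proof -
      have "l * (LINT x|lborel. \<bar>W x\<bar> * (cmod (f x))\<^sup>2) \<le> l * ((s * ?w + sobolev_const / s\<^sup>2) * (2 * N))"
        using l by (intro mult_left_mono Wf) auto
      also have "\<dots> = l * (s * ?w + sobolev_const / s\<^sup>2) * 2 * N" by simp
      also have "\<dots> \<le> 1 / 2 * N" by (rule mult_right_mono[OF small N0])
      finally show ?thesis by simp
    qed
    moreover have "l * - (c * sqnorm lborel f + (LINT x|lborel. \<bar>W x\<bar> * (cmod (f x))\<^sup>2)) \<le> l * (LINT x|lborel. V x * (cmod (f x))\<^sup>2)"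
      using low l by (intro mult_left_mono) auto
    ultimately have "- N \<le> l * (LINT x|lborel. V x * (cmod (f x))\<^sup>2)"
      unfolding mult_minus_right distrib_left by linarith
    then show "0 \<le> (LINT p|lborel. K_radial \<mu> T (norm p) * (cmod (g p))\<^sup>2) + (LINT x|lborel. l * V x * (cmod (f x))\<^sup>2)"
      by (simp add: N_def mult.assoc)
  qed
  then show ?thesis using that T(1) by blast
qed

section \<open>From the form to the critical temperature\<close>

lemma critical_temperature_ge:
  assumes l: "l > 0" and not: "\<And>T. 0 < T \<Longrightarrow> T < T0 \<Longrightarrow> \<not> K_plus_nonneg \<mu> T (\<lambda>x. l * V x)"
  shows "T0 \<le> critical_temperature \<mu> (\<lambda>x. l * V x)"
  unfolding critical_temperature_def
proof (rule cInf_greatest)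
  show "{T. T > 0 \<and> K_plus_nonneg \<mu> T (\<lambda>x. l * V x)} \<noteq> {}" using K_plus_nonneg_high[OF l] by blast
  show "T0 \<le> T" if "T \<in> {T. T > 0 \<and> K_plus_nonneg \<mu> T (\<lambda>x. l * V x)}" for T
    using that not[of T] by (auto simp: not_less[symmetric])
qed

lemma critical_temperature_le:
  assumes "T > 0" "K_plus_nonneg \<mu> T (\<lambda>x. l * V x)"
  shows "critical_temperature \<mu> (\<lambda>x. l * V x) \<le> T"
  unfolding critical_temperature_def
  by (rule cInf_lower) (use assms in \<open>auto intro: bdd_belowI[of _ 0]\<close>)

text \<open>Below \<open>exp (- \<theta> / l)\<close> one has
  \<open>l * ln (1 / T) \<ge> \<theta>\<close>. The minimum with \<open>T1\<close> accounts for the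
  low temperature that the trial state requires; for small \<open>l\<close> the exponential is the
  smaller of the two.\<close>

lemma critical_temperature_below:
  assumes neg: "num_inf < 0" and \<theta>: "\<theta> * (sqrt \<mu> * - num_inf) > 1"
  obtains T1 where "T1 > 0" "\<And>l. l > 0 \<Longrightarrow> min T1 (exp (- \<theta> / l)) \<le> critical_temperature \<mu> (\<lambda>x. l * V x)"
proof -
  obtain T1 where T1: "T1 > 0"
    "\<And>l T. 0 < l \<Longrightarrow> 0 < T \<Longrightarrow> T < T1 \<Longrightarrow> \<theta> \<le> l * ln (1 / T) \<Longrightarrow> \<not> K_plus_nonneg \<mu> T (\<lambda>x. l * V x)"
    using not_K_plus_nonneg_below[OF neg \<theta>] by blast
  have "min T1 (exp (- \<theta> / l)) \<le> critical_temperature \<mu> (\<lambda>x. l * V x)" if l: "l > 0" for l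
  proof (rule critical_temperature_ge[OF l])
    fix T :: real assume T: "0 < T" "T < min T1 (exp (- \<theta> / l))"
    have "ln T < ln (exp (- \<theta> / l))" using T by (subst ln_less_cancel_iff) auto
    then have "\<theta> / l \<le> ln (1 / T)" using T by (simp add: ln_div)
    then have "\<theta> \<le> l * ln (1 / T)" using l by (simp add: divide_le_eq mult.commute)
    then show "\<not> K_plus_nonneg \<mu> T (\<lambda>x. l * V x)" using T1(2)[OF l T(1)] T by simp
  qed
  then show ?thesis using that T1(1) by blast
qed

lemma critical_temperature_pos:
  assumes neg: "num_inf < 0" and l: "l > 0"
  shows "critical_temperature \<mu> (\<lambda>x. l * V x) > 0"
proof -
  have k: "sqrt \<mu> * - num_inf > 0" using mu_pos neg by (intro mult_pos_pos) auto
  \<comment> \<open>Any \<open>\<theta>\<close> that makes the product exceed 1 would serve; this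
    one makes it 2.\<close>
  have "2 / (sqrt \<mu> * - num_inf) * (sqrt \<mu> * - num_inf) = 2"
    by (rule nonzero_divide_eq_eq[THEN iffD1, OF _ refl, symmetric]) (use k in linarith)
  then have "2 / (sqrt \<mu> * - num_inf) * (sqrt \<mu> * - num_inf) > 1" by linarith
  from critical_temperature_below[OF neg this] obtain T1 where "T1 > 0"
    "min T1 (exp (- (2 / (sqrt \<mu> * - num_inf)) / l)) \<le> critical_temperature \<mu> (\<lambda>x. l * V x)"
    using l by metis
  then show ?thesis by (simp add: min_def split: if_splits) (meson exp_gt_zero less_le_trans)+
qed

text \<open>At \<open>T = exp (- \<theta> / l)\<close> the quantity \<open>l * ln (1 / T)\<close>
  equals \<open>\<theta>\<close>, so values of \<open>\<theta>\<close> on either side of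
  \<open>1 / \<kappa>\<close> squeeze the limit. Passing from \<open>ln (1 / T)\<close> to
  \<open>ln (\<mu> / T)\<close> costs only \<open>l * ln \<mu>\<close>, which tends to 0.\<close>

lemma critical_temperature_limit:
  assumes neg: "num_inf < 0"
  shows "((\<lambda>l. l * ln (\<mu> / critical_temperature \<mu> (\<lambda>x. l * V x))) \<longlongrightarrow> - 1 / (sqrt \<mu> * num_inf)) (at_right 0)"
proof -
  let ?Tc = "\<lambda>l. critical_temperature \<mu> (\<lambda>x. l * V x)"
  define \<kappa> where "\<kappa> = sqrt \<mu> * - num_inf"
  have k: "\<kappa> > 0" unfolding \<kappa>_def using mu_pos neg by (intro mult_pos_pos) auto
  have lim: "- 1 / (sqrt \<mu> * num_inf) = 1 / \<kappa>" by (simp add: \<kappa>_def)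
  have l0: "((\<lambda>l. l * ln \<mu>) \<longlongrightarrow> 0 * ln \<mu>) (at_right 0)" by (intro tendsto_intros)
  have pos: "\<forall>\<^sub>F l in at_right 0. (0::real) < l" by (rule eventually_at_right_less)
  have split: "l * ln (\<mu> / ?Tc l) = l * ln \<mu> - l * ln (?Tc l)" if "l > 0" for l
    using critical_temperature_pos[OF neg that] mu_pos by (simp add: ln_div right_diff_distrib)
  show ?thesis
    unfolding lim
  proof (rule order_tendstoI)
    fix a assume a: "a < 1 / \<kappa>"
    \<comment> \<open>The maximum with 0 yields a positive \<open>\<theta>\<close> even when
      \<open>a\<close> is negative.\<close>
    have "max a 0 < 1 / \<kappa>" using a k by simp
    then obtain \<theta> where "max a 0 < \<theta>" "\<theta> < 1 / \<kappa>" using dense by blast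
    then have \<theta>: "\<theta> > 0" "a < \<theta>" "\<theta> < 1 / \<kappa>" by auto
    have "\<theta> * \<kappa> < 1" using \<theta>(3) k by (simp add: pos_less_divide_eq)
    then have "\<theta> * (sqrt \<mu> * - num_inf) < 1" by (simp only: \<kappa>_def)
    from K_plus_nonneg_above[OF neg \<theta>(1) this] obtain L0 T1 where LT: "L0 > 0" "T1 > 0"
      "\<And>l T. 0 < l \<Longrightarrow> l < L0 \<Longrightarrow> 0 < T \<Longrightarrow> T < T1 \<Longrightarrow> l * ln (1 / T) \<le> \<theta> \<Longrightarrow> K_plus_nonneg \<mu> T (\<lambda>x. l * V x)" by blast
    have "\<forall>\<^sub>F l in at_right 0. l < L0" using LT(1) by (auto simp: eventually_at_right_field)
    moreover have "\<forall>\<^sub>F l in at_right 0. a - \<theta> < l * ln \<mu>" using order_tendstoD(1)[OF l0, of "a - \<theta>"] \<theta> by simp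
    ultimately show "\<forall>\<^sub>F l in at_right 0. a < l * ln (\<mu> / ?Tc l)"
      using pos exp_small[OF \<theta>(1) LT(2)]
    proof eventually_elim
      case (elim l)
      have "l * ln (1 / exp (- \<theta> / l)) = \<theta>" using elim(3) by (simp add: ln_div)
      then have "K_plus_nonneg \<mu> (exp (- \<theta> / l)) (\<lambda>x. l * V x)" using elim by (intro LT(3)) auto
      then have "?Tc l \<le> exp (- \<theta> / l)" by (intro critical_temperature_le) auto
      then have "ln (?Tc l) \<le> ln (exp (- \<theta> / l))"
        using critical_temperature_pos[OF neg elim(3)] by (subst ln_le_cancel_iff) auto
      then have "l * ln (?Tc l) \<le> l * (- \<theta> / l)" using elim(3) by (intro mult_left_mono) auto
      then have "l * ln (?Tc l) \<le> - \<theta>" using elim(3) by simp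
      then show ?case unfolding split[OF elim(3)] using elim(2) by linarith
    qed
  next
    fix b assume b: "1 / \<kappa> < b"
    obtain \<theta> where th: "1 / \<kappa> < \<theta>" "\<theta> < b" using dense[OF b] by blast
    have "0 < 1 / \<kappa>" using k by simp
    then have \<theta>: "\<theta> > 0" "\<theta> < b" "1 / \<kappa> < \<theta>" using th by linarith+
    have "1 < \<theta> * \<kappa>" using \<theta>(3) k by (simp add: pos_divide_less_eq)
    then have "1 < \<theta> * (sqrt \<mu> * - num_inf)" by (simp only: \<kappa>_def)
    from critical_temperature_below[OF neg this] obtain T1 where T1: "T1 > 0"
      "\<And>l. l > 0 \<Longrightarrow> min T1 (exp (- \<theta> / l)) \<le> ?Tc l" by blast
    have "\<forall>\<^sub>F l in at_right 0. l * ln \<mu> < b - \<theta>" using order_tendstoD(2)[OF l0, of "b - \<theta>"] \<theta> by simp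
    then show "\<forall>\<^sub>F l in at_right 0. l * ln (\<mu> / ?Tc l) < b"
      using pos exp_small[OF \<theta>(1) T1(1)]
    proof eventually_elim
      case (elim l)
      have "exp (- \<theta> / l) \<le> ?Tc l" using T1(2)[OF elim(2)] elim(3) by simp
      then have "ln (exp (- \<theta> / l)) \<le> ln (?Tc l)"
        using critical_temperature_pos[OF neg elim(2)] by (subst ln_le_cancel_iff) auto
      then have "l * (- \<theta> / l) \<le> l * ln (?Tc l)" using elim(2) by (intro mult_left_mono) auto
      then have "- \<theta> \<le> l * ln (?Tc l)" using elim(2) by simp
      then show ?case unfolding split[OF elim(2)] using elim(1) by linarith
    qed
  qed
qed

end

theorem theorem3p2:
  fixes V :: "real^3 \<Rightarrow> real" and \<mu> :: real
  assumes "V \<in> Lp_space (3 / 2) lebesgue \<inter> Lp_space 1 lebesgue"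
    and "\<mu> > 0"
    and "e_inf \<mu> V < 0"
  shows "(\<forall>l>0. critical_temperature \<mu> (\<lambda>x. l * V x) \<noteq> 0) \<and>
    ((\<lambda>l. l * ln (\<mu> / critical_temperature \<mu> (\<lambda>x. l * V x)))
      \<longlongrightarrow> - 1 / (sqrt \<mu> * e_inf \<mu> V)) (at_right 0)"
proof -
  have Vm: "V \<in> borel_measurable lebesgue"
    and V32: "integrable lebesgue (\<lambda>x. \<bar>V x\<bar> powr (3 / 2))" and V1: "integrable lebesgue (\<lambda>x. \<bar>V x\<bar> powr 1)"
    using assms(1) by (auto simp: Lp_space_def)
  \<comment> \<open>The locales ask for Borel measurability. Integrability, the Fourier transform of
    the potential and the energy form do not see null sets, so \<open>V\<close> may be replaced by
    \<open>W\<close> in both \<open>e_inf\<close> and the critical temperature.\<close>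
  obtain W where W[measurable]: "W \<in> borel_measurable borel" and ae: "AE x in lborel. V x = W x"
    using completion_ex_borel_measurable_real[OF Vm] by auto
  have ael: "AE x in lebesgue. V x = W x" using ae by (rule AE_completion)
  have Wm: "W \<in> borel_measurable lebesgue" by (rule measurable_completion) simp
  have powr: "integrable lborel (\<lambda>x. \<bar>W x\<bar> powr q)" if i: "integrable lebesgue (\<lambda>x. \<bar>V x\<bar> powr q)" for q
  proof -
    have "(\<lambda>x. \<bar>V x\<bar> powr q) \<in> borel_measurable lebesgue" using i by auto
    moreover have b: "(\<lambda>x. \<bar>W x\<bar> powr q) \<in> borel_measurable lborel" by simp
    moreover from b have "(\<lambda>x. \<bar>W x\<bar> powr q) \<in> borel_measurable lebesgue" by (rule measurable_completion)
    moreover have "AE x in lebesgue. \<bar>V x\<bar> powr q = \<bar>W x\<bar> powr q" using ael by eventually_elim simp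
    ultimately have "integrable lebesgue (\<lambda>x. \<bar>W x\<bar> powr q)" using i integrable_cong_AE by blast
    then show ?thesis unfolding integrable_completion[OF b] .
  qed
  interpret bcs_potential W \<mu>
  proof
    show "integrable lborel W"
      by (rule Bochner_Integration.integrable_bound[OF powr[OF V1]]) auto
  qed (use powr[OF V32] assms(2) in auto)
  have "fourier (\<lambda>x. complex_of_real (V x)) = fourier (\<lambda>x. complex_of_real (W x))"
  proof (rule ext, rule fourier_cong_AE)
    show "AE x in lebesgue. complex_of_real (V x) = complex_of_real (W x)" using ael by eventually_elim simp
  qed (use Vm Wm in auto)
  then have "sphere_op \<mu> V = sphere_op \<mu> W" by (intro ext) (simp add: sphere_op_def)
  then have e: "e_inf \<mu> V = num_inf" unfolding e_inf_eq[symmetric] by (simp add: e_inf_def)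
  have Tc: "critical_temperature \<mu> (\<lambda>x. l * V x) = critical_temperature \<mu> (\<lambda>x. l * W x)" for l
  proof -
    have m: "(\<lambda>x. l * V x) \<in> borel_measurable lebesgue" "(\<lambda>x. l * W x) \<in> borel_measurable lebesgue"
      using Vm Wm by auto
    have "AE x in lebesgue. l * V x = l * W x" "AE x in lebesgue. l * W x = l * V x"
      using ael by (eventually_elim, simp)+
    then have "K_plus_nonneg \<mu> T (\<lambda>x. l * V x) \<longleftrightarrow> K_plus_nonneg \<mu> T (\<lambda>x. l * W x)" for T
      using K_plus_nonneg_cong_AE m by blast
    then show ?thesis by (simp add: critical_temperature_def)
  qed
  show ?thesis
    unfolding Tc e using critical_temperature_pos critical_temperature_limit assms(3) unfolding e
    by (auto simp: less_le)
qed

end
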